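(* Let $N\ge1$, let $Q\in\mathcal B^{N\times N}$ with $\mathrm{trace}\,Q=0$ (pointwise on the unit circle), and let $a\in\mathcal B$. Then $$\det\big(T(e^{aI_N+Q})\,e^{-T(aI_N+Q)}\big)=\exp\Big(\tfrac N2\,\mathrm{trace}\,H(a)H(\tilde a)\Big)\cdot\det\big(T(e^Q)\,e^{-T(Q)}\big).$$
   Context: $\mathcal B$ is the Banach algebra of all functions $\phi\in L^1(\mathbb T)$ on the unit circle $\mathbb T$ whose Fourier coefficients $\phi_k=\frac1{2\pi}\int_0^{2\pi}\phi(e^{ix})e^{-ikx}dx$ satisfy $$\|\phi\|_{\mathcal B}:=\sum_{k\in\mathbb Z}|\phi_k|+\Big(\sum_{k\in\mathbb Z}|k|\,|\phi_k|^2\Big)^{1/2}<\infty,$$ with pointwise operations; its elements are continuous functions. $\mathcal B^{N\times N}$ is the algebra of $N\times N$ matrix functions with entries in $\mathcal B$, and $I_N$ is the $N\times N$ identity matrix. For $\phi\in L^\infty(\mathbb T)^{N\times N}$ the Toeplitz and Hankel operators on $(\ell^2(\mathbb Z_+))^N$, $\mathbb Z_+=\{0,1,2,\dots\}$, are $T(\phi)=(\phi_{j-k})_{j,k\ge0}$ and $H(\phi)=(\phi_{j+k+1})_{j,k\ge0}$. Also $\tilde a(e^{ix})=a(e^{-ix})$. Hankel operators with symbols in $\mathcal B$ are Hilbert–Schmidt. For $R\in\mathcal B^{N\times N}$ the operator $T(e^R)e^{-T(R)}$ is the identity plus a trace class operator, so its operator (Fredholm) determinant is well defined. *)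

theory Defs
  imports "HOL-Analysis.Analysis"
begin

section \<open>The Hilbert space of square-summable families\<close>

typedef 'i ell2 = "{x :: 'i \<Rightarrow> complex. (\<lambda>i. (cmod (x i))\<^sup>2) summable_on UNIV}"
  morphisms ell2_coord Abs_ell2
  by (rule exI[of _ "\<lambda>_. 0"]) simp

setup_lifting type_definition_ell2

lemma ell2_coord_summable: "(\<lambda>i. (cmod (ell2_coord x i))\<^sup>2) summable_on UNIV"
  using ell2_coord[of x] by simp

lemma ell2_inner_summable:
  fixes x y :: "'i \<Rightarrow> complex"
  assumes "(\<lambda>i. (cmod (x i))\<^sup>2) summable_on UNIV" "(\<lambda>i. (cmod (y i))\<^sup>2) summable_on UNIV"
  shows "(\<lambda>i. x i \<bullet> y i) summable_on UNIV"
proof (rule abs_summable_summable, rule summable_on_comparison_test)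
  show "(\<lambda>i. (cmod (x i))\<^sup>2 + (cmod (y i))\<^sup>2) summable_on UNIV"
    using assms by (rule summable_on_add)
  fix i
  have "norm (x i \<bullet> y i) \<le> cmod (x i) * cmod (y i)"
    using Cauchy_Schwarz_ineq2[of "x i" "y i"] by simp
  also have "\<dots> \<le> (cmod (x i))\<^sup>2 + (cmod (y i))\<^sup>2"
    using sum_squares_bound[of "cmod (x i)" "cmod (y i)"]
      mult_nonneg_nonneg[OF norm_ge_zero[of "x i"] norm_ge_zero[of "y i"]] by linarith
  finally show "norm (x i \<bullet> y i) \<le> (cmod (x i))\<^sup>2 + (cmod (y i))\<^sup>2" .
qed simp_all

lemma ell2_add_summable:
  fixes x y :: "'i \<Rightarrow> complex"
  assumes "(\<lambda>i. (cmod (x i))\<^sup>2) summable_on UNIV" "(\<lambda>i. (cmod (y i))\<^sup>2) summable_on UNIV"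
  shows "(\<lambda>i. (cmod (x i + y i))\<^sup>2) summable_on UNIV"
proof -
  have "(\<lambda>i. (cmod (x i))\<^sup>2 + 2 * (x i \<bullet> y i) + (cmod (y i))\<^sup>2) summable_on UNIV"
    by (intro summable_on_add summable_on_cmult_right assms ell2_inner_summable)
  moreover have "(cmod (x i + y i))\<^sup>2 = (cmod (x i))\<^sup>2 + 2 * (x i \<bullet> y i) + (cmod (y i))\<^sup>2" for i
    unfolding power2_norm_eq_inner inner_add_left inner_add_right inner_commute[of "y i" "x i"]
    by simp
  ultimately show ?thesis by simp
qed

lemma ell2_scaleR_summable:
  fixes x :: "'i \<Rightarrow> complex"
  assumes "(\<lambda>i. (cmod (x i))\<^sup>2) summable_on UNIV"
  shows "(\<lambda>i. (cmod (r *\<^sub>R x i))\<^sup>2) summable_on UNIV"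
  using summable_on_cmult_right[OF assms, of "r\<^sup>2"] by (simp add: power_mult_distrib)

instantiation ell2 :: (type) real_vector
begin
lift_definition zero_ell2 :: "'a ell2" is "\<lambda>_. 0" by simp
lift_definition plus_ell2 :: "'a ell2 \<Rightarrow> 'a ell2 \<Rightarrow> 'a ell2" is "\<lambda>x y i. x i + y i"
  by (simp add: ell2_add_summable)
lift_definition uminus_ell2 :: "'a ell2 \<Rightarrow> 'a ell2" is "\<lambda>x i. - x i" by simp
lift_definition minus_ell2 :: "'a ell2 \<Rightarrow> 'a ell2 \<Rightarrow> 'a ell2" is "\<lambda>x y i. x i - y i"
  using ell2_add_summable[where y = "\<lambda>i. - y i" for y] by simp
lift_definition scaleR_ell2 :: "real \<Rightarrow> 'a ell2 \<Rightarrow> 'a ell2" is "\<lambda>r x i. r *\<^sub>R x i"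
  using ell2_scaleR_summable by simp
instance
  by standard (transfer; simp add: fun_eq_iff algebra_simps)+
end

(* The real part of the sesquilinear inner product, since real_inner is a class of
   real spaces; norm and topology are the usual ones of the complex Hilbert space. *)
instantiation ell2 :: (type) real_inner
begin
definition inner_ell2 :: "'a ell2 \<Rightarrow> 'a ell2 \<Rightarrow> real" where
  "inner_ell2 x y = (\<Sum>\<^sub>\<infinity>i. ell2_coord x i \<bullet> ell2_coord y i)"
definition norm_ell2 :: "'a ell2 \<Rightarrow> real" where
  "norm_ell2 x = sqrt (x \<bullet> x)"
definition sgn_ell2 :: "'a ell2 \<Rightarrow> 'a ell2" where
  "sgn_ell2 x = inverse (norm x) *\<^sub>R x"
definition dist_ell2 :: "'a ell2 \<Rightarrow> 'a ell2 \<Rightarrow> real" where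
  "dist_ell2 x y = norm (x - y)"
definition uniformity_ell2 :: "('a ell2 \<times> 'a ell2) filter" where
  "uniformity_ell2 = (INF e\<in>{0<..}. principal {(x, y). dist x y < e})"
definition open_ell2 :: "'a ell2 set \<Rightarrow> bool" where
  "open_ell2 U = (\<forall>x\<in>U. \<forall>\<^sub>F (x', y) in uniformity. x' = x \<longrightarrow> y \<in> U)"
instance
proof
  fix x y z :: "'a ell2" and r :: real
  note s = ell2_inner_summable[OF ell2_coord_summable ell2_coord_summable]
  show "x \<bullet> y = y \<bullet> x" by (simp add: inner_ell2_def inner_commute)
  show "(x + y) \<bullet> z = x \<bullet> z + y \<bullet> z"
    by (simp add: inner_ell2_def plus_ell2.rep_eq inner_add_left infsum_add s)
  show "(r *\<^sub>R x) \<bullet> y = r * (x \<bullet> y)"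
    by (simp add: inner_ell2_def scaleR_ell2.rep_eq infsum_cmult_right')
  show "0 \<le> x \<bullet> x" by (simp add: inner_ell2_def infsum_nonneg)
  show "(x \<bullet> x = 0) = (x = 0)"
  proof
    assume "x \<bullet> x = 0"
    then have "ell2_coord x i \<bullet> ell2_coord x i = 0" for i
      using nonneg_infsum_le_0D[of "\<lambda>i. ell2_coord x i \<bullet> ell2_coord x i" UNIV i] s[of x x]
      by (simp add: inner_ell2_def)
    then show "x = 0"
      by (simp add: ell2_coord_inject[symmetric] zero_ell2.rep_eq fun_eq_iff)
  qed (simp add: inner_ell2_def zero_ell2.rep_eq)
qed (simp_all add: sgn_ell2_def dist_ell2_def norm_ell2_def uniformity_ell2_def open_ell2_def)
end

lemma ell2_norm_sq: "(norm x)\<^sup>2 = (\<Sum>\<^sub>\<infinity>i. (cmod (ell2_coord x i))\<^sup>2)"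
  by (simp add: power2_norm_eq_inner inner_ell2_def)

lemma ell2_sum_le_norm_sq:
  assumes "finite F"
  shows "(\<Sum>i\<in>F. (cmod (ell2_coord x i))\<^sup>2) \<le> (norm x)\<^sup>2"
  unfolding ell2_norm_sq by (rule finite_sum_le_infsum[OF ell2_coord_summable assms]) simp_all

lemma ell2_coord_le_norm: "cmod (ell2_coord x i) \<le> norm x"
  by (rule power2_le_imp_le) (use ell2_sum_le_norm_sq[of "{i}" x] in simp_all)

instance ell2 :: (type) banach
proof
  fix X :: "nat \<Rightarrow> 'a ell2"
  assume X: "Cauchy X"
  have "Cauchy (\<lambda>n. ell2_coord (X n) i)" for i
  proof (rule metric_CauchyI)
    fix e :: real assume "0 < e"
    then obtain M where M: "\<forall>m\<ge>M. \<forall>n\<ge>M. norm (X m - X n) < e"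
      using CauchyD[OF X \<open>0 < e\<close>] by auto
    have "dist (ell2_coord (X m) i) (ell2_coord (X n) i) < e" if "m \<ge> M" "n \<ge> M" for m n
    proof -
      have "norm (X m - X n) < e" using M that by blast
      then show ?thesis using ell2_coord_le_norm[of "X m - X n" i]
        by (simp add: dist_norm minus_ell2.rep_eq)
    qed
    then show "\<exists>M. \<forall>m\<ge>M. \<forall>n\<ge>M. dist (ell2_coord (X m) i) (ell2_coord (X n) i) < e" by blast
  qed
  then have "(\<lambda>n. ell2_coord (X n) i) \<longlonglongrightarrow> lim (\<lambda>n. ell2_coord (X n) i)" for i
    by (simp add: Cauchy_convergent_iff convergent_LIMSEQ_iff[symmetric])
  then obtain l where l: "\<And>i. (\<lambda>n. ell2_coord (X n) i) \<longlonglongrightarrow> l i"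
    by (rule that)
  have bound: "(\<Sum>i\<in>F. (cmod (ell2_coord (X n) i - l i))\<^sup>2) \<le> e\<^sup>2"
    if M: "\<forall>m\<ge>M. \<forall>n\<ge>M. norm (X m - X n) < e" and "n \<ge> M" "finite F" for M n e F
  proof (rule Lim_bounded)
    show "(\<lambda>m. \<Sum>i\<in>F. (cmod (ell2_coord (X n) i - ell2_coord (X m) i))\<^sup>2)
            \<longlonglongrightarrow> (\<Sum>i\<in>F. (cmod (ell2_coord (X n) i - l i))\<^sup>2)"
      by (intro tendsto_intros l)
    show "\<forall>m\<ge>M. (\<Sum>i\<in>F. (cmod (ell2_coord (X n) i - ell2_coord (X m) i))\<^sup>2) \<le> e\<^sup>2"
    proof (intro allI impI)
      fix m assume "m \<ge> M"
      then have "norm (X n - X m) \<le> e" using M \<open>n \<ge> M\<close> by (simp add: less_imp_le)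
      then have "(norm (X n - X m))\<^sup>2 \<le> e\<^sup>2" by (intro power_mono) simp_all
      then show "(\<Sum>i\<in>F. (cmod (ell2_coord (X n) i - ell2_coord (X m) i))\<^sup>2) \<le> e\<^sup>2"
        using ell2_sum_le_norm_sq[OF \<open>finite F\<close>, of "X n - X m"]
        by (simp add: minus_ell2.rep_eq)
    qed
  qed
  have summ: "(\<lambda>i. (cmod (ell2_coord (X n) i - l i))\<^sup>2) summable_on UNIV"
    if M: "\<forall>m\<ge>M. \<forall>n\<ge>M. norm (X m - X n) < e" and "n \<ge> M" for M n e
    by (rule nonneg_bdd_above_summable_on) (use bound[OF that] in \<open>auto intro!: bdd_aboveI2\<close>)
  obtain M1 where M1: "\<forall>m\<ge>M1. \<forall>n\<ge>M1. norm (X m - X n) < 1"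
    using CauchyD[OF X, of 1] by auto
  have "(\<lambda>i. (cmod (l i))\<^sup>2) summable_on UNIV"
    using ell2_add_summable[OF ell2_coord_summable[of "X M1"], of "\<lambda>i. - (ell2_coord (X M1) i - l i)"]
      summ[OF M1, of M1] by (simp add: norm_minus_commute)
  then have L: "ell2_coord (Abs_ell2 l) = l" by (simp add: Abs_ell2_inverse)
  have "X \<longlonglongrightarrow> Abs_ell2 l"
  proof (rule LIMSEQ_I)
    fix r :: real assume "0 < r"
    then obtain M where M: "\<forall>m\<ge>M. \<forall>n\<ge>M. norm (X m - X n) < r / 2"
      using CauchyD[OF X, of "r / 2"] by auto
    have "norm (X n - Abs_ell2 l) < r" if "n \<ge> M" for n
    proof -
      have "(norm (X n - Abs_ell2 l))\<^sup>2 \<le> (r / 2)\<^sup>2"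
        unfolding ell2_norm_sq minus_ell2.rep_eq L
        by (rule infsum_le_finite_sums[OF summ[OF M that]]) (use bound[OF M that] in auto)
      then have "norm (X n - Abs_ell2 l) \<le> r / 2"
        by (rule power2_le_imp_le) (use \<open>0 < r\<close> in simp)
      with \<open>0 < r\<close> show ?thesis by simp
    qed
    then show "\<exists>M. \<forall>n\<ge>M. norm (X n - Abs_ell2 l) < r" by blast
  qed
  then show "convergent X" by (auto simp: convergent_def)
qed


section \<open>Exponential, trace and Fredholm determinant of operators\<close>

definition op_exp :: "('a::real_normed_vector \<Rightarrow>\<^sub>L 'a) \<Rightarrow> ('a \<Rightarrow>\<^sub>L 'a)" where
  "op_exp A = (\<Sum>n. ((\<lambda>B. A o\<^sub>L B) ^^ n) id_blinfun /\<^sub>R fact n)"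

definition ell2_basis :: "'i \<Rightarrow> 'i ell2" where
  "ell2_basis i = Abs_ell2 (\<lambda>j. if j = i then 1 else 0)"

definition op_entry :: "('i ell2 \<Rightarrow>\<^sub>L 'i ell2) \<Rightarrow> 'i \<Rightarrow> 'i \<Rightarrow> complex" where
  "op_entry A i j = ell2_coord (blinfun_apply A (ell2_basis j)) i"

definition op_trace :: "('i ell2 \<Rightarrow>\<^sub>L 'i ell2) \<Rightarrow> complex" where
  "op_trace A = (\<Sum>\<^sub>\<infinity>i. op_entry A i i)"

(* Fredholm's expansion: for A = I + K with K trace class,
     det A = (SUM n. trace of the n-th exterior power of K)
           = (SUM n. 1/n! * SUM i1..in. det (K ip iq)),
   and by symmetry the inner sum counts every n-element set S of indices n! times, tuples
   with repetitions contributing 0. What remains is the absolutely convergent sum of all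
   finite principal minors of K (the empty one being 1), each given by Leibniz' formula. *)
definition fredholm_det :: "('i ell2 \<Rightarrow>\<^sub>L 'i ell2) \<Rightarrow> complex" where
  "fredholm_det A =
     (\<Sum>\<^sub>\<infinity>S\<in>{S. finite S}. \<Sum>p\<in>{p. p permutes S}.
        of_int (sign p) * (\<Prod>i\<in>S. op_entry (A - id_blinfun) i (p i)))"


section \<open>The algebra of symbols\<close>

(* Functions on the unit circle are functions on the complex numbers of which only the
   values on the circle matter. *)

definition fourier_coeff :: "(complex \<Rightarrow> complex) \<Rightarrow> int \<Rightarrow> complex" where
  "fourier_coeff \<phi> k =
     integral {0..2*pi} (\<lambda>x. \<phi> (cis x) * cis (- (of_int k * x))) / (2 * pi)"

definition B_alg :: "(complex \<Rightarrow> complex) set" where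
  "B_alg = {\<phi>. (\<lambda>x. \<phi> (cis x)) absolutely_integrable_on {0..2*pi}
      \<and> (\<lambda>k. cmod (fourier_coeff \<phi> k)) summable_on UNIV
      \<and> (\<lambda>k. \<bar>of_int k\<bar> * (cmod (fourier_coeff \<phi> k))\<^sup>2) summable_on UNIV}"

definition B_mat :: "(complex \<Rightarrow> complex^'n^'n) set" where
  "B_mat = {\<Phi>. \<forall>i j. (\<lambda>z. \<Phi> z $ i $ j) \<in> B_alg}"

definition circle_reflect :: "(complex \<Rightarrow> complex) \<Rightarrow> complex \<Rightarrow> complex" where
  "circle_reflect a z = a (cnj z)"

(* The matrix exponential, applied to matrix functions pointwise. The multiplication of the
   type of matrices being the entrywise one, powers are spelled out with the matrix product. *)
definition mat_exp :: "complex^'n^'n \<Rightarrow> complex^'n^'n" where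
  "mat_exp A = (\<Sum>k. (((**) A) ^^ k) (mat 1) /\<^sub>R fact k)"


section \<open>Toeplitz and Hankel operators\<close>

(* The space of N-tuples of square-summable sequences is taken as the square-summable
   families over nat \<times> 'n. Blinfun and Abs_ell2 are only meaningful for bounded operators and
   square-summable families, which is the case for all symbols with absolutely summable
   Fourier coefficients. *)
definition toeplitz :: "(complex \<Rightarrow> complex^'n^'n) \<Rightarrow> ((nat \<times> 'n) ell2 \<Rightarrow>\<^sub>L (nat \<times> 'n) ell2)" where
  "toeplitz \<Phi> = Blinfun (\<lambda>x. Abs_ell2 (\<lambda>(j, r). \<Sum>\<^sub>\<infinity>(k, s).
      fourier_coeff (\<lambda>z. \<Phi> z $ r $ s) (int j - int k) * ell2_coord x (k, s)))"

definition hankel :: "(complex \<Rightarrow> complex) \<Rightarrow> (nat ell2 \<Rightarrow>\<^sub>L nat ell2)" where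
  "hankel \<phi> = Blinfun (\<lambda>x. Abs_ell2 (\<lambda>j. \<Sum>\<^sub>\<infinity>k.
      fourier_coeff \<phi> (int j + int k + 1) * ell2_coord x k))"

end

theory Submission
  imports Defs "HOL-Complex_Analysis.Complex_Analysis" "Jordan_Normal_Form.Determinant"
    "HOL-Combinatorics.Multiset_Permutations"
begin

text \<open>Hadamard's inequality makes the series of principal minors converge for nuclear perturbations
  of the identity, and truncation to finite matrices makes the resulting determinant multiplicative.
  The analytic core is the formula \<open>det (e\<^sup>A e\<^sup>B e\<^bsup>-(A+B)\<^esup>) = exp (tr [A, B] / 2)\<close> for a nuclear
  commutator \<open>[A, B]\<close>: up to powers of the determinant of the group commutator of \<open>e\<^bsup>A/n\<^esup>\<close> and
  \<open>e\<^bsup>B/n\<^esup>\<close>, which is known to first order, the left-hand side is the \<open>n\<close>-th power of the same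
  expression in \<open>A/n\<close> and \<open>B/n\<close>, and \<open>n\<close> tends to infinity. Splitting \<open>a = a\<^sub>- + a\<^sub>+\<close> into negative
  and nonnegative frequencies gives \<open>T(e\<^bsup>aI+Q\<^esup>) = e\<^bsup>T(a\<^sub>-)\<^esup> T(e\<^sup>Q) e\<^bsup>T(a\<^sub>+)\<^esup>\<close>. Two applications of
  the formula then leave half the traces of the commutators of \<open>T(a\<^sub>-)\<close>, \<open>T(Q)\<close> and \<open>T(a\<^sub>+)\<close>; those
  with \<open>T(Q)\<close> vanish because \<open>Q\<close> is traceless, and the remaining one is \<open>N tr H(a)H(a~)\<close>.\<close>

hide_const (open) Matrix.mat Matrix.vec Determinant.det Matrix.row Matrix.col Matrix.transpose_mat
no_notation Matrix.vec_index (infixl "$" 100)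

section \<open>Hadamard's inequality\<close>

text \<open>\<open>fredholm_det\<close> is a bare series of principal minors, so summability,
  continuity and multiplicativity all have to come from bounds on minors that are uniform in the
  matrix size. These bounds are attached to explicit rank-one expansions, which avoids singular
  values. Neither \<open>T(e^R)\<close> nor \<open>e^{-T(R)}\<close> need have a determinant by
  itself; determinants are only taken of products whose difference from the identity is nuclear, and
  all rearrangements are conjugations, under which the determinant is invariant. In the formula for
  \<open>e^A e^B e^{-(A+B)}\<close> the factor 1/2 is the limit of (n(n-1)/2)/n^2: collecting n-th
  powers produces n(n-1)/2 group commutators, each of determinant 1 + tr[A,B]/n^2 up to O(n^{-3}).
  Toeplitz operators are compressions of doubly infinite Laurent operators, where symbols multiply
  without error; \<open>T(e^R)\<close> is then the compression of an operator exponential, and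
  Hankel operators are the off-diagonal corners. Elements of the symbol algebra are given as
  integrable functions, so they first have to be identified almost everywhere with their Fourier
  series.\<close>

definition nlists :: "nat \<Rightarrow> 'a set \<Rightarrow> 'a list set" where
  "nlists n A = {xs. set xs \<subseteq> A \<and> length xs = n}"

lemma finite_nlists: "finite A \<Longrightarrow> finite (nlists n A)"
  unfolding nlists_def by (rule finite_lists_length_eq)

lemma nlists_0 [simp]: "nlists 0 A = {[]}"
  by (auto simp: nlists_def)

lemma sum_nlists_Suc:
  "(\<Sum>xs\<in>nlists (Suc n) A. f xs) = (\<Sum>x\<in>A. \<Sum>xs\<in>nlists n A. f (x # xs))"
proof -
  have "(\<Sum>xs\<in>nlists (Suc n) A. f xs) = (\<Sum>(x, xs)\<in>A \<times> nlists n A. f (x # xs))"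
    by (rule sum.reindex_bij_witness[where i = "\<lambda>(x, xs). x # xs" and j = "\<lambda>xs. (hd xs, tl xs)"])
       (auto simp: nlists_def length_Suc_conv)
  then show ?thesis by (simp add: sum.cartesian_product)
qed

lemma sum_nlists_prod:
  fixes f :: "nat \<Rightarrow> 'a \<Rightarrow> 'b::comm_semiring_1"
  shows "(\<Sum>xs\<in>nlists n A. \<Prod>p<n. f p (xs ! p)) = (\<Prod>p<n. \<Sum>x\<in>A. f p x)"
proof (induction n arbitrary: f)
  case (Suc n)
  have "(\<Sum>xs\<in>nlists (Suc n) A. \<Prod>p<Suc n. f p (xs ! p))
      = (\<Sum>x\<in>A. \<Sum>xs\<in>nlists n A. f 0 x * (\<Prod>p<n. f (Suc p) (xs ! p)))"
    by (simp add: sum_nlists_Suc prod.lessThan_Suc_shift del: prod.lessThan_Suc)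
  also have "\<dots> = (\<Sum>x\<in>A. f 0 x) * (\<Prod>p<n. \<Sum>x\<in>A. f (Suc p) x)"
    by (simp add: Suc.IH[of "\<lambda>p. f (Suc p)", symmetric] sum_product)
  also have "\<dots> = (\<Prod>p<Suc n. \<Sum>x\<in>A. f p x)"
    by (simp add: prod.lessThan_Suc_shift del: prod.lessThan_Suc)
  finally show ?case .
qed simp

text \<open>A Slater determinant: the coefficient at the tuple \<open>xs\<close> of the wedge
  product of \<open>w 0\<close>, ..., \<open>w (n - 1)\<close>. Working with tuples instead of sets
  avoids any ordering of the index type.\<close>

definition slater :: "nat \<Rightarrow> (nat \<Rightarrow> 'a \<Rightarrow> complex) \<Rightarrow> 'a list \<Rightarrow> complex" where
  "slater n w xs = Determinant.det (Matrix.mat n n (\<lambda>(i, p). w p (xs ! i)))"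

definition del_nth :: "nat \<Rightarrow> 'a list \<Rightarrow> 'a list" where
  "del_nth q xs = take q xs @ drop (Suc q) xs"

text \<open>Moving the \<open>q\<close>-th entry to the front is a cycle of sign
  \<open>(-1) ^ q\<close>. It reduces each term of a Laplace expansion to the term for
  \<open>q = 0\<close>.\<close>

definition to_front :: "nat \<Rightarrow> 'a list \<Rightarrow> 'a list" where
  "to_front q xs = xs ! q # del_nth q xs"

lemma nth_del_nth:
  "q < length xs \<Longrightarrow> i < length xs - 1 \<Longrightarrow> del_nth q xs ! i = xs ! (if i < q then i else Suc i)"
  by (simp add: del_nth_def nth_append)

lemma slater_laplace:
  assumes "length xs = Suc n"
  shows "slater (Suc n) w xs
       = (\<Sum>q<Suc n. (-1) ^ q * w 0 (xs ! q) * slater n (\<lambda>p. w (Suc p)) (del_nth q xs))"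
proof -
  let ?A = "Matrix.mat (Suc n) (Suc n) (\<lambda>(i, p). w p (xs ! i))"
  have "slater (Suc n) w xs = (\<Sum>q<Suc n. ?A $$ (q, 0) * cofactor ?A q 0)"
    unfolding slater_def by (rule laplace_expansion_column) auto
  also have "\<dots> = (\<Sum>q<Suc n. (-1) ^ q * w 0 (xs ! q) * slater n (\<lambda>p. w (Suc p)) (del_nth q xs))"
  proof (rule sum.cong[OF refl])
    fix q assume q: "q \<in> {..<Suc n}"
    have "mat_delete ?A q 0 = Matrix.mat n n (\<lambda>(i, p). w (Suc p) (del_nth q xs ! i))"
      using q assms by (auto simp: mat_delete_def nth_del_nth intro!: eq_matI)
    then show "?A $$ (q, 0) * cofactor ?A q 0
        = (-1) ^ q * w 0 (xs ! q) * slater n (\<lambda>p. w (Suc p)) (del_nth q xs)"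
      using q by (simp add: cofactor_def slater_def)
  qed
  finally show ?thesis .
qed

lemma slater_to_front:
  assumes "length xs = n" "q < n"
  shows "slater n w (to_front q xs) = (-1) ^ q * slater n w xs"
proof -
  let ?A = "Matrix.mat n n (\<lambda>(i, p). w p (xs ! i))"
  have "swap_row_to_front ?A q = Matrix.mat n n (\<lambda>(i, p). w p (to_front q xs ! i))"
    by (subst swap_row_to_front_result[of _ n n])
       (use assms in \<open>auto simp: to_front_def nth_del_nth nth_Cons' intro!: eq_matI\<close>)
  then show ?thesis
    using swap_row_to_front_det[of ?A n q] assms by (simp add: slater_def)
qed

lemma sum_to_front:
  assumes "q < n"
  shows "(\<Sum>xs\<in>nlists n A. f (to_front q xs)) = (\<Sum>xs\<in>nlists n A. f xs)"
proof (rule sum.reindex_bij_witness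
    [where j = "to_front q" and i = "\<lambda>ys. take q (tl ys) @ hd ys # drop q (tl ys)"])
  fix xs assume xs: "xs \<in> nlists n A"
  then show "take q (tl (to_front q xs)) @ hd (to_front q xs) # drop q (tl (to_front q xs)) = xs"
    using assms by (simp add: nlists_def to_front_def del_nth_def id_take_nth_drop[symmetric])
  show "to_front q xs \<in> nlists n A"
    using xs assms set_take_subset[of q xs] set_drop_subset[of "Suc q" xs]
    by (auto simp: nlists_def to_front_def del_nth_def)
next
  fix ys assume ys: "ys \<in> nlists n A"
  then obtain z zs where zs: "ys = z # zs"
    using assms by (cases ys) (auto simp: nlists_def)
  show "to_front q (take q (tl ys) @ hd ys # drop q (tl ys)) = ys"
    using ys assms by (simp add: zs nlists_def to_front_def del_nth_def nth_append)
  show "take q (tl ys) @ hd ys # drop q (tl ys) \<in> nlists n A"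
    using ys assms set_take_subset[of q zs] set_drop_subset[of q zs]
    by (auto simp: zs nlists_def)
qed simp

text \<open>In the language of exterior algebra: the creation operator of a vector \<open>w\<close> has norm \<open>\<parallel>w\<parallel>\<close>.\<close>

lemma slater_step:
  assumes "finite A"
  shows "(\<Sum>xs\<in>nlists (Suc n) A. (cmod (slater (Suc n) w xs))\<^sup>2)
       \<le> Suc n * (\<Sum>x\<in>A. (cmod (w 0 x))\<^sup>2)
          * (\<Sum>xs\<in>nlists n A. (cmod (slater n (\<lambda>p. w (Suc p)) xs))\<^sup>2)"
proof -
  let ?L = "nlists (Suc n) A" and ?\<psi> = "slater n (\<lambda>p. w (Suc p))" and ?\<Phi> = "slater (Suc n) w"
  define c where "c = (\<Sum>x\<in>A. \<Sum>ys\<in>nlists n A. w 0 x * ?\<psi> ys * cnj (?\<Phi> (x # ys)))"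
  have "(\<Sum>xs\<in>?L. ?\<Phi> xs * cnj (?\<Phi> xs))
      = (\<Sum>q<Suc n. \<Sum>xs\<in>?L. (-1) ^ q * w 0 (xs ! q) * ?\<psi> (del_nth q xs) * cnj (?\<Phi> xs))"
    by (subst sum.swap, intro sum.cong refl, subst slater_laplace)
       (simp_all add: nlists_def sum_distrib_right del: sum.lessThan_Suc)
  \<comment> \<open>Moving \<open>xs ! q\<close> to the front multiplies the conjugated determinant
    by \<open>(-1) ^ q\<close>, which cancels the Laplace sign, so that all \<open>Suc n\<close>
    terms agree.\<close>
  also have "\<dots> = (\<Sum>q<Suc n. c)"
  proof (rule sum.cong[OF refl])
    fix q assume q: "q \<in> {..<Suc n}"
    have "(\<Sum>xs\<in>?L. (-1) ^ q * w 0 (xs ! q) * ?\<psi> (del_nth q xs) * cnj (?\<Phi> xs))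
        = (\<Sum>xs\<in>?L. (\<lambda>ys. w 0 (hd ys) * ?\<psi> (tl ys) * cnj (?\<Phi> ys)) (to_front q xs))"
      using q by (intro sum.cong refl, subst slater_to_front)
        (simp_all add: nlists_def to_front_def)
    also have "\<dots> = (\<Sum>ys\<in>?L. w 0 (hd ys) * ?\<psi> (tl ys) * cnj (?\<Phi> ys))"
      using q by (intro sum_to_front) simp
    finally show "(\<Sum>xs\<in>?L. (-1) ^ q * w 0 (xs ! q) * ?\<psi> (del_nth q xs) * cnj (?\<Phi> xs)) = c"
      by (simp add: sum_nlists_Suc c_def)
  qed
  finally have 1: "(\<Sum>xs\<in>?L. ?\<Phi> xs * cnj (?\<Phi> xs)) = of_nat (Suc n) * c"
    by simp
  \<comment> \<open>\<open>d\<close> is the correction in the anticommutation relation of creation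
    and annihilation by \<open>w 0\<close>: expanding the determinant at \<open>x # ys\<close> once
    more yields the product of the squared norms minus \<open>d\<close>.\<close>
  define d where "d = (\<Sum>q<n. \<Sum>x\<in>A. \<Sum>ys\<in>nlists n A.
      (-1) ^ q * w 0 x * ?\<psi> ys * cnj (w 0 (ys ! q)) * cnj (?\<psi> (x # del_nth q ys)))"
  have "w 0 x * ?\<psi> ys * cnj (?\<Phi> (x # ys)) = w 0 x * cnj (w 0 x) * (?\<psi> ys * cnj (?\<psi> ys))
      - (\<Sum>q<n. (-1) ^ q * w 0 x * ?\<psi> ys * cnj (w 0 (ys ! q)) * cnj (?\<psi> (x # del_nth q ys)))"
    if "ys \<in> nlists n A" for x ys
    using that
    by (subst slater_laplace)
       (simp_all add: nlists_def sum.lessThan_Suc_shift del_nth_def sum_distrib_left sum_negf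
         algebra_simps del: sum.lessThan_Suc)
  then have "c = (\<Sum>x\<in>A. w 0 x * cnj (w 0 x)) * (\<Sum>ys\<in>nlists n A. ?\<psi> ys * cnj (?\<psi> ys)) - d"
    unfolding c_def d_def
    by (simp add: sum_subtractf sum_product cong: sum.cong)
       (simp add: sum.swap[of _ "{..<n}"])
  then have 2: "Re c = (\<Sum>x\<in>A. (cmod (w 0 x))\<^sup>2) * (\<Sum>ys\<in>nlists n A. (cmod (?\<psi> ys))\<^sup>2) - Re d"
    by (simp flip: complex_norm_square of_real_sum of_real_mult del: of_real_power)
  \<comment> \<open>\<open>d\<close> is \<open>n\<close> times the squared norm of the contraction
    of the smaller determinant with \<open>w 0\<close>, so dropping it only enlarges the upper
    bound; \<open>g r\<close> below is this contraction up to conjugation.\<close>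
  have 3: "Re d \<ge> 0"
  proof (cases n)
    case (Suc m)
    define g where "g = (\<lambda>r. \<Sum>x\<in>A. w 0 x * cnj (?\<psi> (x # r)))"
    have "d = (\<Sum>q<n. \<Sum>r\<in>nlists m A. complex_of_real ((cmod (g r))\<^sup>2))"
      unfolding d_def
    proof (rule sum.cong[OF refl])
      fix q assume q: "q \<in> {..<n}"
      have "(\<Sum>ys\<in>nlists n A. (-1) ^ q * w 0 x * ?\<psi> ys * cnj (w 0 (ys ! q)) * cnj (?\<psi> (x # del_nth q ys)))
          = (\<Sum>z\<in>A. \<Sum>r\<in>nlists m A. w 0 x * ?\<psi> (z # r) * cnj (w 0 z) * cnj (?\<psi> (x # r)))" for x
      proof -
        have "(\<Sum>ys\<in>nlists n A. (-1) ^ q * w 0 x * ?\<psi> ys * cnj (w 0 (ys ! q)) * cnj (?\<psi> (x # del_nth q ys)))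
            = (\<Sum>ys\<in>nlists n A. (\<lambda>zs. w 0 x * ?\<psi> zs * cnj (w 0 (hd zs)) * cnj (?\<psi> (x # tl zs))) (to_front q ys))"
          using q by (intro sum.cong refl, subst slater_to_front)
            (simp_all add: nlists_def to_front_def)
        also have "\<dots> = (\<Sum>zs\<in>nlists n A. w 0 x * ?\<psi> zs * cnj (w 0 (hd zs)) * cnj (?\<psi> (x # tl zs)))"
          using q by (intro sum_to_front) simp
        finally show ?thesis by (simp add: Suc sum_nlists_Suc)
      qed
      then have "(\<Sum>x\<in>A. \<Sum>ys\<in>nlists n A. (-1) ^ q * w 0 x * ?\<psi> ys * cnj (w 0 (ys ! q)) * cnj (?\<psi> (x # del_nth q ys)))
          = (\<Sum>r\<in>nlists m A. \<Sum>x\<in>A. \<Sum>z\<in>A. w 0 x * ?\<psi> (z # r) * cnj (w 0 z) * cnj (?\<psi> (x # r)))"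
        by (simp add: sum.swap[of _ "nlists m A"])
      also have "\<dots> = (\<Sum>r\<in>nlists m A. g r * cnj (g r))"
        by (simp add: g_def sum_product mult_ac)
      finally show "(\<Sum>x\<in>A. \<Sum>ys\<in>nlists n A. (-1) ^ q * w 0 x * ?\<psi> ys * cnj (w 0 (ys ! q)) * cnj (?\<psi> (x # del_nth q ys)))
          = (\<Sum>r\<in>nlists m A. complex_of_real ((cmod (g r))\<^sup>2))"
        by (simp only: complex_norm_square)
    qed
    then show ?thesis by (simp add: sum_nonneg del: of_real_power)
  qed (simp add: d_def)
  have "complex_of_real (\<Sum>xs\<in>?L. (cmod (?\<Phi> xs))\<^sup>2) = of_nat (Suc n) * c"
    unfolding 1[symmetric] of_real_sum by (simp only: complex_norm_square)
  then have "(\<Sum>xs\<in>?L. (cmod (?\<Phi> xs))\<^sup>2) = Re (of_nat (Suc n) * c)"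
    by (metis Re_complex_of_real)
  also have "\<dots> = Suc n * Re c"
    by simp
  also have "\<dots> \<le> Suc n * ((\<Sum>x\<in>A. (cmod (w 0 x))\<^sup>2) * (\<Sum>ys\<in>nlists n A. (cmod (?\<psi> ys))\<^sup>2))"
    using 2 3 by (intro mult_left_mono) auto
  finally show ?thesis by (simp add: mult.assoc)
qed

text \<open>Induction over the creation operators. Tuples count each finite index set once per
  ordering, which is the origin of \<open>fact n\<close>.\<close>

lemma hadamard_slater:
  assumes "finite A"
  shows "(\<Sum>xs\<in>nlists n A. (cmod (slater n w xs))\<^sup>2) \<le> fact n * (\<Prod>p<n. \<Sum>x\<in>A. (cmod (w p x))\<^sup>2)"
proof (induction n arbitrary: w)
  case 0
  then show ?case by (simp add: slater_def)
next
  case (Suc n)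
  have "(\<Sum>xs\<in>nlists (Suc n) A. (cmod (slater (Suc n) w xs))\<^sup>2)
      \<le> Suc n * (\<Sum>x\<in>A. (cmod (w 0 x))\<^sup>2) * (\<Sum>xs\<in>nlists n A. (cmod (slater n (\<lambda>p. w (Suc p)) xs))\<^sup>2)"
    by (rule slater_step[OF assms])
  also have "\<dots> \<le> Suc n * (\<Sum>x\<in>A. (cmod (w 0 x))\<^sup>2) * (fact n * (\<Prod>p<n. \<Sum>x\<in>A. (cmod (w (Suc p) x))\<^sup>2))"
    by (intro mult_left_mono Suc.IH mult_nonneg_nonneg sum_nonneg) auto
  also have "\<dots> = fact (Suc n) * (\<Prod>p<Suc n. \<Sum>x\<in>A. (cmod (w p x))\<^sup>2)"
    by (simp add: prod.lessThan_Suc_shift del: prod.lessThan_Suc)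
  finally show ?case .
qed

section \<open>Principal minors\<close>

definition minor :: "'a set \<Rightarrow> ('a \<Rightarrow> 'a \<Rightarrow> complex) \<Rightarrow> complex" where
  "minor S M = (\<Sum>p | p permutes S. of_int (sign p) * (\<Prod>i\<in>S. M i (p i)))"

lemma permutes_lt: "p permutes {0..<n} \<Longrightarrow> i < n \<Longrightarrow> p i < (n::nat)"
  using permutes_in_image[of p "{0..<n}" i] by simp

text \<open>Enumerating the set by a list carries its permutations to permutations of positions
  without changing signs. The determinant laws for matrices indexed by numbers thereby become
  available over any index type.\<close>

lemma minor_eq_det:
  assumes "distinct xs"
  shows "minor (set xs) M
       = Determinant.det (Matrix.mat (length xs) (length xs) (\<lambda>(i, j). M (xs ! i) (xs ! j)))"
proof -
  let ?I = "{0..<length xs}" and ?f = "(!) xs"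
  have bij: "bij_betw ?f ?I (set xs)"
    using assms by (intro bij_betw_nth) auto
  have inj: "inj_on ?f ?I" using bij by (rule bij_betw_imp_inj_on)
  have bp: "bij_betw (map_permutation ?I ?f) {p. p permutes ?I} {p. p permutes set xs}"
  proof -
    have "map_permutation ?I ?f p = (\<lambda>x. if x \<in> set xs then ?f (p (inv_into ?I ?f x)) else x)" for p
      using bij by (auto simp: map_permutation_def restrict_id_def fun_eq_iff bij_betw_def)
    then have "map_permutation ?I ?f = (\<lambda>p x. if x \<in> set xs then ?f (p (inv_into ?I ?f x)) else x)"
      by (rule ext)
    then show ?thesis using bij_betw_permutations[OF bij] by simp
  qed
  have "minor (set xs) M = (\<Sum>p | p permutes ?I. of_int (sign (map_permutation ?I ?f p))
      * (\<Prod>i\<in>set xs. M i (map_permutation ?I ?f p i)))"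
    unfolding minor_def by (rule sum.reindex_bij_betw[OF bp, symmetric])
  also have "\<dots> = (\<Sum>p | p permutes ?I. of_int (sign p) * (\<Prod>i\<in>?I. M (xs ! i) (xs ! p i)))"
  proof (rule sum.cong[OF refl])
    fix p assume "p \<in> {p. p permutes ?I}"
    then have p: "p permutes ?I" by simp
    have "(\<Prod>i\<in>set xs. M i (map_permutation ?I ?f p i))
        = (\<Prod>i\<in>?I. M (xs ! i) (map_permutation ?I ?f p (xs ! i)))"
      by (rule prod.reindex_bij_betw[OF bij, symmetric])
    also have "\<dots> = (\<Prod>i\<in>?I. M (xs ! i) (xs ! p i))"
      by (intro prod.cong refl) (simp add: map_permutation_apply[OF inj])
    finally show "of_int (sign (map_permutation ?I ?f p)) * (\<Prod>i\<in>set xs. M i (map_permutation ?I ?f p i))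
        = of_int (sign p) * (\<Prod>i\<in>?I. M (xs ! i) (xs ! p i))"
      using sign_map_permutation[OF inj p] by simp
  qed
  also have "\<dots> = Determinant.det (Matrix.mat (length xs) (length xs) (\<lambda>(i, j). M (xs ! i) (xs ! j)))"
    unfolding det_def
    by (auto intro!: sum.cong prod.cong simp: permutes_lt)
  finally show ?thesis .
qed

text \<open>Multilinearity in the rows: choosing a rank-one term \<open>ks ! p\<close> for each row
  \<open>p\<close> leaves the product of the row factors and a Slater determinant. Choices with
  repetitions stay in the sum; their Slater determinants vanish.\<close>

lemma det_rank_expansion:
  fixes u w :: "nat \<Rightarrow> 'a \<Rightarrow> complex"
  assumes "length xs = n"
  shows "Determinant.det (Matrix.mat n n (\<lambda>(i, j). \<Sum>k<m. u k (xs ! i) * w k (xs ! j)))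
       = (\<Sum>ks\<in>nlists n {..<m}. (\<Prod>p<n. u (ks ! p) (xs ! p)) * slater n (\<lambda>p. w (ks ! p)) xs)"
proof -
  have s: "slater n (\<lambda>p. w (ks ! p)) xs
      = (\<Sum>p | p permutes {0..<n}. of_int (sign p) * (\<Prod>i<n. w (ks ! i) (xs ! p i)))" for ks
  proof -
    have "slater n (\<lambda>p. w (ks ! p)) xs
        = Determinant.det (Matrix.transpose_mat (Matrix.mat n n (\<lambda>(i, p). w (ks ! p) (xs ! i))))"
      unfolding slater_def by (rule det_transpose[symmetric, of _ n]) simp
    also have "Matrix.transpose_mat (Matrix.mat n n (\<lambda>(i, p). w (ks ! p) (xs ! i)))
        = Matrix.mat n n (\<lambda>(p, i). w (ks ! p) (xs ! i))"
      by (rule eq_matI) auto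
    also have "Determinant.det \<dots>
        = (\<Sum>p | p permutes {0..<n}. of_int (sign p) * (\<Prod>i<n. w (ks ! i) (xs ! p i)))"
      unfolding det_def by (auto intro!: sum.cong prod.cong simp: permutes_lt atLeast0LessThan)
    finally show ?thesis .
  qed
  have "Determinant.det (Matrix.mat n n (\<lambda>(i, j). \<Sum>k<m. u k (xs ! i) * w k (xs ! j)))
      = (\<Sum>p | p permutes {0..<n}. of_int (sign p) *
          (\<Prod>i<n. \<Sum>k<m. u k (xs ! i) * w k (xs ! p i)))"
    unfolding det_def by (auto intro!: sum.cong prod.cong simp: permutes_lt atLeast0LessThan)
  also have "\<dots> = (\<Sum>p | p permutes {0..<n}. of_int (sign p) *
      (\<Sum>ks\<in>nlists n {..<m}. \<Prod>i<n. u (ks ! i) (xs ! i) * w (ks ! i) (xs ! p i)))"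
    by (subst sum_nlists_prod) simp
  also have "\<dots> = (\<Sum>ks\<in>nlists n {..<m}. (\<Prod>p<n. u (ks ! p) (xs ! p)) * slater n (\<lambda>p. w (ks ! p)) xs)"
    unfolding s sum_distrib_left
    by (subst sum.swap) (simp add: prod.distrib mult_ac)
  finally show ?thesis .
qed

lemma sqrt_prod: "sqrt (\<Prod>i\<in>I. f i) = (\<Prod>i\<in>I. sqrt (f i))"
  by (induction I rule: infinite_finite_induct) (simp_all add: real_sqrt_mult)

text \<open>Passing from sets to their orderings gains \<open>fact n\<close>, while Cauchy-Schwarz
  over all tuples together with \<open>hadamard_slater\<close> costs \<open>sqrt (fact n)\<close>;
  the quotient \<open>1 / sqrt (fact n)\<close> remains. This factor depends neither on the rank
  \<open>m\<close> nor on \<open>A\<close>, so limits in both are possible.\<close>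

lemma sum_cmod_minor_le:
  fixes u w :: "nat \<Rightarrow> 'a \<Rightarrow> complex"
  assumes A: "finite A" and \<S>: "\<And>S. S \<in> \<S> \<Longrightarrow> S \<subseteq> A \<and> card S = n"
  shows "(\<Sum>S\<in>\<S>. cmod (minor S (\<lambda>i j. \<Sum>k<m. u k i * w k j)))
       \<le> (\<Sum>k<m. sqrt (\<Sum>x\<in>A. (cmod (u k x))\<^sup>2) * sqrt (\<Sum>x\<in>A. (cmod (w k x))\<^sup>2)) ^ n / sqrt (fact n)"
proof -
  define M where "M = (\<lambda>i j. \<Sum>k<m. u k i * w k j)"
  define D where "D = (\<lambda>xs. Determinant.det (Matrix.mat n n (\<lambda>(i, j). M (xs ! i) (xs ! j))))"
  define a where "a = (\<lambda>k. sqrt (\<Sum>x\<in>A. (cmod (u k x))\<^sup>2))"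
  define b where "b = (\<lambda>k. sqrt (\<Sum>x\<in>A. (cmod (w k x))\<^sup>2))"
  have fin: "finite \<S>"
    by (rule finite_subset[of _ "Pow A"]) (use \<S> A in auto)
  have fact: "fact n * cmod (minor S M) = (\<Sum>xs\<in>permutations_of_set S. cmod (D xs))" if "S \<in> \<S>" for S
  proof -
    have S: "finite S" "card S = n" using \<S>[OF that] A finite_subset by auto
    have "cmod (D xs) = cmod (minor S M)" if "xs \<in> permutations_of_set S" for xs
      using permutations_of_setD[OF that] S minor_eq_det[of xs M] distinct_card[of xs]
      by (simp add: D_def)
    then show ?thesis using S by simp
  qed
  have "fact n * (\<Sum>S\<in>\<S>. cmod (minor S M)) = (\<Sum>S\<in>\<S>. \<Sum>xs\<in>permutations_of_set S. cmod (D xs))"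
    by (simp add: sum_distrib_left fact)
  also have "\<dots> = (\<Sum>xs\<in>(\<Union>S\<in>\<S>. permutations_of_set S). cmod (D xs))"
    by (rule sum.UNION_disjoint[symmetric]) (simp_all add: fin, auto simp: permutations_of_set_def)
  also have "\<dots> \<le> (\<Sum>xs\<in>nlists n A. cmod (D xs))"
    by (rule sum_mono2)
       (use \<S> finite_nlists[OF A] in \<open>auto simp: permutations_of_set_def nlists_def simp flip: distinct_card\<close>)
  also have "\<dots> \<le> (\<Sum>xs\<in>nlists n A. \<Sum>ks\<in>nlists n {..<m}.
      (\<Prod>p<n. cmod (u (ks ! p) (xs ! p))) * cmod (slater n (\<lambda>p. w (ks ! p)) xs))"
  proof (rule sum_mono)
    fix xs assume "xs \<in> nlists n A"
    then have "length xs = n" by (simp add: nlists_def)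
    from det_rank_expansion[OF this, where m = m and u = u and w = w]
    have "D xs = (\<Sum>ks\<in>nlists n {..<m}. (\<Prod>p<n. u (ks ! p) (xs ! p)) * slater n (\<lambda>p. w (ks ! p)) xs)"
      by (simp add: D_def M_def)
    then show "cmod (D xs) \<le> (\<Sum>ks\<in>nlists n {..<m}.
        (\<Prod>p<n. cmod (u (ks ! p) (xs ! p))) * cmod (slater n (\<lambda>p. w (ks ! p)) xs))"
      by (simp add: norm_mult prod_norm) (intro sum_norm_le, simp add: norm_mult prod_norm)
  qed
  also have "\<dots> = (\<Sum>ks\<in>nlists n {..<m}. \<Sum>xs\<in>nlists n A.
      (\<Prod>p<n. cmod (u (ks ! p) (xs ! p))) * cmod (slater n (\<lambda>p. w (ks ! p)) xs))"
    by (rule sum.swap)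
  also have "\<dots> \<le> (\<Sum>ks\<in>nlists n {..<m}. sqrt (fact n) * (\<Prod>p<n. a (ks ! p) * b (ks ! p)))"
  proof (rule sum_mono)
    fix ks :: "nat list"
    have "(\<Sum>xs\<in>nlists n A. (\<Prod>p<n. cmod (u (ks ! p) (xs ! p))) * cmod (slater n (\<lambda>p. w (ks ! p)) xs))
        \<le> sqrt (\<Sum>xs\<in>nlists n A. (\<Prod>p<n. cmod (u (ks ! p) (xs ! p)))\<^sup>2)
          * sqrt (\<Sum>xs\<in>nlists n A. (cmod (slater n (\<lambda>p. w (ks ! p)) xs))\<^sup>2)"
      using L2_set_mult_ineq[where f = "\<lambda>xs. \<Prod>p<n. cmod (u (ks ! p) (xs ! p))" and
          g = "\<lambda>xs. cmod (slater n (\<lambda>p. w (ks ! p)) xs)" and A = "nlists n A"]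
      by (simp add: L2_set_def abs_mult prod_nonneg)
    also have "(\<Sum>xs\<in>nlists n A. (\<Prod>p<n. cmod (u (ks ! p) (xs ! p)))\<^sup>2)
        = (\<Prod>p<n. \<Sum>x\<in>A. (cmod (u (ks ! p) x))\<^sup>2)"
      by (subst sum_nlists_prod[symmetric]) (simp add: prod_power_distrib)
    also have "sqrt (\<Prod>p<n. \<Sum>x\<in>A. (cmod (u (ks ! p) x))\<^sup>2)
          * sqrt (\<Sum>xs\<in>nlists n A. (cmod (slater n (\<lambda>p. w (ks ! p)) xs))\<^sup>2)
        \<le> sqrt (\<Prod>p<n. \<Sum>x\<in>A. (cmod (u (ks ! p) x))\<^sup>2)
          * sqrt (fact n * (\<Prod>p<n. \<Sum>x\<in>A. (cmod (w (ks ! p) x))\<^sup>2))"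
      by (intro mult_left_mono real_sqrt_le_mono hadamard_slater[OF A]) (simp add: prod_nonneg sum_nonneg)
    also have "\<dots> = sqrt (fact n) * (\<Prod>p<n. a (ks ! p) * b (ks ! p))"
      by (simp add: a_def b_def real_sqrt_mult sqrt_prod prod.distrib)
    finally show "(\<Sum>xs\<in>nlists n A. (\<Prod>p<n. cmod (u (ks ! p) (xs ! p))) * cmod (slater n (\<lambda>p. w (ks ! p)) xs))
        \<le> sqrt (fact n) * (\<Prod>p<n. a (ks ! p) * b (ks ! p))" .
  qed
  also have "\<dots> = sqrt (fact n) * (\<Sum>k<m. a k * b k) ^ n"
    using sum_nlists_prod[where n = n and A = "{..<m}" and f = "\<lambda>_ k. a k * b k"]
    by (simp flip: sum_distrib_left)
  finally have "fact n * (\<Sum>S\<in>\<S>. cmod (minor S M)) \<le> sqrt (fact n) * (\<Sum>k<m. a k * b k) ^ n" .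
  moreover have "sqrt (fact n) * sqrt (fact n) = (fact n :: real)"
    by simp
  ultimately have "sqrt (fact n) * (sqrt (fact n) * (\<Sum>S\<in>\<S>. cmod (minor S M)))
      \<le> sqrt (fact n) * (\<Sum>k<m. a k * b k) ^ n"
    by (metis mult.assoc)
  then have "sqrt (fact n) * (\<Sum>S\<in>\<S>. cmod (minor S M)) \<le> (\<Sum>k<m. a k * b k) ^ n"
    by (rule mult_left_le_imp_le) simp
  then show ?thesis
    by (simp add: M_def a_def b_def field_simps)
qed

section \<open>Vanishing minors, perturbations of the identity, products\<close>

lemma minor_cong:
  assumes "\<And>i j. i \<in> S \<Longrightarrow> j \<in> S \<Longrightarrow> M i j = N i j"
  shows "minor S M = minor S N"
  unfolding minor_def by (intro sum.cong refl arg_cong2[where f = "(*)"] prod.cong assms)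
    (auto simp: permutes_in_image)

lemma minor_empty [simp]: "minor {} M = 1"
  by (simp add: minor_def)

lemma minor_singleton [simp]: "minor {i} M = M i i"
  by (simp add: minor_def)

lemma minor_zero_row:
  assumes "finite S" "i \<in> S" "\<And>j. j \<in> S \<Longrightarrow> M i j = 0"
  shows "minor S M = 0"
  unfolding minor_def
proof (intro sum.neutral ballI)
  fix p assume "p \<in> {p. p permutes S}"
  then have "M i (p i) = 0" using assms by (auto simp: permutes_in_image)
  then show "of_int (sign p) * (\<Prod>i\<in>S. M i (p i)) = 0"
    using assms by (simp add: prod_zero_iff) blast
qed

lemma minor_zero_col:
  assumes "finite S" "j \<in> S" "\<And>i. i \<in> S \<Longrightarrow> M i j = 0"
  shows "minor S M = 0"
  unfolding minor_def
proof (intro sum.neutral ballI)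
  fix p assume "p \<in> {p. p permutes S}"
  then have p: "p permutes S" by simp
  then obtain i where "i \<in> S" "p i = j"
    using assms(2) permutes_image[OF p] by (metis imageE)
  then have "M i (p i) = 0" using assms by auto
  then show "of_int (sign p) * (\<Prod>i\<in>S. M i (p i)) = 0"
    using assms \<open>i \<in> S\<close> by (simp add: prod_zero_iff) blast
qed

text \<open>When the product is multiplied out, the rows outside \<open>S\<close> select the
  identity, so a permutation of \<open>F\<close> contributes to \<open>S\<close> exactly if it fixes
  \<open>F - S\<close>, that is, permutes \<open>S\<close>. This identifies partial sums of the
  Fredholm series with finite determinants.\<close>

lemma minor_one_plus:
  assumes "finite F"
  shows "minor F (\<lambda>i j. (if i = j then 1 else 0) + M i j) = (\<Sum>S\<in>Pow F. minor S M)"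
proof -
  have "(\<Prod>i\<in>F. (if i = p i then 1 else 0) + M i (p i))
      = (\<Sum>S\<in>Pow F. (if p permutes S then \<Prod>i\<in>S. M i (p i) else 0))"
    if p: "p permutes F" for p
  proof -
    have "(\<Prod>i\<in>F. M i (p i) + (if i = p i then 1 else 0))
        = (\<Sum>S\<in>Pow F. (\<Prod>i\<in>S. M i (p i)) * (\<Prod>i\<in>F - S. if i = p i then 1 else 0))"
      by (rule prod_add[OF assms])
    also have "\<dots> = (\<Sum>S\<in>Pow F. (if p permutes S then \<Prod>i\<in>S. M i (p i) else 0))"
    proof (rule sum.cong[OF refl])
      fix S assume S: "S \<in> Pow F"
      have "p permutes S \<longleftrightarrow> (\<forall>i\<in>F - S. i = p i)"
        using p S permutes_superset[OF p] by (metis DiffE PowD permutes_not_in permutes_subset)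
      then show "(\<Prod>i\<in>S. M i (p i)) * (\<Prod>i\<in>F - S. if i = p i then 1 else 0)
          = (if p permutes S then \<Prod>i\<in>S. M i (p i) else 0)"
        using assms by (auto simp: prod_zero_iff)
    qed
    finally show ?thesis by (simp add: add.commute)
  qed
  then have "minor F (\<lambda>i j. (if i = j then 1 else 0) + M i j)
      = (\<Sum>p | p permutes F. \<Sum>S\<in>Pow F. if p permutes S then of_int (sign p) * (\<Prod>i\<in>S. M i (p i)) else 0)"
    unfolding minor_def by (simp add: sum_distrib_left if_distrib cong: if_cong)
  also have "\<dots> = (\<Sum>S\<in>Pow F. \<Sum>p | p permutes F. if p permutes S then of_int (sign p) * (\<Prod>i\<in>S. M i (p i)) else 0)"
    by (rule sum.swap)
  also have "\<dots> = (\<Sum>S\<in>Pow F. minor S M)"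
  proof (rule sum.cong[OF refl])
    fix S assume "S \<in> Pow F"
    then have "{p. p permutes S} = {p \<in> {p. p permutes F}. p permutes S}"
      using permutes_subset by auto
    then show "(\<Sum>p | p permutes F. if p permutes S then of_int (sign p) * (\<Prod>i\<in>S. M i (p i)) else 0) = minor S M"
      unfolding minor_def using assms
      by (simp only: sum.inter_filter[OF finite_permutations[OF assms], symmetric])
  qed
  finally show ?thesis .
qed

lemma mat_of_mult:
  assumes "distinct xs" "set xs = F" "length xs = n"
  shows "Matrix.mat n n (\<lambda>(i, j). M (xs ! i) (xs ! j)) * Matrix.mat n n (\<lambda>(i, j). N (xs ! i) (xs ! j))
       = Matrix.mat n n (\<lambda>(i, j). (\<Sum>k\<in>F. M (xs ! i) k * N k (xs ! j) :: complex))"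
proof -
  have bij: "bij_betw ((!) xs) {0..<n} F"
    using assms by (intro bij_betw_nth) auto
  show ?thesis
    by (rule eq_matI) (auto simp: scalar_prod_def sum.reindex_bij_betw[OF bij, symmetric])
qed

lemma minor_mult:
  assumes "finite F"
  shows "minor F (\<lambda>i j. \<Sum>k\<in>F. M i k * N k j) = minor F M * minor F N"
proof -
  obtain xs where xs: "set xs = F" "distinct xs"
    using finite_distinct_list[OF assms] by blast
  show ?thesis
    using minor_eq_det[OF xs(2)] mat_of_mult[OF xs(2,1) refl, of M N]
    by (simp add: xs(1) det_mult[symmetric, of _ "length xs"])
qed

text \<open>Sylvester's identity. The block matrix with rows \<open>1, -A\<close> and
  \<open>B, 1\<close> is evaluated once by its Schur complement and once by a block triangular
  factorization.\<close>

lemma det_one_plus_mult_commute: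
  fixes A B :: "complex Matrix.mat"
  assumes A: "A \<in> carrier_mat n n" and B: "B \<in> carrier_mat n n"
  shows "Determinant.det (1\<^sub>m n + A * B) = Determinant.det (1\<^sub>m n + B * A)"
proof -
  let ?X = "four_block_mat (1\<^sub>m n) (- A) B (1\<^sub>m n)"
  have AB: "A * B \<in> carrier_mat n n" "B * A \<in> carrier_mat n n" "- A \<in> carrier_mat n n"
    using A B by auto
  have "Determinant.det ?X = Determinant.det (1\<^sub>m n * 1\<^sub>m n - (- A) * B)"
    by (rule det_four_block_mat) (use A B in auto)
  also have "1\<^sub>m n * 1\<^sub>m n - (- A) * B = 1\<^sub>m n + A * B"
    using A B AB by (intro eq_matI) (auto simp: uminus_mult_left_mat)
  finally have 1: "Determinant.det ?X = Determinant.det (1\<^sub>m n + A * B)" .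
  let ?L = "four_block_mat (1\<^sub>m n) (0\<^sub>m n n) B (1\<^sub>m n)"
  let ?U = "four_block_mat (1\<^sub>m n) (- A) (0\<^sub>m n n) (1\<^sub>m n + B * A)"
  have cL: "?L \<in> carrier_mat (n + n) (n + n)" and cU: "?U \<in> carrier_mat (n + n) (n + n)"
    using A B by auto
  have "?L * ?U = four_block_mat (1\<^sub>m n * 1\<^sub>m n + 0\<^sub>m n n * 0\<^sub>m n n) (1\<^sub>m n * (- A) + 0\<^sub>m n n * (1\<^sub>m n + B * A))
      (B * 1\<^sub>m n + 1\<^sub>m n * 0\<^sub>m n n) (B * (- A) + 1\<^sub>m n * (1\<^sub>m n + B * A))"
    by (rule mult_four_block_mat) (use A B in auto)
  also have "\<dots> = ?X"
    using A B AB by (intro arg_cong4[where f = four_block_mat] eq_matI)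
      (auto simp: uminus_mult_right_mat)
  finally have "Determinant.det ?X = Determinant.det ?L * Determinant.det ?U"
    using det_mult[OF cL cU] by simp
  moreover have "Determinant.det ?L = 1"
    using det_four_block_mat_upper_right_zero[of "1\<^sub>m n" n "0\<^sub>m n n" n B "1\<^sub>m n"] B by simp
  moreover have "Determinant.det ?U = Determinant.det (1\<^sub>m n + B * A)"
    using det_four_block_mat_lower_left_zero[of "1\<^sub>m n" n "- A" n "0\<^sub>m n n" "1\<^sub>m n + B * A"] A B by simp
  ultimately show ?thesis using 1 by simp
qed

lemma minor_one_plus_mult_commute:
  assumes "finite F"
  shows "minor F (\<lambda>i j. (if i = j then 1 else 0) + (\<Sum>k\<in>F. M i k * N k j))
       = minor F (\<lambda>i j. (if i = j then 1 else 0) + (\<Sum>k\<in>F. N i k * M k j))"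
proof -
  obtain xs where xs: "set xs = F" "distinct xs"
    using finite_distinct_list[OF assms] by blast
  let ?n = "length xs"
  have *: "Matrix.mat ?n ?n (\<lambda>(i, j). (if xs ! i = xs ! j then 1 else 0) + (\<Sum>k\<in>F. M (xs ! i) k * N k (xs ! j)))
      = 1\<^sub>m ?n + Matrix.mat ?n ?n (\<lambda>(i, j). M (xs ! i) (xs ! j)) * Matrix.mat ?n ?n (\<lambda>(i, j). N (xs ! i) (xs ! j))"
    for M N :: "'a \<Rightarrow> 'a \<Rightarrow> complex"
    unfolding mat_of_mult[OF xs(2,1) refl]
    by (rule eq_matI) (use xs in \<open>auto simp: nth_eq_iff_index_eq\<close>)
  show ?thesis
    unfolding xs(1)[symmetric] minor_eq_det[OF xs(2)]
    unfolding xs(1) * by (rule det_one_plus_mult_commute) auto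
qed

section \<open>Complex-linear operators\<close>

lemma ell2_eqI: "(\<And>i. ell2_coord x i = ell2_coord y i) \<Longrightarrow> x = y"
  by (simp add: ell2_coord_inject[symmetric] fun_eq_iff)

lemma ell2_memI:
  fixes x :: "'i \<Rightarrow> complex"
  assumes "\<And>F. finite F \<Longrightarrow> (\<Sum>i\<in>F. (cmod (x i))\<^sup>2) \<le> C"
  shows "ell2_coord (Abs_ell2 x) = x"
proof -
  have "(\<lambda>i. (cmod (x i))\<^sup>2) summable_on UNIV"
    by (rule nonneg_bdd_above_summable_on) (use assms in \<open>auto intro!: bdd_aboveI2[where M = C]\<close>)
  then show ?thesis by (simp add: Abs_ell2_inverse)
qed

lemma ell2_norm_leI:
  assumes "\<And>F. finite F \<Longrightarrow> (\<Sum>i\<in>F. (cmod (ell2_coord x i))\<^sup>2) \<le> c\<^sup>2" "c \<ge> 0"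
  shows "norm x \<le> c"
proof (rule power2_le_imp_le)
  show "(norm x)\<^sup>2 \<le> c\<^sup>2"
    unfolding ell2_norm_sq by (rule infsum_le_finite_sums[OF ell2_coord_summable]) (use assms in auto)
qed (use assms in auto)

lemma bounded_linear_ell2_coord: "bounded_linear (\<lambda>x. ell2_coord x i)"
  by (rule bounded_linear_intro[where K = 1])
     (auto simp: plus_ell2.rep_eq scaleR_ell2.rep_eq ell2_coord_le_norm)

lemmas ell2_coord_simps [simp] =
  plus_ell2.rep_eq minus_ell2.rep_eq uminus_ell2.rep_eq zero_ell2.rep_eq scaleR_ell2.rep_eq

lemma ell2_coord_sum [simp]: "ell2_coord (\<Sum>k\<in>A. f k) i = (\<Sum>k\<in>A. ell2_coord (f k) i)"
  by (induction A rule: infinite_finite_induct) auto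

lift_definition cscale :: "complex \<Rightarrow> 'i ell2 \<Rightarrow> 'i ell2" is "\<lambda>c x i. c * x i"
  by (simp add: norm_mult power_mult_distrib summable_on_cmult_right)

lift_definition restr :: "'i set \<Rightarrow> 'i ell2 \<Rightarrow> 'i ell2" is "\<lambda>A x i. if i \<in> A then x i else 0"
  by (rule summable_on_comparison_test) auto

declare cscale.rep_eq [simp] restr.rep_eq [simp]

lemma norm_cscale [simp]: "norm (cscale c x) = cmod c * norm x"
proof -
  have "(norm (cscale c x))\<^sup>2 = (cmod c * norm x)\<^sup>2"
    by (simp add: ell2_norm_sq norm_mult power_mult_distrib infsum_cmult_right')
  then show ?thesis by (rule power2_eq_imp_eq) auto
qed

lemma bounded_linear_cscale: "bounded_linear (cscale c)"
  by (rule bounded_linear_intro[where K = "cmod c"]) (auto intro!: ell2_eqI simp: algebra_simps)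

lemma norm_restr_le: "norm (restr A x) \<le> norm x"
proof (rule ell2_norm_leI)
  fix F :: "'a set" assume F: "finite F"
  have "(\<Sum>i\<in>F. (cmod (ell2_coord (restr A x) i))\<^sup>2) \<le> (\<Sum>i\<in>F. (cmod (ell2_coord x i))\<^sup>2)"
    by (rule sum_mono) auto
  also have "\<dots> \<le> (norm x)\<^sup>2" by (rule ell2_sum_le_norm_sq[OF F])
  finally show "(\<Sum>i\<in>F. (cmod (ell2_coord (restr A x) i))\<^sup>2) \<le> (norm x)\<^sup>2" .
qed auto

lemma ell2_coord_basis [simp]: "ell2_coord (ell2_basis j) i = (if i = j then 1 else 0)"
proof -
  have "ell2_coord (ell2_basis j) = (\<lambda>i. if i = j then 1 else 0)"
    unfolding ell2_basis_def
  proof (rule ell2_memI)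
    fix F :: "'a set" assume F: "finite F"
    have "(\<Sum>i\<in>F. (cmod (if i = j then 1 else 0))\<^sup>2) = (\<Sum>i\<in>F. if i = j then 1 else (0::real))"
      by (intro sum.cong) auto
    also have "\<dots> \<le> 1" using F by simp
    finally show "(\<Sum>i\<in>F. (cmod (if i = j then 1 else 0))\<^sup>2) \<le> (1::real)" .
  qed
  then show ?thesis by simp
qed

lemma norm_sq_restr_finite:
  assumes "finite F"
  shows "(norm (restr F x))\<^sup>2 = (\<Sum>i\<in>F. (cmod (ell2_coord x i))\<^sup>2)"
proof -
  have "(norm (restr F x))\<^sup>2 = (\<Sum>\<^sub>\<infinity>i. (cmod (ell2_coord (restr F x) i))\<^sup>2)"
    by (rule ell2_norm_sq)
  also have "\<dots> = (\<Sum>\<^sub>\<infinity>i\<in>F. (cmod (ell2_coord x i))\<^sup>2)"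
    by (rule infsum_cong_neutral) auto
  finally show ?thesis using assms by simp
qed

lemma restr_finite:
  assumes "finite F"
  shows "restr F x = (\<Sum>i\<in>F. cscale (ell2_coord x i) (ell2_basis i))"
proof (rule ell2_eqI)
  fix i
  have "(\<Sum>k\<in>F. ell2_coord x k * (if i = k then 1 else 0)) = (if i \<in> F then ell2_coord x i else 0)"
    using assms by (simp add: if_distrib cong: if_cong)
  then show "ell2_coord (restr F x) i = ell2_coord (\<Sum>i\<in>F. cscale (ell2_coord x i) (ell2_basis i)) i"
    by simp
qed

lemma norm_basis [simp]: "norm (ell2_basis i) = 1"
proof -
  have "restr {i} (ell2_basis i) = ell2_basis i"
    by (rule ell2_eqI) auto
  then have "(norm (ell2_basis i))\<^sup>2 = 1"
    using norm_sq_restr_finite[of "{i}" "ell2_basis i"] by simp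
  then show ?thesis by (simp add: power2_eq_1_iff) (metis norm_ge_zero not_one_le_zero neg_0_le_iff_le)
qed

lemma norm_sq_restr_compl: "(norm (x - restr F x))\<^sup>2 + (norm (restr F x))\<^sup>2 = (norm x)\<^sup>2"
proof -
  have "(\<Sum>\<^sub>\<infinity>i. (cmod (ell2_coord x i))\<^sup>2)
      = (\<Sum>\<^sub>\<infinity>i. (cmod (ell2_coord (x - restr F x) i))\<^sup>2 + (cmod (ell2_coord (restr F x) i))\<^sup>2)"
    by (intro infsum_cong) auto
  also have "\<dots> = (\<Sum>\<^sub>\<infinity>i. (cmod (ell2_coord (x - restr F x) i))\<^sup>2) + (\<Sum>\<^sub>\<infinity>i. (cmod (ell2_coord (restr F x) i))\<^sup>2)"
    by (rule infsum_add; rule ell2_coord_summable)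
  finally show ?thesis by (simp only: ell2_norm_sq)
qed

lemma tendsto_restr: "((\<lambda>F. restr F x) \<longlongrightarrow> x) (finite_subsets_at_top UNIV)"
proof -
  have "((\<lambda>i. (cmod (ell2_coord x i))\<^sup>2) has_sum (norm x)\<^sup>2) UNIV"
    using ell2_coord_summable ell2_norm_sq by (metis has_sum_infsum)
  then have "((\<lambda>F. \<Sum>i\<in>F. (cmod (ell2_coord x i))\<^sup>2) \<longlongrightarrow> (norm x)\<^sup>2) (finite_subsets_at_top UNIV)"
    by (simp add: has_sum_def)
  moreover have "eventually (\<lambda>F. (\<Sum>i\<in>F. (cmod (ell2_coord x i))\<^sup>2) = (norm (restr F x))\<^sup>2) (finite_subsets_at_top UNIV)"
    by (intro eventually_finite_subsets_at_top_weakI) (simp add: norm_sq_restr_finite)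
  ultimately have "((\<lambda>F. (norm (restr F x))\<^sup>2) \<longlongrightarrow> (norm x)\<^sup>2) (finite_subsets_at_top UNIV)"
    by (rule Lim_transform_eventually)
  from tendsto_diff[OF tendsto_const[of "(norm x)\<^sup>2"] this]
  have "((\<lambda>F. (norm x)\<^sup>2 - (norm (restr F x))\<^sup>2) \<longlongrightarrow> 0) (finite_subsets_at_top UNIV)"
    by simp
  moreover have "(norm x)\<^sup>2 - (norm (restr F x))\<^sup>2 = (norm (x - restr F x))\<^sup>2" for F
    using norm_sq_restr_compl[of x F] by simp
  ultimately have "((\<lambda>F. (norm (x - restr F x))\<^sup>2) \<longlongrightarrow> 0) (finite_subsets_at_top UNIV)"
    by (simp only:)
  from tendsto_real_sqrt[OF this]
  have "((\<lambda>F. norm (x - restr F x)) \<longlongrightarrow> 0) (finite_subsets_at_top UNIV)"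
    by simp
  then have "((\<lambda>F. x - restr F x) \<longlongrightarrow> 0) (finite_subsets_at_top UNIV)"
    by (rule tendsto_norm_zero_cancel)
  from tendsto_diff[OF tendsto_const[of x] this] show ?thesis by simp
qed

lemma has_sum_basis: "((\<lambda>i. cscale (ell2_coord x i) (ell2_basis i)) has_sum x) UNIV"
proof -
  have "eventually (\<lambda>F. restr F x = (\<Sum>i\<in>F. cscale (ell2_coord x i) (ell2_basis i))) (finite_subsets_at_top UNIV)"
    by (intro eventually_finite_subsets_at_top_weakI) (simp add: restr_finite)
  then show ?thesis
    unfolding has_sum_def by (rule Lim_transform_eventually[OF tendsto_restr])
qed

text \<open>The functional is represented through the bilinear pairing by its values on the basis,
  so no conjugation enters. Complex linearity is what turns the basis expansion of \<open>x\<close>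
  into this sum.\<close>

lemma riesz:
  fixes \<phi> :: "'i ell2 \<Rightarrow> complex"
  assumes \<phi>: "bounded_linear \<phi>" "\<And>c x. \<phi> (cscale c x) = c * \<phi> x" and B: "\<And>x. cmod (\<phi> x) \<le> B * norm x"
  obtains w where "\<And>i. ell2_coord w i = \<phi> (ell2_basis i)" "norm w \<le> B"
    "\<And>x. ((\<lambda>i. ell2_coord w i * ell2_coord x i) has_sum \<phi> x) UNIV"
proof
  have B0: "B \<ge> 0"
    using order_trans[OF norm_ge_zero B[of "ell2_basis undefined"]] by simp
  have le: "(\<Sum>i\<in>F. (cmod (\<phi> (ell2_basis i)))\<^sup>2) \<le> B\<^sup>2" if F: "finite F" for F
  proof -
    let ?s = "\<Sum>i\<in>F. (cmod (\<phi> (ell2_basis i)))\<^sup>2"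
    \<comment> \<open>The extremal test vector: with conjugated coefficients, both
      \<open>\<phi> ?x\<close> and the square of \<open>norm ?x\<close> are equal to
      \<open>?s\<close>.\<close>
    let ?x = "\<Sum>i\<in>F. cscale (cnj (\<phi> (ell2_basis i))) (ell2_basis i)"
    have "\<phi> ?x = (\<Sum>i\<in>F. cnj (\<phi> (ell2_basis i)) * \<phi> (ell2_basis i))"
      by (simp add: linear_sum[OF bounded_linear.linear[OF \<phi>(1)]] \<phi>(2))
    also have "\<dots> = complex_of_real ?s"
      unfolding of_real_sum complex_norm_square by (intro sum.cong refl) (rule mult.commute)
    finally have 1: "cmod (\<phi> ?x) = ?s"
      by (simp add: sum_nonneg del: of_real_sum)
    have c: "ell2_coord ?x i = (if i \<in> F then cnj (\<phi> (ell2_basis i)) else 0)" for i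
      using F by (simp add: if_distrib cong: if_cong)
    have "restr F ?x = ?x" by (rule ell2_eqI) (simp only: restr.rep_eq c split: if_split, simp)
    then have 2: "(norm ?x)\<^sup>2 = ?s"
      using norm_sq_restr_finite[OF F, of ?x] by (simp only: c) simp
    have "norm ?x * norm ?x = ?s"
      using 2 by (simp only: power2_eq_square[of "norm ?x"])
    then have "norm ?x * norm ?x \<le> B * norm ?x"
      using B[of ?x] 1 by linarith
    then have "norm ?x \<le> B"
      using B0 mult_right_le_imp_le[of "norm ?x" "norm ?x" B] norm_ge_zero[of ?x] by linarith
    then have "(norm ?x)\<^sup>2 \<le> B\<^sup>2"
      by (rule power_mono) simp
    then show ?thesis unfolding 2 .
  qed
  define w where "w = Abs_ell2 (\<lambda>i. \<phi> (ell2_basis i))"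
  show w: "ell2_coord w i = \<phi> (ell2_basis i)" for i
    unfolding w_def by (subst ell2_memI) (use le in auto)
  show "norm w \<le> B" by (rule ell2_norm_leI) (use le B0 w in auto)
  fix x
  show "((\<lambda>i. ell2_coord w i * ell2_coord x i) has_sum \<phi> x) UNIV"
    using has_sum_bounded_linear[OF \<phi>(1) has_sum_basis[of x]] by (simp add: w \<phi>(2) o_def mult.commute)
qed

lemma pairing_abs:
  assumes "finite F"
  shows "(\<Sum>i\<in>F. cmod (ell2_coord w i * ell2_coord x i)) \<le> norm w * norm x"
proof -
  have "(\<Sum>i\<in>F. cmod (ell2_coord w i * ell2_coord x i))
      \<le> sqrt (\<Sum>i\<in>F. (cmod (ell2_coord w i))\<^sup>2) * sqrt (\<Sum>i\<in>F. (cmod (ell2_coord x i))\<^sup>2)"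
    using L2_set_mult_ineq[where f = "\<lambda>i. cmod (ell2_coord w i)" and g = "\<lambda>i. cmod (ell2_coord x i)" and A = F]
    by (simp add: L2_set_def norm_mult)
  also have "\<dots> \<le> norm w * norm x"
    by (intro mult_mono real_le_lsqrt ell2_sum_le_norm_sq[OF assms]) (auto simp: sum_nonneg)
  finally show ?thesis .
qed

text \<open>Bilinear rather than sesquilinear: a rank-one matrix with entries
  \<open>u i * w j\<close> acts as \<open>u\<close> times the pairing with \<open>w\<close>, and
  moving an operator to the other side produces its transpose instead of its adjoint.\<close>

definition pairing :: "'i ell2 \<Rightarrow> 'i ell2 \<Rightarrow> complex" where
  "pairing w x = (\<Sum>\<^sub>\<infinity>i. ell2_coord w i * ell2_coord x i)"

lemma pairing_abs_summable: "(\<lambda>i. norm (ell2_coord w i * ell2_coord x i)) summable_on UNIV"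
  by (rule nonneg_bdd_above_summable_on)
     (auto intro!: bdd_aboveI2[where M = "norm w * norm x"] pairing_abs)

lemma pairing_has_sum: "((\<lambda>i. ell2_coord w i * ell2_coord x i) has_sum pairing w x) UNIV"
  unfolding pairing_def using abs_summable_summable[OF pairing_abs_summable] by (rule has_sum_infsum)

lemma norm_pairing_le: "cmod (pairing w x) \<le> norm w * norm x"
proof -
  have "cmod (pairing w x) \<le> (\<Sum>\<^sub>\<infinity>i. norm (ell2_coord w i * ell2_coord x i))"
    unfolding pairing_def by (rule norm_infsum_bound[OF pairing_abs_summable])
  also have "\<dots> \<le> norm w * norm x"
    by (rule infsum_le_finite_sums[OF pairing_abs_summable]) (use pairing_abs in auto)
  finally show ?thesis .
qed

lemma pairing_commute: "pairing w x = pairing x w"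
  by (simp add: pairing_def mult.commute)

lemma bounded_linear_pairing: "bounded_linear (pairing w)"
proof (rule bounded_linear_intro[where K = "norm w"])
  fix x y :: "'a ell2" and r :: real
  have s: "(\<lambda>i. ell2_coord w i * ell2_coord x i) summable_on UNIV" for x :: "'a ell2"
    using pairing_has_sum by (rule has_sum_imp_summable)
  show "pairing w (x + y) = pairing w x + pairing w y"
    unfolding pairing_def by (simp add: algebra_simps infsum_add s)
  show "pairing w (r *\<^sub>R x) = r *\<^sub>R pairing w x"
    unfolding pairing_def by (simp add: scaleR_conv_of_real infsum_cmult_right' mult.left_commute)
  show "norm (pairing w x) \<le> norm x * norm w"
    using norm_pairing_le[of w x] by (simp add: mult.commute)
qed

lemma pairing_cscale [simp]: "pairing w (cscale c x) = c * pairing w x"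
  unfolding pairing_def by (simp add: infsum_cmult_right' mult.left_commute)

lemma pairing_basis [simp]: "pairing w (ell2_basis i) = ell2_coord w i"
proof -
  have "pairing w (ell2_basis i) = (\<Sum>\<^sub>\<infinity>k\<in>{i}. ell2_coord w k)"
    unfolding pairing_def by (rule infsum_cong_neutral) auto
  then show ?thesis by simp
qed

lemma cscale_0 [simp]: "cscale c 0 = 0"
  by (rule ell2_eqI) simp

text \<open>The operators between Hilbert spaces here are only real-linear. The complex-linear ones form
  a Banach algebra, in which the exponential function of the library is available, and only they are
  determined by their entries.\<close>

typedef 'i cop = "{A :: 'i ell2 \<Rightarrow>\<^sub>L 'i ell2. \<forall>c x. blinfun_apply A (cscale c x) = cscale c (blinfun_apply A x)}"
  morphisms op_of Abs_cop
  by (rule exI[of _ 0]) simp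

setup_lifting type_definition_cop

instantiation cop :: (type) real_normed_algebra_1
begin
lift_definition zero_cop :: "'a cop" is 0 by simp
lift_definition one_cop :: "'a cop" is id_blinfun by simp
lift_definition plus_cop :: "'a cop \<Rightarrow> 'a cop \<Rightarrow> 'a cop" is "(+)"
  by (auto intro!: ell2_eqI simp: blinfun.bilinear_simps algebra_simps)
lift_definition minus_cop :: "'a cop \<Rightarrow> 'a cop \<Rightarrow> 'a cop" is "(-)"
  by (auto intro!: ell2_eqI simp: blinfun.bilinear_simps algebra_simps)
lift_definition uminus_cop :: "'a cop \<Rightarrow> 'a cop" is uminus
  by (auto intro!: ell2_eqI simp: blinfun.bilinear_simps algebra_simps)
lift_definition scaleR_cop :: "real \<Rightarrow> 'a cop \<Rightarrow> 'a cop" is scaleR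
  by (auto intro!: ell2_eqI simp: blinfun.bilinear_simps algebra_simps)
lift_definition times_cop :: "'a cop \<Rightarrow> 'a cop \<Rightarrow> 'a cop" is "(o\<^sub>L)"
  by simp
lift_definition norm_cop :: "'a cop \<Rightarrow> real" is norm .
definition sgn_cop :: "'a cop \<Rightarrow> 'a cop" where
  "sgn_cop x = inverse (norm x) *\<^sub>R x"
definition dist_cop :: "'a cop \<Rightarrow> 'a cop \<Rightarrow> real" where
  "dist_cop x y = norm (x - y)"
definition uniformity_cop :: "('a cop \<times> 'a cop) filter" where
  "uniformity_cop = (INF e\<in>{0<..}. principal {(x, y). dist x y < e})"
definition open_cop :: "'a cop set \<Rightarrow> bool" where
  "open_cop U = (\<forall>x\<in>U. \<forall>\<^sub>F (x', y) in uniformity. x' = x \<longrightarrow> y \<in> U)"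
instance
proof
  fix x y z :: "'a cop" and a b :: real
  show "norm (1 :: 'a cop) = 1"
  proof transfer
    show "norm (id_blinfun :: 'a ell2 \<Rightarrow>\<^sub>L 'a ell2) = 1"
      using norm_blinfun[of "id_blinfun :: 'a ell2 \<Rightarrow>\<^sub>L 'a ell2" "ell2_basis undefined"]
      by (intro antisym[OF norm_blinfun_id_le]) simp
  qed
  then show "(0 :: 'a cop) \<noteq> 1"
    by (metis zero_cop.rep_eq norm_cop.rep_eq norm_zero zero_neq_one)
  show "norm (x * y) \<le> norm x * norm y"
    by transfer (rule norm_blinfun_compose)
  show "norm (x + y) \<le> norm x + norm y"
    by transfer (rule norm_triangle_ineq)
qed (transfer; auto simp: sgn_cop_def dist_cop_def uniformity_cop_def open_cop_def
       blinfun.bilinear_simps algebra_simps intro!: blinfun_eqI; fail |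
     auto simp: sgn_cop_def dist_cop_def uniformity_cop_def open_cop_def)+
end

definition capply :: "'i cop \<Rightarrow> 'i ell2 \<Rightarrow> 'i ell2" where
  "capply A = blinfun_apply (op_of A)"

lemma capply_cscale: "capply A (cscale c x) = cscale c (capply A x)"
  unfolding capply_def using op_of[of A] by simp

lemma bounded_linear_capply: "bounded_linear (capply A)"
  unfolding capply_def by (rule blinfun.bounded_linear_right)

lemma norm_capply_le: "norm (capply A x) \<le> norm A * norm x"
  unfolding capply_def norm_cop.rep_eq by (rule norm_blinfun)

lemma capply_simps [simp]:
  "capply (A + B) x = capply A x + capply B x" "capply (A - B) x = capply A x - capply B x"
  "capply (- A) x = - capply A x" "capply (A * B) x = capply A (capply B x)"
  "capply 0 x = 0" "capply 1 x = x" "capply (r *\<^sub>R A) x = r *\<^sub>R capply A x"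
  by (simp_all add: capply_def plus_cop.rep_eq minus_cop.rep_eq uminus_cop.rep_eq times_cop.rep_eq
      zero_cop.rep_eq one_cop.rep_eq scaleR_cop.rep_eq blinfun.bilinear_simps)

lemma cop_make:
  assumes "bounded_linear f" "\<And>c x. f (cscale c x) = cscale c (f x)"
  shows "capply (Abs_cop (Blinfun f)) = f" "op_of (Abs_cop (Blinfun f)) = Blinfun f"
proof -
  show "op_of (Abs_cop (Blinfun f)) = Blinfun f"
    by (rule Abs_cop_inverse) (use assms in \<open>simp add: bounded_linear_Blinfun_apply\<close>)
  then show "capply (Abs_cop (Blinfun f)) = f"
    by (simp add: capply_def bounded_linear_Blinfun_apply assms)
qed

lemma norm_cop_leI:
  assumes "\<And>x. norm (capply A x) \<le> c * norm x" "c \<ge> 0"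
  shows "norm A \<le> c"
  unfolding norm_cop.rep_eq by (rule norm_blinfun_bound) (use assms in \<open>simp_all add: capply_def\<close>)

instance cop :: (type) banach
proof
  fix X :: "nat \<Rightarrow> 'a cop"
  assume X: "Cauchy X"
  have "Cauchy (\<lambda>n. op_of (X n))"
    using X unfolding Cauchy_def dist_norm minus_cop.rep_eq[symmetric] norm_cop.rep_eq[symmetric] .
  then obtain L where L: "(\<lambda>n. op_of (X n)) \<longlonglongrightarrow> L"
    by (auto simp: Cauchy_convergent_iff convergent_def)
  have "blinfun_apply L (cscale c x) = cscale c (blinfun_apply L x)" for c x
  proof (rule LIMSEQ_unique)
    show "(\<lambda>n. blinfun_apply (op_of (X n)) (cscale c x)) \<longlonglongrightarrow> blinfun_apply L (cscale c x)"
      by (intro blinfun.tendsto L tendsto_const)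
    have "(\<lambda>n. cscale c (blinfun_apply (op_of (X n)) x)) \<longlonglongrightarrow> cscale c (blinfun_apply L x)"
      by (intro bounded_linear.tendsto[OF bounded_linear_cscale] blinfun.tendsto L tendsto_const)
    then show "(\<lambda>n. blinfun_apply (op_of (X n)) (cscale c x)) \<longlonglongrightarrow> cscale c (blinfun_apply L x)"
      using op_of[of "X _"] by simp
  qed
  then have M: "op_of (Abs_cop L) = L"
    by (simp add: Abs_cop_inverse)
  have "X \<longlonglongrightarrow> Abs_cop L"
    using L unfolding tendsto_iff dist_norm norm_cop.rep_eq minus_cop.rep_eq M .
  then show "convergent X" by (auto simp: convergent_def)
qed

definition entry :: "'i cop \<Rightarrow> 'i \<Rightarrow> 'i \<Rightarrow> complex" where
  "entry A i j = ell2_coord (capply A (ell2_basis j)) i"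

lemma op_entry_op_of: "op_entry (op_of A) = entry A"
  by (simp add: fun_eq_iff op_entry_def entry_def capply_def)

lemma entry_simps [simp]:
  "entry (A + B) i j = entry A i j + entry B i j" "entry (A - B) i j = entry A i j - entry B i j"
  "entry (- A) i j = - entry A i j" "entry 0 i j = 0" "entry (r *\<^sub>R A) i j = r *\<^sub>R entry A i j"
  "entry 1 i j = (if i = j then 1 else 0)"
  by (simp_all add: entry_def)

lemma bounded_linear_entry: "bounded_linear (\<lambda>A. entry A i j)"
proof (rule bounded_linear_intro[where K = 1])
  fix A :: "'a cop"
  have "cmod (entry A i j) \<le> norm (capply A (ell2_basis j))"
    unfolding entry_def by (rule ell2_coord_le_norm)
  also have "\<dots> \<le> norm A * norm (ell2_basis j)" by (rule norm_capply_le)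
  finally show "norm (entry A i j) \<le> norm A * 1" by simp
qed auto

lemma capply_has_sum: "((\<lambda>j. entry A i j * ell2_coord x j) has_sum ell2_coord (capply A x) i) UNIV"
proof -
  have "bounded_linear (\<lambda>x. ell2_coord (capply A x) i)"
    by (rule bounded_linear_compose[OF bounded_linear_ell2_coord bounded_linear_capply])
  from has_sum_bounded_linear[OF this has_sum_basis[of x]] show ?thesis
    by (simp add: o_def capply_cscale entry_def mult.commute)
qed

lemma entry_mult: "((\<lambda>k. entry A i k * entry B k j) has_sum entry (A * B) i j) UNIV"
  using capply_has_sum[of A i "capply B (ell2_basis j)"] by (simp add: entry_def)

lemma cop_eqI:
  assumes "\<And>i j. entry A i j = entry B i j"
  shows "A = B"
proof -
  have "capply A x = capply B x" for x
    by (rule ell2_eqI, rule has_sum_unique[OF capply_has_sum]) (simp add: assms capply_has_sum)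
  then have "op_of A = op_of B"
    by (intro blinfun_eqI) (simp add: capply_def)
  then show ?thesis by (simp add: op_of_inject)
qed

lemma row_vector:
  obtains w where "\<And>j. ell2_coord w j = entry A i j" "norm w \<le> norm A"
    "\<And>x. ell2_coord (capply A x) i = pairing w x"
proof (rule riesz[of "\<lambda>x. ell2_coord (capply A x) i" "norm A"])
  show "bounded_linear (\<lambda>x. ell2_coord (capply A x) i)"
    by (rule bounded_linear_compose[OF bounded_linear_ell2_coord bounded_linear_capply])
  show "cmod (ell2_coord (capply A x) i) \<le> norm A * norm x" for x
    by (rule order_trans[OF ell2_coord_le_norm norm_capply_le])
  fix w
  assume w: "\<And>j. ell2_coord w j = ell2_coord (capply A (ell2_basis j)) i" "norm w \<le> norm A"
    "\<And>x. ((\<lambda>j. ell2_coord w j * ell2_coord x j) has_sum ell2_coord (capply A x) i) UNIV"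
  show thesis
    by (rule that[of w]) (auto simp: w entry_def intro: has_sum_unique[OF w(3) pairing_has_sum])
qed (simp add: capply_cscale)

text \<open>\<open>v\<close> is the transpose of \<open>A\<close> applied to \<open>w\<close>,
  obtained from \<open>riesz\<close> for one vector at a time.\<close>

lemma transpose_vector:
  obtains v where "\<And>x. pairing v x = pairing w (capply A x)" "norm v \<le> norm w * norm A"
proof (rule riesz[of "\<lambda>x. pairing w (capply A x)" "norm w * norm A"])
  show "bounded_linear (\<lambda>x. pairing w (capply A x))"
    by (rule bounded_linear_compose[OF bounded_linear_pairing bounded_linear_capply])
  show "cmod (pairing w (capply A x)) \<le> norm w * norm A * norm x" for x
    using order_trans[OF norm_pairing_le mult_left_mono[OF norm_capply_le norm_ge_zero]] by (simp add: mult.assoc)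
  fix v
  assume v: "norm v \<le> norm w * norm A"
    "\<And>x. ((\<lambda>i. ell2_coord v i * ell2_coord x i) has_sum pairing w (capply A x)) UNIV"
  show thesis
    by (rule that[OF has_sum_unique[OF pairing_has_sum v(2)] v(1)])
qed (simp add: capply_cscale)

definition proj :: "'i set \<Rightarrow> 'i cop" where
  "proj A = Abs_cop (Blinfun (restr A))"

lemma bounded_linear_restr: "bounded_linear (restr A)"
  by (rule bounded_linear_intro[where K = 1]) (auto intro!: ell2_eqI simp: norm_restr_le)

lemma capply_proj [simp]: "capply (proj A) x = restr A x"
  unfolding proj_def by (subst cop_make) (auto intro!: bounded_linear_restr ell2_eqI)

lemma norm_proj_le: "norm (proj A) \<le> 1"
  by (rule norm_cop_leI) (auto simp: norm_restr_le)

lemma entry_proj: "entry (proj A) i j = (if i = j \<and> i \<in> A then 1 else 0)"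
  by (simp add: entry_def)

lemma entry_proj_mult: "entry (proj A * B) i j = (if i \<in> A then entry B i j else 0)"
  by (simp add: entry_def)

lemma restr_basis: "restr A (ell2_basis j) = (if j \<in> A then ell2_basis j else 0)"
  by (rule ell2_eqI) auto

lemma entry_mult_proj: "entry (B * proj A) i j = (if j \<in> A then entry B i j else 0)"
  by (simp add: entry_def restr_basis linear_0[OF bounded_linear.linear[OF bounded_linear_capply]])

lemma proj_idem: "proj A * proj A = proj A"
  by (rule cop_eqI) (simp add: entry_proj_mult entry_proj)

lemma proj_compl: "proj A + proj (- A) = 1"
  by (rule cop_eqI) (simp add: entry_proj)

lemma entry_mult_finite:
  assumes "finite F" "\<And>k. k \<notin> F \<Longrightarrow> entry A i k = 0 \<or> entry B k j = 0"
  shows "entry (A * B) i j = (\<Sum>k\<in>F. entry A i k * entry B k j)"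
proof -
  have "((\<lambda>k. entry A i k * entry B k j) has_sum (\<Sum>k\<in>F. entry A i k * entry B k j)) F"
    by (rule has_sum_finite[OF assms(1)])
  then have "((\<lambda>k. entry A i k * entry B k j) has_sum (\<Sum>k\<in>F. entry A i k * entry B k j)) UNIV"
    by (subst has_sum_cong_neutral[where T = F and g = "\<lambda>k. entry A i k * entry B k j"]) (use assms(2) in auto)
  then show ?thesis by (rule has_sum_unique[OF entry_mult])
qed

lemma op_exp_op_of: "op_exp (op_of A) = op_of (exp A)"
proof -
  have p: "((\<lambda>B. op_of A o\<^sub>L B) ^^ n) id_blinfun = op_of (A ^ n)" for n
    by (induction n) (simp_all add: one_cop.rep_eq times_cop.rep_eq)
  have bl: "bounded_linear (op_of :: 'a cop \<Rightarrow> _)"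
    by (rule bounded_linear_intro[where K = 1])
       (auto simp: plus_cop.rep_eq scaleR_cop.rep_eq norm_cop.rep_eq)
  have "(\<lambda>n. op_of (A ^ n /\<^sub>R fact n)) sums op_of (exp A)"
    by (rule bounded_linear.sums[OF bl exp_converges])
  then show ?thesis
    unfolding op_exp_def p by (simp add: scaleR_cop.rep_eq sums_iff)
qed

lemma op_trace_op_of: "op_trace (op_of A) = (\<Sum>\<^sub>\<infinity>i. entry A i i)"
  by (simp add: op_trace_def op_entry_op_of)

section \<open>Nuclear operators\<close>

text \<open>In effect the trace norm is at most \<open>c\<close>, witnessed by a series of rank-one
  matrices. The property is stated for matrices of entries and not for operators because the
  Lipschitz estimate of the determinant perturbs by complex multiples, while the operators carry
  only real scaling.\<close>

definition nuclear :: "real \<Rightarrow> ('i \<Rightarrow> 'i \<Rightarrow> complex) \<Rightarrow> bool" where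
  "nuclear c M \<longleftrightarrow> (\<exists>(u :: nat \<Rightarrow> 'i ell2) w.
     (\<forall>F. finite F \<longrightarrow> (\<Sum>k\<in>F. norm (u k) * norm (w k)) \<le> c) \<and>
     (\<forall>i j. ((\<lambda>k. ell2_coord (u k) i * ell2_coord (w k) j) has_sum M i j) UNIV))"

text \<open>Any countable index set may number the rank-one terms; natural numbers outside the range
  of \<open>to_nat\<close> are filled with zero vectors.\<close>

lemma nuclearI:
  fixes u w :: "'k::countable \<Rightarrow> 'i ell2"
  assumes c: "\<And>F. finite F \<Longrightarrow> (\<Sum>k\<in>F. norm (u k) * norm (w k)) \<le> c"
    and M: "\<And>i j. ((\<lambda>k. ell2_coord (u k) i * ell2_coord (w k) j) has_sum M i j) UNIV"
  shows "nuclear c M"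
proof -
  define R where "R = range (to_nat :: 'k \<Rightarrow> nat)"
  define u' where "u' = (\<lambda>n. if n \<in> R then u (from_nat n) else 0)"
  define w' where "w' = (\<lambda>n. if n \<in> R then w (from_nat n) else 0)"
  have "(\<Sum>k\<in>F. norm (u' k) * norm (w' k)) \<le> c" if F: "finite F" for F
  proof -
    have inj: "inj_on (from_nat :: nat \<Rightarrow> 'k) (F \<inter> R)"
      by (rule inj_onI) (auto simp: R_def)
    have "(\<Sum>k\<in>F. norm (u' k) * norm (w' k)) = (\<Sum>k\<in>F \<inter> R. norm (u (from_nat k)) * norm (w (from_nat k)))"
      using F by (subst sum.inter_restrict) (auto simp: u'_def w'_def intro!: sum.cong)
    also have "\<dots> = (\<Sum>k\<in>from_nat ` (F \<inter> R). norm (u k) * norm (w k))"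
      by (simp add: sum.reindex[OF inj])
    also have "\<dots> \<le> c" using F by (intro c) simp
    finally show ?thesis .
  qed
  moreover have "((\<lambda>k. ell2_coord (u' k) i * ell2_coord (w' k) j) has_sum M i j) UNIV" for i j
  proof -
    have "((\<lambda>k. ell2_coord (u' k) i * ell2_coord (w' k) j) \<circ> to_nat has_sum M i j) (UNIV :: 'k set)"
      using M[of i j] by (simp add: u'_def w'_def o_def R_def)
    then have "((\<lambda>k. ell2_coord (u' k) i * ell2_coord (w' k) j) has_sum M i j) R"
      unfolding R_def by (subst has_sum_reindex) auto
    then show ?thesis
      by (subst has_sum_cong_neutral[where T = R]) (auto simp: u'_def)
  qed
  ultimately show ?thesis unfolding nuclear_def by blast
qed

lemma nuclearE:
  assumes "nuclear c M"
  obtains u w :: "nat \<Rightarrow> 'i ell2" where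
    "\<And>F. finite F \<Longrightarrow> (\<Sum>k\<in>F. norm (u k) * norm (w k)) \<le> c"
    "\<And>i j. ((\<lambda>k. ell2_coord (u k) i * ell2_coord (w k) j) has_sum M i j) UNIV"
  using assms unfolding nuclear_def by blast

lemma nuclear_nonneg: "nuclear c M \<Longrightarrow> c \<ge> 0"
  by (erule nuclearE) (metis finite.emptyI sum.empty)

lemma nuclear_mono: "nuclear c M \<Longrightarrow> c \<le> d \<Longrightarrow> nuclear d M"
  unfolding nuclear_def by (meson order_trans)

lemma nuclear_0: "nuclear 0 (\<lambda>i j. 0)"
  unfolding nuclear_def by (intro exI[of _ "\<lambda>_. 0"]) simp

lemma nuclear_cmult:
  assumes "nuclear c M"
  shows "nuclear (cmod z * c) (\<lambda>i j. z * M i j)"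
  using assms
proof (rule nuclearE)
  fix u w :: "nat \<Rightarrow> 'a ell2"
  assume c: "\<And>F. finite F \<Longrightarrow> (\<Sum>k\<in>F. norm (u k) * norm (w k)) \<le> c"
    and M: "\<And>i j. ((\<lambda>k. ell2_coord (u k) i * ell2_coord (w k) j) has_sum M i j) UNIV"
  show ?thesis
  proof (rule nuclearI[where u = "\<lambda>k. cscale z (u k)" and w = w])
    fix F :: "nat set" assume "finite F"
    then show "(\<Sum>k\<in>F. norm (cscale z (u k)) * norm (w k)) \<le> cmod z * c"
      using mult_left_mono[OF c norm_ge_zero[of z]] by (simp add: sum_distrib_left mult.assoc)
  next
    fix i j
    show "((\<lambda>k. ell2_coord (cscale z (u k)) i * ell2_coord (w k) j) has_sum z * M i j) UNIV"
      using has_sum_cmult_right[OF M, of z] by (simp add: mult.assoc)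
  qed
qed

text \<open>The rank-one expansions of all summands are joined into a single one indexed by pairs.
  The bounds make it absolutely summable, so it may be summed over \<open>k\<close> first and over
  \<open>n\<close> afterwards.\<close>

lemma nuclear_suminf:
  assumes N: "\<And>n::nat. nuclear (c n) (N n)" and c: "summable c"
    and M: "\<And>i j. (\<lambda>n. N n i j) sums M i j"
  shows "nuclear (suminf c) M"
proof -
  have c0: "c n \<ge> 0" for n using N nuclear_nonneg by blast
  have "\<exists>p :: nat \<Rightarrow> (nat \<Rightarrow> 'a ell2) \<times> (nat \<Rightarrow> 'a ell2). \<forall>n. (\<forall>F. finite F \<longrightarrow> (\<Sum>k\<in>F. norm (fst (p n) k) * norm (snd (p n) k)) \<le> c n)
      \<and> (\<forall>i j. ((\<lambda>k. ell2_coord (fst (p n) k) i * ell2_coord (snd (p n) k) j) has_sum N n i j) UNIV)"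
  proof (rule choice, rule allI)
    fix n
    show "\<exists>p :: (nat \<Rightarrow> 'a ell2) \<times> (nat \<Rightarrow> 'a ell2).
        (\<forall>F. finite F \<longrightarrow> (\<Sum>k\<in>F. norm (fst p k) * norm (snd p k)) \<le> c n)
      \<and> (\<forall>i j. ((\<lambda>k. ell2_coord (fst p k) i * ell2_coord (snd p k) j) has_sum N n i j) UNIV)"
      using N[of n] unfolding nuclear_def by (auto intro: exI[of _ "(_, _)"])
  qed
  then obtain p :: "nat \<Rightarrow> (nat \<Rightarrow> 'a ell2) \<times> (nat \<Rightarrow> 'a ell2)" where
    p: "\<forall>n. (\<forall>F. finite F \<longrightarrow> (\<Sum>k\<in>F. norm (fst (p n) k) * norm (snd (p n) k)) \<le> c n)
      \<and> (\<forall>i j. ((\<lambda>k. ell2_coord (fst (p n) k) i * ell2_coord (snd (p n) k) j) has_sum N n i j) UNIV)" ..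
  define u w where "u = (\<lambda>n. fst (p n))" and "w = (\<lambda>n. snd (p n))"
  have uw: "(\<Sum>k\<in>F. norm (u n k) * norm (w n k)) \<le> c n" if "finite F" for n F
    using p that unfolding u_def w_def by simp
  have NM: "((\<lambda>k. ell2_coord (u n k) i * ell2_coord (w n k) j) has_sum N n i j) UNIV" for n i j
    using p unfolding u_def w_def by simp
  have fin: "(\<Sum>p\<in>F. norm (u (fst p) (snd p)) * norm (w (fst p) (snd p))) \<le> suminf c"
    if F: "finite F" for F
  proof -
    have "(\<Sum>p\<in>F. norm (u (fst p) (snd p)) * norm (w (fst p) (snd p)))
        \<le> (\<Sum>p\<in>fst ` F \<times> snd ` F. norm (u (fst p) (snd p)) * norm (w (fst p) (snd p)))"
      using F by (intro sum_mono2 subset_fst_snd) auto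
    also have "\<dots> = (\<Sum>n\<in>fst ` F. \<Sum>k\<in>snd ` F. norm (u n k) * norm (w n k))"
      by (simp add: sum.cartesian_product case_prod_beta)
    also have "\<dots> \<le> (\<Sum>n\<in>fst ` F. c n)"
      using F by (intro sum_mono uw) simp
    also have "\<dots> \<le> suminf c"
      using F c c0 by (intro sum_le_suminf) auto
    finally show ?thesis .
  qed
  show ?thesis
  proof (rule nuclearI[where u = "\<lambda>p. u (fst p) (snd p)" and w = "\<lambda>p. w (fst p) (snd p)"])
    fix i j
    let ?f = "\<lambda>p. ell2_coord (u (fst p) (snd p)) i * ell2_coord (w (fst p) (snd p)) j"
    have "(\<lambda>p. norm (?f p)) summable_on UNIV"
    proof (rule nonneg_bdd_above_summable_on)
      have "(\<Sum>p\<in>F. norm (?f p)) \<le> suminf c" if "finite F" for F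
      proof -
        have "(\<Sum>p\<in>F. norm (?f p)) \<le> (\<Sum>p\<in>F. norm (u (fst p) (snd p)) * norm (w (fst p) (snd p)))"
          by (intro sum_mono) (simp add: norm_mult mult_mono ell2_coord_le_norm)
        then show ?thesis using fin[OF that] by linarith
      qed
      then show "bdd_above (sum (\<lambda>p. norm (?f p)) ` {F. F \<subseteq> UNIV \<and> finite F})"
        by (auto intro!: bdd_aboveI2[where M = "suminf c"])
    qed simp
    then have s: "?f summable_on UNIV" by (rule abs_summable_summable)
    then have s': "(\<lambda>(n, k). ell2_coord (u n k) i * ell2_coord (w n k) j) summable_on UNIV \<times> UNIV"
      by (simp add: case_prod_unfold)
    have "infsum ?f UNIV = (\<Sum>\<^sub>\<infinity>n. \<Sum>\<^sub>\<infinity>k. ell2_coord (u n k) i * ell2_coord (w n k) j)"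
      using infsum_Sigma'_banach[OF s'] by (simp add: case_prod_unfold)
    also have "\<dots> = (\<Sum>\<^sub>\<infinity>n. N n i j)"
      by (simp add: infsumI[OF NM])
    also have "\<dots> = M i j"
    proof -
      have "(\<lambda>n. \<Sum>\<^sub>\<infinity>k. ell2_coord (u n k) i * ell2_coord (w n k) j) summable_on UNIV"
        by (rule summable_on_Sigma_banach[OF s'])
      then have "(\<lambda>n. N n i j) summable_on UNIV"
        by (simp add: infsumI[OF NM])
      then show ?thesis
        using has_sum_imp_sums[OF has_sum_infsum] M sums_unique2 by blast
    qed
    finally have "infsum ?f UNIV = M i j" .
    then show "(?f has_sum M i j) UNIV" using has_sum_infsum[OF s] by simp
  qed (use fin in auto)
qed

lemma nuclear_add:
  assumes "nuclear c M" "nuclear d N"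
  shows "nuclear (c + d) (\<lambda>i j. M i j + N i j)"
proof -
  let ?c = "\<lambda>n::nat. if n = 0 then c else if n = 1 then d else 0"
  let ?N = "\<lambda>n::nat. if n = 0 then M else if n = 1 then N else (\<lambda>i j. 0)"
  have c: "?c sums (c + d)"
    using sums_finite[of "{0, 1}" ?c] by simp
  have M: "(\<lambda>n. ?N n i j) sums (M i j + N i j)" for i j
    using sums_finite[of "{0, 1}" "\<lambda>n. ?N n i j"] by simp
  have "nuclear (suminf ?c) (\<lambda>i j. M i j + N i j)"
  proof (rule nuclear_suminf[OF _ _ M])
    show "nuclear (?c n) (?N n)" for n using assms by (auto intro: nuclear_0)
  qed (use c in \<open>simp add: sums_iff\<close>)
  then show ?thesis using c by (simp add: sums_iff)
qed

text \<open>For finitely many rank-one terms this is Cauchy-Schwarz in the diagonal index. The bound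
  passes to the entrywise limit because only finitely many diagonal entries are involved at a
  time.\<close>

lemma nuclear_summable_diag:
  assumes "nuclear c M"
  shows "(\<lambda>i. norm (M i i)) summable_on UNIV" "(\<Sum>\<^sub>\<infinity>i. norm (M i i)) \<le> c"
proof -
  obtain u w :: "nat \<Rightarrow> 'a ell2" where
    c: "\<And>F. finite F \<Longrightarrow> (\<Sum>k\<in>F. norm (u k) * norm (w k)) \<le> c" and
    M: "\<And>i j. ((\<lambda>k. ell2_coord (u k) i * ell2_coord (w k) j) has_sum M i j) UNIV"
    using nuclearE[OF assms] by blast
  have fin: "(\<Sum>i\<in>F. norm (M i i)) \<le> c" if F: "finite F" for F
  proof (rule tendsto_upperbound)
    show "((\<lambda>K. \<Sum>i\<in>F. norm (\<Sum>k\<in>K. ell2_coord (u k) i * ell2_coord (w k) i))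
        \<longlongrightarrow> (\<Sum>i\<in>F. norm (M i i))) (finite_subsets_at_top UNIV)"
      using M unfolding has_sum_def by (intro tendsto_intros) auto
    show "eventually (\<lambda>K. (\<Sum>i\<in>F. norm (\<Sum>k\<in>K. ell2_coord (u k) i * ell2_coord (w k) i)) \<le> c)
        (finite_subsets_at_top UNIV)"
    proof (rule eventually_finite_subsets_at_top_weakI)
      fix K :: "nat set" assume K: "finite K"
      have "(\<Sum>i\<in>F. norm (\<Sum>k\<in>K. ell2_coord (u k) i * ell2_coord (w k) i))
          \<le> (\<Sum>i\<in>F. \<Sum>k\<in>K. norm (ell2_coord (u k) i * ell2_coord (w k) i))"
        by (intro sum_mono norm_sum)
      also have "\<dots> = (\<Sum>k\<in>K. \<Sum>i\<in>F. norm (ell2_coord (u k) i * ell2_coord (w k) i))"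
        by (rule sum.swap)
      also have "\<dots> \<le> (\<Sum>k\<in>K. norm (u k) * norm (w k))"
        by (intro sum_mono pairing_abs F)
      also have "\<dots> \<le> c" by (rule c[OF K])
      finally show "(\<Sum>i\<in>F. norm (\<Sum>k\<in>K. ell2_coord (u k) i * ell2_coord (w k) i)) \<le> c" .
    qed
  qed simp
  show s: "(\<lambda>i. norm (M i i)) summable_on UNIV"
    by (rule nonneg_bdd_above_summable_on) (use fin in \<open>auto intro!: bdd_aboveI2[where M = c]\<close>)
  show "(\<Sum>\<^sub>\<infinity>i. norm (M i i)) \<le> c"
    by (rule infsum_le_finite_sums[OF s]) (use fin in auto)
qed

section \<open>Nuclear operators as a two-sided ideal\<close>

definition nuc :: "real \<Rightarrow> 'i cop \<Rightarrow> bool" where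
  "nuc c A \<longleftrightarrow> nuclear c (entry A)"

lemma nuc_nonneg: "nuc c A \<Longrightarrow> c \<ge> 0"
  unfolding nuc_def by (rule nuclear_nonneg)

lemma nuc_mono: "nuc c A \<Longrightarrow> c \<le> d \<Longrightarrow> nuc d A"
  unfolding nuc_def by (rule nuclear_mono)

lemma nuc_0: "nuc 0 0"
proof -
  have "entry (0 :: 'a cop) = (\<lambda>i j. 0)" by (intro ext) simp
  then show ?thesis using nuclear_0 by (simp add: nuc_def)
qed

lemma nuc_add:
  assumes "nuc c A" "nuc d B"
  shows "nuc (c + d) (A + B)"
proof -
  have "entry (A + B) = (\<lambda>i j. entry A i j + entry B i j)" by (intro ext) simp
  then show ?thesis using nuclear_add assms by (simp add: nuc_def)
qed

lemma nuc_scaleR: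
  assumes "nuc c A"
  shows "nuc (\<bar>r\<bar> * c) (r *\<^sub>R A)"
proof -
  have "entry (r *\<^sub>R A) = (\<lambda>i j. complex_of_real r * entry A i j)"
    by (intro ext) (simp only: entry_simps scaleR_conv_of_real[where 'a = complex])
  then show ?thesis using nuclear_cmult[of c "entry A" "complex_of_real r"] assms by (simp add: nuc_def)
qed

lemma nuc_uminus: "nuc c A \<Longrightarrow> nuc c (- A)"
  using nuc_scaleR[of c A "-1"] by simp

lemma nuc_diff: "nuc c A \<Longrightarrow> nuc d B \<Longrightarrow> nuc (c + d) (A - B)"
  using nuc_add[of c A d "- B"] nuc_uminus[of d B] by simp

lemma nuc_sums:
  assumes "\<And>n::nat. nuc (c n) (A n)" "summable c" "A sums B"
  shows "nuc (suminf c) B"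
  unfolding nuc_def
proof (rule nuclear_suminf[where N = "\<lambda>n. entry (A n)"])
  show "nuclear (c n) (entry (A n))" for n using assms(1) by (simp add: nuc_def)
  show "(\<lambda>n. entry (A n) i j) sums entry B i j" for i j
    by (rule bounded_linear.sums[OF bounded_linear_entry assms(3)])
qed (rule assms(2))

lemma nuc_sum:
  assumes "\<And>n. n \<in> I \<Longrightarrow> nuc (c n) (A n)"
  shows "nuc (\<Sum>n\<in>I. c n) (\<Sum>n\<in>I. A n)"
  using assms by (induction I rule: infinite_finite_induct) (auto simp: nuc_0 intro: nuc_add)

text \<open>Entrywise convergence of the expansion is upgraded to norm convergence of each column,
  which allows a bounded operator to be applied term by term.\<close>

lemma summable_rank_one:
  fixes u w :: "nat \<Rightarrow> 'i ell2"
  assumes c: "\<And>F. finite F \<Longrightarrow> (\<Sum>k\<in>F. norm (u k) * norm (w k)) \<le> c"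
  shows "(\<lambda>k. cscale (ell2_coord (w k) j) (u k)) summable_on UNIV"
proof (rule abs_summable_summable, rule nonneg_bdd_above_summable_on)
  have "(\<Sum>k\<in>F. norm (cscale (ell2_coord (w k) j) (u k))) \<le> c" if "finite F" for F
  proof -
    have "(\<Sum>k\<in>F. norm (cscale (ell2_coord (w k) j) (u k))) \<le> (\<Sum>k\<in>F. norm (u k) * norm (w k))"
      by (intro sum_mono) (simp add: mult.commute mult_left_mono ell2_coord_le_norm)
    then show ?thesis using c[OF that] by linarith
  qed
  then show "bdd_above (sum (\<lambda>k. norm (cscale (ell2_coord (w k) j) (u k))) ` {F. F \<subseteq> UNIV \<and> finite F})"
    by (auto intro!: bdd_aboveI2[where M = c])
qed simp

lemma nuc_mult_left:
  assumes "nuc c K"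
  shows "nuc (norm A * c) (A * K)"
proof -
  obtain u w :: "nat \<Rightarrow> 'a ell2" where
    c: "\<And>F. finite F \<Longrightarrow> (\<Sum>k\<in>F. norm (u k) * norm (w k)) \<le> c" and
    M: "\<And>i j. ((\<lambda>k. ell2_coord (u k) i * ell2_coord (w k) j) has_sum entry K i j) UNIV"
    using nuclearE[OF assms[unfolded nuc_def]] by blast
  show ?thesis unfolding nuc_def
  proof (rule nuclearI[where u = "\<lambda>k. capply A (u k)" and w = w])
    fix F :: "nat set" assume F: "finite F"
    have "(\<Sum>k\<in>F. norm (capply A (u k)) * norm (w k)) \<le> (\<Sum>k\<in>F. norm A * (norm (u k) * norm (w k)))"
      by (intro sum_mono) (simp add: mult.assoc[symmetric] mult_right_mono norm_capply_le)
    also have "\<dots> \<le> norm A * c"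
      using c[OF F] by (simp add: sum_distrib_left[symmetric] mult_left_mono)
    finally show "(\<Sum>k\<in>F. norm (capply A (u k)) * norm (w k)) \<le> norm A * c" .
  next
    fix i j
    obtain s where s: "((\<lambda>k. cscale (ell2_coord (w k) j) (u k)) has_sum s) UNIV"
      using summable_rank_one[of u w c j] c by (auto simp: summable_on_def)
    have "s = capply K (ell2_basis j)"
    proof (rule ell2_eqI)
      fix l
      from has_sum_bounded_linear[OF bounded_linear_ell2_coord s, of l]
      have "((\<lambda>k. ell2_coord (u k) l * ell2_coord (w k) j) has_sum ell2_coord s l) UNIV"
        by (simp add: o_def mult.commute)
      then show "ell2_coord s l = ell2_coord (capply K (ell2_basis j)) l"
        using has_sum_unique[OF _ M[of l j]] by (simp add: entry_def)
    qed
    then have "entry (A * K) i j = ell2_coord (capply A s) i" by (simp add: entry_def)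
    moreover have "bounded_linear (\<lambda>x. ell2_coord (capply A x) i)"
      by (rule bounded_linear_compose[OF bounded_linear_ell2_coord bounded_linear_capply])
    ultimately show "((\<lambda>k. ell2_coord (capply A (u k)) i * ell2_coord (w k) j) has_sum entry (A * K) i j) UNIV"
      using has_sum_bounded_linear[OF _ s, of "\<lambda>x. ell2_coord (capply A x) i"]
      by (simp add: o_def capply_cscale mult.commute)
  qed
qed

text \<open>Mirror image of \<open>nuc_mult_left\<close>: the operator moves onto the second vectors
  through its transpose, and the rows of \<open>K\<close> take the place of its columns.\<close>

lemma nuc_mult_right:
  assumes "nuc c K"
  shows "nuc (norm A * c) (K * A)"
proof -
  obtain u w :: "nat \<Rightarrow> 'a ell2" where
    c: "\<And>F. finite F \<Longrightarrow> (\<Sum>k\<in>F. norm (u k) * norm (w k)) \<le> c" and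
    M: "\<And>i j. ((\<lambda>k. ell2_coord (u k) i * ell2_coord (w k) j) has_sum entry K i j) UNIV"
    using nuclearE[OF assms[unfolded nuc_def]] by blast
  have "\<forall>k. \<exists>v. (\<forall>x. pairing v x = pairing (w k) (capply A x)) \<and> norm v \<le> norm (w k) * norm A"
    using transpose_vector[of "w _" A] by metis
  then obtain v where v: "\<And>k x. pairing (v k) x = pairing (w k) (capply A x)"
    "\<And>k. norm (v k) \<le> norm (w k) * norm A" by metis
  have vj: "ell2_coord (v k) j = pairing (w k) (capply A (ell2_basis j))" for k j
    using v(1)[of k "ell2_basis j"] by simp
  show ?thesis unfolding nuc_def
  proof (rule nuclearI[where u = u and w = v])
    fix F :: "nat set" assume F: "finite F"
    have "(\<Sum>k\<in>F. norm (u k) * norm (v k)) \<le> (\<Sum>k\<in>F. norm A * (norm (u k) * norm (w k)))"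
    proof (rule sum_mono)
      fix k
      show "norm (u k) * norm (v k) \<le> norm A * (norm (u k) * norm (w k))"
        using mult_left_mono[OF v(2)[of k] norm_ge_zero[of "u k"]] by (simp add: mult_ac)
    qed
    also have "\<dots> \<le> norm A * c"
      using c[OF F] by (simp add: sum_distrib_left[symmetric] mult_left_mono)
    finally show "(\<Sum>k\<in>F. norm (u k) * norm (v k)) \<le> norm A * c" .
  next
    fix i j
    obtain s where s: "((\<lambda>k. cscale (ell2_coord (u k) i) (w k)) has_sum s) UNIV"
      using summable_rank_one[of w u c i] c by (auto simp: summable_on_def mult.commute)
    obtain r where r: "\<And>l. ell2_coord r l = entry K i l" "\<And>x. ell2_coord (capply K x) i = pairing r x"
      using row_vector[of K i] by metis
    have "s = r"
    proof (rule ell2_eqI)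
      fix l
      from has_sum_bounded_linear[OF bounded_linear_ell2_coord s, of l]
      have "((\<lambda>k. ell2_coord (u k) i * ell2_coord (w k) l) has_sum ell2_coord s l) UNIV"
        by (simp add: o_def)
      then show "ell2_coord s l = ell2_coord r l"
        using has_sum_unique[OF _ M[of i l]] by (simp add: r(1))
    qed
    then have "entry (K * A) i j = pairing (capply A (ell2_basis j)) s"
      by (simp add: entry_def r(2) pairing_commute)
    then show "((\<lambda>k. ell2_coord (u k) i * ell2_coord (v k) j) has_sum entry (K * A) i j) UNIV"
      using has_sum_bounded_linear[OF bounded_linear_pairing s, of "capply A (ell2_basis j)"]
      by (simp add: o_def vj pairing_commute)
  qed
qed

lemma nuc_mult_left_le: "nuc c K \<Longrightarrow> norm A \<le> a \<Longrightarrow> nuc (a * c) (A * K)"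
  using nuc_mono[OF nuc_mult_left] nuc_nonneg mult_right_mono by metis

lemma nuc_mult_right_le: "nuc c K \<Longrightarrow> norm A \<le> a \<Longrightarrow> nuc (a * c) (K * A)"
  using nuc_mono[OF nuc_mult_right] nuc_nonneg mult_right_mono by metis

text \<open>\<open>K - P K P\<close> splits into \<open>(1 - P) K\<close> and
  \<open>P K (1 - P)\<close>. Every rank-one term of either part tends to zero as \<open>F\<close>
  grows, and the summable products of norms dominate all terms at once, so Tannery's theorem applies
  along the net of finite sets.\<close>

lemma nuc_truncate:
  assumes "nuc c K"
  obtains e where "(e \<longlongrightarrow> 0) (finite_subsets_at_top UNIV)"
    "\<And>F. nuc (e F) (K - proj F * K * proj F)"
proof -
  obtain u w :: "nat \<Rightarrow> 'a ell2" where
    c: "\<And>F. finite F \<Longrightarrow> (\<Sum>k\<in>F. norm (u k) * norm (w k)) \<le> c" and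
    M: "\<And>i j. ((\<lambda>k. ell2_coord (u k) i * ell2_coord (w k) j) has_sum entry K i j) UNIV"
    using nuclearE[OF assms[unfolded nuc_def]] by blast
  have sm: "summable (\<lambda>k. norm (u k) * norm (w k))"
    by (rule bounded_imp_summable[where B = c]) (use c[of "{.._}"] in auto)
  have le2: "norm (x - restr F x) \<le> norm x" for x :: "'a ell2" and F
  proof (rule power2_le_imp_le)
    show "(norm (x - restr F x))\<^sup>2 \<le> (norm x)\<^sup>2"
      using norm_sq_restr_compl[of x F] zero_le_power2[of "norm (restr F x)"] by linarith
  qed simp
  define f where "f = (\<lambda>k F. norm (u k - restr F (u k)) * norm (w k))"
  define g where "g = (\<lambda>k F. norm (u k) * norm (w k - restr F (w k)))"
  have fle: "f k F \<le> norm (u k) * norm (w k)" and gle: "g k F \<le> norm (u k) * norm (w k)" for k F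
    by (auto simp: f_def g_def intro!: mult_mono le2)
  have f0: "f k F \<ge> 0" and g0: "g k F \<ge> 0" for k F by (auto simp: f_def g_def)
  have sf: "summable (\<lambda>k. f k F)" and sg: "summable (\<lambda>k. g k F)" for F
    by (rule summable_comparison_test'[OF sm, of 0]; use fle gle f0 g0 in simp)+
  have res: "((\<lambda>F. norm (x - restr F x)) \<longlongrightarrow> 0) (finite_subsets_at_top UNIV)" for x :: "'a ell2"
    using tendsto_norm[OF tendsto_diff[OF tendsto_const[of x] tendsto_restr[of x]]] by simp
  have tf: "((\<lambda>F. f k F) \<longlongrightarrow> 0) (finite_subsets_at_top UNIV)"
    and tg: "((\<lambda>F. g k F) \<longlongrightarrow> 0) (finite_subsets_at_top UNIV)" for k
    using tendsto_mult[OF res[of "u k"] tendsto_const[of "norm (w k)"]]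
      tendsto_mult[OF tendsto_const[of "norm (u k)"] res[of "w k"]] by (simp_all add: f_def g_def)
  have lim: "((\<lambda>F. \<Sum>k. h k F) \<longlongrightarrow> 0) (finite_subsets_at_top UNIV)"
    if "\<And>k. ((\<lambda>F. h k F) \<longlongrightarrow> 0) (finite_subsets_at_top UNIV)"
      "\<And>k F. norm (h k F) \<le> norm (u k) * norm (w k)" for h :: "nat \<Rightarrow> 'a set \<Rightarrow> real"
  proof -
    have "eventually (\<lambda>(k, F). norm (h k F) \<le> norm (u k) * norm (w k)) (at_top \<times>\<^sub>F finite_subsets_at_top UNIV)"
      using that(2) by (intro always_eventually) (simp add: case_prod_beta)
    from tannerys_theorem[OF that(1) this sm] show ?thesis by simp
  qed
  show thesis
  proof (rule that[of "\<lambda>F. (\<Sum>k. f k F) + (\<Sum>k. g k F)"])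
    show "((\<lambda>F. (\<Sum>k. f k F) + (\<Sum>k. g k F)) \<longlongrightarrow> 0) (finite_subsets_at_top UNIV)"
      using tendsto_add[OF lim[of f] lim[of g]] tf tg fle gle f0 g0 by simp
    fix F :: "'a set"
    have 1: "nuclear (\<Sum>k. f k F) (\<lambda>i j. if i \<in> F then 0 else entry K i j)"
    proof (rule nuclearI[where u = "\<lambda>k. u k - restr F (u k)" and w = w])
      fix G :: "nat set" assume "finite G"
      then show "(\<Sum>k\<in>G. norm (u k - restr F (u k)) * norm (w k)) \<le> (\<Sum>k. f k F)"
        using sum_le_suminf[OF sf[of F], of G] f0 by (simp add: f_def)
    next
      show "((\<lambda>k. ell2_coord (u k - restr F (u k)) i * ell2_coord (w k) j)
          has_sum (if i \<in> F then 0 else entry K i j)) UNIV" for i j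
        using M[of i j] by simp
    qed
    have 2: "nuclear (\<Sum>k. g k F) (\<lambda>i j. if i \<in> F \<and> j \<notin> F then entry K i j else 0)"
    proof (rule nuclearI[where u = "\<lambda>k. restr F (u k)" and w = "\<lambda>k. w k - restr F (w k)"])
      fix G :: "nat set" assume G: "finite G"
      have "(\<Sum>k\<in>G. norm (restr F (u k)) * norm (w k - restr F (w k))) \<le> (\<Sum>k\<in>G. g k F)"
        unfolding g_def by (intro sum_mono mult_right_mono norm_restr_le) auto
      also have "\<dots> \<le> (\<Sum>k. g k F)"
        using G sg g0 by (intro sum_le_suminf) auto
      finally show "(\<Sum>k\<in>G. norm (restr F (u k)) * norm (w k - restr F (w k))) \<le> (\<Sum>k. g k F)" .
    next
      show "((\<lambda>k. ell2_coord (restr F (u k)) i * ell2_coord (w k - restr F (w k)) j)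
          has_sum (if i \<in> F \<and> j \<notin> F then entry K i j else 0)) UNIV" for i j
        using M[of i j] by (cases "i \<in> F"; cases "j \<in> F") simp_all
    qed
    have "entry (K - proj F * K * proj F)
        = (\<lambda>i j. (if i \<in> F then 0 else entry K i j) + (if i \<in> F \<and> j \<notin> F then entry K i j else 0))"
      by (intro ext) (simp add: entry_mult_proj entry_proj_mult)
    then show "nuc ((\<Sum>k. f k F) + (\<Sum>k. g k F)) (K - proj F * K * proj F)"
      unfolding nuc_def using nuclear_add[OF 1 2] by simp
  qed
qed

section \<open>The determinant of a nuclear perturbation of the identity\<close>

definition minor_series :: "real \<Rightarrow> real" where
  "minor_series c = (\<Sum>n. c ^ n / sqrt (fact n))"

text \<open>The quotient of consecutive terms has modulus
  \<open>\<bar>c\<bar> / sqrt (Suc n)\<close> and is at most 1/2 once \<open>n\<close> reaches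
  \<open>4 * c\<^sup>2\<close>. Hence the bound on all minors is finite however large
  \<open>c\<close> is.\<close>

lemma summable_minor_series: "summable (\<lambda>n. c ^ n / sqrt (fact n) :: real)"
proof (rule summable_ratio_test[of "1 / 2" "nat \<lceil>4 * c\<^sup>2\<rceil>"])
  fix n assume n: "nat \<lceil>4 * c\<^sup>2\<rceil> \<le> n"
  have "(2 * \<bar>c\<bar>)\<^sup>2 \<le> real (Suc n)"
    using n by (simp add: power_mult_distrib)
  then have "2 * \<bar>c\<bar> \<le> sqrt (Suc n)"
    by (rule real_le_rsqrt)
  then have r: "\<bar>c\<bar> / sqrt (Suc n) \<le> 1 / 2"
    by (simp add: field_simps)
  have "norm (c ^ Suc n / sqrt (fact (Suc n))) = \<bar>c\<bar> / sqrt (Suc n) * norm (c ^ n / sqrt (fact n))"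
    unfolding fact_Suc of_nat_mult real_sqrt_mult by (simp add: abs_mult)
  also have "\<dots> \<le> 1 / 2 * norm (c ^ n / sqrt (fact n))"
    by (rule mult_right_mono[OF r]) simp
  finally show "norm (c ^ Suc n / sqrt (fact (Suc n))) \<le> 1 / 2 * norm (c ^ n / sqrt (fact n))" .
qed simp

lemma minor_series_mono:
  assumes "0 \<le> c" "c \<le> d"
  shows "minor_series c \<le> minor_series d"
  unfolding minor_series_def
  by (intro suminf_le summable_minor_series divide_right_mono power_mono) (use assms in auto)

text \<open>The estimate for finitely many rank-one terms is uniform in their number, and a fixed
  finite family of minors depends continuously on the entries.\<close>

lemma nuclear_minors_card:
  assumes M: "nuclear c M" and \<S>: "finite \<S>" "\<And>S. S \<in> \<S> \<Longrightarrow> finite S \<and> card S = n"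
  shows "(\<Sum>S\<in>\<S>. cmod (minor S M)) \<le> c ^ n / sqrt (fact n)"
proof -
  obtain u w :: "nat \<Rightarrow> 'a ell2" where
    c: "\<And>F. finite F \<Longrightarrow> (\<Sum>k\<in>F. norm (u k) * norm (w k)) \<le> c" and
    M: "\<And>i j. ((\<lambda>k. ell2_coord (u k) i * ell2_coord (w k) j) has_sum M i j) UNIV"
    using nuclearE[OF M] by blast
  have A: "finite (\<Union>\<S>)" using \<S> by auto
  have lim: "(\<lambda>m. \<Sum>k<m. ell2_coord (u k) i * ell2_coord (w k) j) \<longlonglongrightarrow> M i j" for i j
    using has_sum_imp_sums[OF M[of i j]] by (simp add: sums_def)
  show ?thesis
  proof (rule LIMSEQ_le_const2)
    show "(\<lambda>m. \<Sum>S\<in>\<S>. cmod (minor S (\<lambda>i j. \<Sum>k<m. ell2_coord (u k) i * ell2_coord (w k) j)))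
        \<longlonglongrightarrow> (\<Sum>S\<in>\<S>. cmod (minor S M))"
      unfolding minor_def by (intro tendsto_sum tendsto_norm tendsto_mult tendsto_prod tendsto_const lim)
    have "(\<Sum>S\<in>\<S>. cmod (minor S (\<lambda>i j. \<Sum>k<m. ell2_coord (u k) i * ell2_coord (w k) j)))
        \<le> c ^ n / sqrt (fact n)" for m
    proof -
      have "(\<Sum>S\<in>\<S>. cmod (minor S (\<lambda>i j. \<Sum>k<m. ell2_coord (u k) i * ell2_coord (w k) j)))
        \<le> (\<Sum>k<m. sqrt (\<Sum>x\<in>\<Union>\<S>. (cmod (ell2_coord (u k) x))\<^sup>2)
              * sqrt (\<Sum>x\<in>\<Union>\<S>. (cmod (ell2_coord (w k) x))\<^sup>2)) ^ n / sqrt (fact n)"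
        by (rule sum_cmod_minor_le[OF A]) (use \<S> in auto)
      also have "\<dots> \<le> (\<Sum>k<m. norm (u k) * norm (w k)) ^ n / sqrt (fact n)"
        by (intro divide_right_mono power_mono sum_mono mult_mono real_le_lsqrt
            ell2_sum_le_norm_sq[OF A] sum_nonneg mult_nonneg_nonneg real_sqrt_ge_zero) auto
      also have "\<dots> \<le> c ^ n / sqrt (fact n)"
        by (intro divide_right_mono power_mono c) (auto intro: sum_nonneg)
      finally show ?thesis .
    qed
    then show "\<exists>N. \<forall>m\<ge>N. (\<Sum>S\<in>\<S>. cmod (minor S (\<lambda>i j. \<Sum>k<m. ell2_coord (u k) i * ell2_coord (w k) j)))
        \<le> c ^ n / sqrt (fact n)" by blast
  qed
qed

lemma nuclear_minors_by_card:
  assumes M: "nuclear c M" and \<S>: "finite \<S>" "\<And>S. S \<in> \<S> \<Longrightarrow> finite S"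
  shows "(\<Sum>S\<in>\<S>. cmod (minor S M)) \<le> (\<Sum>n\<in>card ` \<S>. c ^ n / sqrt (fact n))"
proof -
  have "(\<Sum>S\<in>\<S>. cmod (minor S M)) = (\<Sum>n\<in>card ` \<S>. \<Sum>S\<in>{S \<in> \<S>. card S = n}. cmod (minor S M))"
    by (rule sum.image_gen[OF \<S>(1)])
  also have "\<dots> \<le> (\<Sum>n\<in>card ` \<S>. c ^ n / sqrt (fact n))"
    by (intro sum_mono nuclear_minors_card[OF M]) (use \<S> in auto)
  finally show ?thesis .
qed

lemma nuclear_minors_bound:
  assumes M: "nuclear c M" and \<S>: "finite \<S>" "\<And>S. S \<in> \<S> \<Longrightarrow> finite S"
  shows "(\<Sum>S\<in>\<S>. cmod (minor S M)) \<le> minor_series c"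
proof -
  have "(\<Sum>n\<in>card ` \<S>. c ^ n / sqrt (fact n)) \<le> minor_series c"
    unfolding minor_series_def
    by (intro sum_le_suminf summable_minor_series) (use \<S> nuclear_nonneg[OF M] in auto)
  then show ?thesis using nuclear_minors_by_card[OF assms] by linarith
qed

definition fredholm :: "('i \<Rightarrow> 'i \<Rightarrow> complex) \<Rightarrow> complex" where
  "fredholm M = (\<Sum>\<^sub>\<infinity>S\<in>{S. finite S}. minor S M)"

lemma fredholm_det_op_of: "fredholm_det (op_of A) = fredholm (entry (A - 1))"
  unfolding fredholm_det_def fredholm_def minor_def op_entry_op_of[symmetric] minus_cop.rep_eq one_cop.rep_eq ..

lemma minors_abs_summable:
  fixes M :: "'a \<Rightarrow> 'a \<Rightarrow> complex"
  assumes "nuclear c M"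
  shows "(\<lambda>S. norm (minor S M)) summable_on {S. finite S}"
proof (rule nonneg_bdd_above_summable_on)
  show "bdd_above (sum (\<lambda>S. norm (minor S M)) ` {F. F \<subseteq> {S. finite S} \<and> finite F})"
  proof (rule bdd_aboveI2)
    fix \<S> :: "'a set set" assume "\<S> \<in> {F. F \<subseteq> {S. finite S} \<and> finite F}"
    then show "(\<Sum>S\<in>\<S>. norm (minor S M)) \<le> minor_series c"
      by (intro nuclear_minors_bound[OF assms]) auto
  qed
qed simp

lemma minors_has_sum:
  assumes "nuclear c M"
  shows "((\<lambda>S. minor S M) has_sum fredholm M) {S. finite S}"
  unfolding fredholm_def by (rule has_sum_infsum[OF abs_summable_summable[OF minors_abs_summable[OF assms]]])

text \<open>The empty set contributes 1 and the singletons contribute the trace. The minors of size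
  \<open>n \<ge> 2\<close> add up to at most \<open>c ^ n\<close>, and for
  \<open>c \<le> 1 / 2\<close> this tail is below a geometric series with sum
  \<open>2 * c\<^sup>2\<close>.\<close>

lemma fredholm_first_order:
  assumes M: "nuclear c M" and c: "c \<le> 1 / 2"
  shows "cmod (fredholm M - (1 + (\<Sum>\<^sub>\<infinity>i. M i i))) \<le> 2 * c\<^sup>2"
proof -
  have c0: "c \<ge> 0" by (rule nuclear_nonneg[OF M])
  let ?big = "{S :: 'a set. finite S \<and> card S \<ge> 2}"
  have "S \<in> {{}} \<union> (range (\<lambda>i. {i}) \<union> ?big)" if S: "finite S" for S :: "'a set"
  proof -
    consider "card S = 0" | "card S = 1" | "card S \<ge> 2" by linarith
    then show ?thesis
      using S by cases (auto simp: card_1_singleton_iff)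
  qed
  then have split: "{S :: 'a set. finite S} = {{}} \<union> (range (\<lambda>i. {i}) \<union> ?big)"
    by auto
  have s: "(\<lambda>S. minor S M) summable_on T" if "T \<subseteq> {S. finite S}" for T
    using summable_on_subset_banach[OF abs_summable_summable[OF minors_abs_summable[OF M]] that] .
  have "fredholm M = infsum (\<lambda>S. minor S M) {{}} + infsum (\<lambda>S. minor S M) (range (\<lambda>i. {i}) \<union> ?big)"
    unfolding fredholm_def split by (rule infsum_Un_disjoint) (auto intro!: s)
  also have "infsum (\<lambda>S. minor S M) (range (\<lambda>i. {i}) \<union> ?big)
      = infsum (\<lambda>S. minor S M) (range (\<lambda>i. {i})) + infsum (\<lambda>S. minor S M) ?big"
    by (rule infsum_Un_disjoint) (auto intro!: s)
  also have "infsum (\<lambda>S. minor S M) (range (\<lambda>i. {i})) = (\<Sum>\<^sub>\<infinity>i. M i i)"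
    by (subst infsum_reindex) (auto simp: o_def)
  finally have "fredholm M - (1 + (\<Sum>\<^sub>\<infinity>i. M i i)) = infsum (\<lambda>S. minor S M) ?big"
    by simp
  also have "cmod \<dots> \<le> infsum (\<lambda>S. norm (minor S M)) ?big"
    by (rule norm_infsum_bound) (rule summable_on_subset_banach[OF minors_abs_summable[OF M]], auto)
  also have "\<dots> \<le> 2 * c\<^sup>2"
  proof (rule infsum_le_finite_sums)
    show "(\<lambda>S. norm (minor S M)) summable_on ?big"
      by (rule summable_on_subset_banach[OF minors_abs_summable[OF M]]) auto
    fix \<S> assume \<S>: "finite \<S>" "\<S> \<subseteq> ?big"
    have "(\<Sum>S\<in>\<S>. cmod (minor S M)) \<le> (\<Sum>n\<in>card ` \<S>. c ^ n / sqrt (fact n))"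
      by (rule nuclear_minors_by_card[OF M]) (use \<S> in auto)
    also have "\<dots> \<le> (\<Sum>n\<in>card ` \<S>. c\<^sup>2 * (1 / 2) ^ (n - 2))"
    proof (rule sum_mono)
      fix n assume "n \<in> card ` \<S>"
      then have n: "n \<ge> 2" using \<S> by auto
      have "c ^ n / sqrt (fact n) \<le> c ^ n / 1"
        using c0 by (intro divide_left_mono) auto
      also have "c ^ n / 1 = c\<^sup>2 * c ^ (n - 2)"
        using power_add[of c 2 "n - 2"] unfolding le_add_diff_inverse[OF n] by simp
      also have "\<dots> \<le> c\<^sup>2 * (1 / 2) ^ (n - 2)"
        using c0 c by (intro mult_left_mono power_mono) auto
      finally show "c ^ n / sqrt (fact n) \<le> c\<^sup>2 * (1 / 2) ^ (n - 2)" .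
    qed
    also have "\<dots> = c\<^sup>2 * (\<Sum>n\<in>(\<lambda>n. n - 2) ` card ` \<S>. (1 / 2) ^ n)"
    proof -
      have ge: "n \<ge> 2" if "n \<in> card ` \<S>" for n using that \<S> by auto
      have inj: "inj_on (\<lambda>n. n - 2) (card ` \<S>)"
      proof (rule inj_onI)
        fix x y assume "x \<in> card ` \<S>" "y \<in> card ` \<S>" "x - 2 = y - 2"
        then show "x = y" using ge[of x] ge[of y] by linarith
      qed
      show ?thesis by (simp only: sum.reindex[OF inj] o_def sum_distrib_left)
    qed
    also have "\<dots> \<le> c\<^sup>2 * (\<Sum>n. (1 / 2) ^ n)"
      by (intro mult_left_mono sum_le_suminf summable_geometric) (use \<S> in auto)
    also have "\<dots> = 2 * c\<^sup>2" by (simp add: suminf_geometric)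
    finally show "(\<Sum>S\<in>\<S>. cmod (minor S M)) \<le> 2 * c\<^sup>2" .
  qed
  finally show ?thesis .
qed

text \<open>Power sets are cofinal: a finite family of finite sets lies in the power set of its
  union. The Fredholm series is therefore a limit of finite determinants.\<close>

lemma filterlim_Pow: "filterlim Pow (finite_subsets_at_top {S. finite S}) (finite_subsets_at_top UNIV)"
  unfolding filterlim_iff
proof (intro allI impI)
  fix P :: "'a set set \<Rightarrow> bool"
  assume "eventually P (finite_subsets_at_top {S. finite S})"
  then have "\<exists>\<X>. finite \<X> \<and> \<X> \<subseteq> {S. finite S} \<and> (\<forall>\<Y>. finite \<Y> \<and> \<X> \<subseteq> \<Y> \<and> \<Y> \<subseteq> {S. finite S} \<longrightarrow> P \<Y>)"
    by (simp only: eventually_finite_subsets_at_top)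
  then obtain \<X> where X: "finite \<X>" "\<X> \<subseteq> {S. finite S}"
    "\<forall>\<Y>. finite \<Y> \<and> \<X> \<subseteq> \<Y> \<and> \<Y> \<subseteq> {S. finite S} \<longrightarrow> P \<Y>"
    by (elim exE conjE)
  have "P (Pow F)" if F: "finite F" "\<Union>\<X> \<subseteq> F" for F
    using F by (intro X(3)[rule_format]) (auto intro: finite_subset)
  moreover have "finite (\<Union>\<X>)" using X by auto
  ultimately show "eventually (\<lambda>F. P (Pow F)) (finite_subsets_at_top UNIV)"
    by (auto simp: eventually_finite_subsets_at_top)
qed

lemma fredholm_limit:
  assumes "nuclear c M"
  shows "((\<lambda>F. \<Sum>S\<in>Pow F. minor S M) \<longlongrightarrow> fredholm M) (finite_subsets_at_top UNIV)"
  using filterlim_compose[OF minors_has_sum[OF assms, unfolded has_sum_def] filterlim_Pow] .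

text \<open>An index set that leaves \<open>F\<close> meets a zero row, so only subsets of
  \<open>F\<close> survive and \<open>minor_one_plus\<close> applies.\<close>

lemma fredholm_finite_rows:
  assumes "finite F" "\<And>i j. i \<notin> F \<Longrightarrow> M i j = 0"
  shows "fredholm M = minor F (\<lambda>i j. (if i = j then 1 else 0) + M i j)"
proof -
  have "fredholm M = infsum (\<lambda>S. minor S M) (Pow F)"
    unfolding fredholm_def
  proof (rule infsum_cong_neutral)
    fix S assume "S \<in> {S. finite S} - Pow F"
    then obtain i where "finite S" "i \<in> S" "i \<notin> F" by auto
    then show "minor S M = 0" by (intro minor_zero_row[of S i]) (auto simp: assms)
  qed (use assms(1) finite_subset in auto)
  then show ?thesis using assms(1) by (simp add: minor_one_plus)
qed

lemma fredholm_finite_cols: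
  assumes "finite F" "\<And>i j. j \<notin> F \<Longrightarrow> M i j = 0"
  shows "fredholm M = minor F (\<lambda>i j. (if i = j then 1 else 0) + M i j)"
proof -
  have "fredholm M = infsum (\<lambda>S. minor S M) (Pow F)"
    unfolding fredholm_def
  proof (rule infsum_cong_neutral)
    fix S assume "S \<in> {S. finite S} - Pow F"
    then obtain i where "finite S" "i \<in> S" "i \<notin> F" by auto
    then show "minor S M = 0" by (intro minor_zero_col[of S i]) (auto simp: assms)
  qed (use assms(1) finite_subset in auto)
  then show ?thesis using assms(1) by (simp add: minor_one_plus)
qed

text \<open>For finite \<open>F\<close> the sum of minors of \<open>A + z * E\<close> is a
  polynomial \<open>f\<close> in the complex parameter \<open>z\<close>. It is bounded on the disc
  of radius \<open>1 + 1 / e\<close>, where \<open>a + cmod z * e \<le> a + e + 1\<close>. Cauchy's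
  estimate on circles of radius \<open>1 / e\<close> then bounds its derivative on the unit disc and
  produces the factor \<open>e\<close>.\<close>

lemma fredholm_lipschitz:
  assumes A: "nuclear a A" and E: "nuclear e E"
  shows "cmod (fredholm (\<lambda>i j. A i j + E i j) - fredholm A) \<le> e * minor_series (a + e + 1)"
proof (cases "e = 0")
  case True
  then have "E i j = 0" for i j
  proof -
    obtain u w :: "nat \<Rightarrow> 'a ell2" where
      c: "\<And>F. finite F \<Longrightarrow> (\<Sum>k\<in>F. norm (u k) * norm (w k)) \<le> 0" and
      M: "\<And>i j. ((\<lambda>k. ell2_coord (u k) i * ell2_coord (w k) j) has_sum E i j) UNIV"
      using nuclearE[OF E] True by blast
    have "norm (u k) * norm (w k) \<le> 0" for k
      using c[of "{k}"] by simp
    then have "norm (u k) * norm (w k) = 0" for k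
      by (meson antisym mult_nonneg_nonneg norm_ge_zero)
    then have "ell2_coord (u k) i * ell2_coord (w k) j = 0" for k
      by (metis mult_eq_0_iff norm_eq_zero zero_ell2.rep_eq)
    then show ?thesis
      using has_sum_unique[OF M[of i j] has_sum_0] by simp
  qed
  then show ?thesis using True by simp
next
  case False
  then have e: "e > 0" using nuclear_nonneg[OF E] by simp
  have a: "a \<ge> 0" by (rule nuclear_nonneg[OF A])
  define B where "B = e * minor_series (a + e + 1)"
  have fin: "cmod ((\<Sum>S\<in>Pow F. minor S (\<lambda>i j. A i j + E i j)) - (\<Sum>S\<in>Pow F. minor S A)) \<le> B"
    if F: "finite F" for F
  proof -
    define f where "f = (\<lambda>z. \<Sum>S\<in>Pow F. minor S (\<lambda>i j. A i j + z * E i j))"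
    have hol: "f holomorphic_on T" for T
      unfolding f_def minor_def by (intro holomorphic_intros)
    have bound: "cmod (f z) \<le> minor_series (a + e + 1)" if z: "cmod z \<le> 1 + 1 / e" for z
    proof -
      have N: "nuclear (a + cmod z * e) (\<lambda>i j. A i j + z * E i j)"
        by (rule nuclear_add[OF A nuclear_cmult[OF E]])
      have "cmod (f z) \<le> (\<Sum>S\<in>Pow F. cmod (minor S (\<lambda>i j. A i j + z * E i j)))"
        unfolding f_def by (rule norm_sum)
      also have "\<dots> \<le> minor_series (a + cmod z * e)"
        by (rule nuclear_minors_bound[OF N]) (use F finite_subset in auto)
      also have "\<dots> \<le> minor_series (a + e + 1)"
      proof (rule minor_series_mono)
        have "cmod z * e \<le> (1 + 1 / e) * e" using z e by (intro mult_right_mono) auto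
        also have "\<dots> = e + 1" using e by (simp add: field_simps)
        finally show "a + cmod z * e \<le> a + e + 1" by simp
      qed (use a e in auto)
      finally show ?thesis .
    qed
    have der: "cmod (deriv f x) \<le> B" if x: "cmod x \<le> 1" for x
    proof -
      have "cmod ((deriv ^^ 1) f x) \<le> fact 1 * minor_series (a + e + 1) / (1 / e) ^ 1"
      proof (rule Cauchy_inequality)
        fix y assume "norm (x - y) = 1 / e"
        then have "cmod y \<le> 1 + 1 / e"
          using x norm_triangle_ineq4[of x "x - y"] by simp
        then show "cmod (f y) \<le> minor_series (a + e + 1)" by (rule bound)
      qed (use e hol holomorphic_on_imp_continuous_on in auto)
      then show ?thesis by (simp add: B_def mult.commute)
    qed
    have "norm (f 1 - f 0) \<le> B * norm (1 - 0 :: complex)"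
    proof (rule field_differentiable_bound[where S = "cball 0 1"])
      fix z :: complex assume "z \<in> cball 0 1"
      show "(f has_field_derivative deriv f z) (at z within cball 0 1)"
        using holomorphic_derivI[OF hol[of UNIV], of z] by (simp add: has_field_derivative_at_within)
    qed (use der in auto)
    then show ?thesis by (simp add: f_def)
  qed
  show ?thesis unfolding B_def[symmetric]
  proof (rule tendsto_upperbound)
    show "((\<lambda>F. cmod ((\<Sum>S\<in>Pow F. minor S (\<lambda>i j. A i j + E i j)) - (\<Sum>S\<in>Pow F. minor S A)))
        \<longlongrightarrow> cmod (fredholm (\<lambda>i j. A i j + E i j) - fredholm A)) (finite_subsets_at_top UNIV)"
      by (intro tendsto_intros fredholm_limit[OF A] fredholm_limit[OF nuclear_add[OF A E]])
    show "eventually (\<lambda>F. cmod ((\<Sum>S\<in>Pow F. minor S (\<lambda>i j. A i j + E i j)) - (\<Sum>S\<in>Pow F. minor S A)) \<le> B)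
        (finite_subsets_at_top UNIV)"
      by (rule eventually_finite_subsets_at_top_weakI) (rule fin)
  qed simp
qed

text \<open>This is the determinant of \<open>1 + K\<close>, with the trace class part as
  argument.\<close>

definition fdet :: "'i cop \<Rightarrow> complex" where
  "fdet K = fredholm (entry K)"

lemma fdet_lipschitz:
  assumes "nuc a A" "nuc e E"
  shows "cmod (fdet (A + E) - fdet A) \<le> e * minor_series (a + e + 1)"
proof -
  have "entry (A + E) = (\<lambda>i j. entry A i j + entry E i j)" by (intro ext) simp
  then show ?thesis
    using fredholm_lipschitz[OF assms[unfolded nuc_def]] by (simp add: fdet_def)
qed

lemma fdet_tendsto:
  assumes A: "nuc a A" and e: "(e \<longlongrightarrow> 0) \<F>" "eventually (\<lambda>x. nuc (e x) (A - B x)) \<F>"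
  shows "((\<lambda>x. fdet (B x)) \<longlongrightarrow> fdet A) \<F>"
proof -
  have "((\<lambda>x. fdet (B x) - fdet A) \<longlongrightarrow> 0) \<F>"
  proof (rule Lim_null_comparison)
    \<comment> \<open>Eventually \<open>e x < 1\<close>, whence
      \<open>a + e x + 1 \<le> a + 2\<close>, and the Lipschitz constant becomes independent of
      \<open>x\<close>.\<close>
    show "((\<lambda>x. e x * minor_series (a + 2)) \<longlongrightarrow> 0) \<F>"
      using tendsto_mult_left_zero[OF e(1)] .
    have "eventually (\<lambda>x. e x < 1) \<F>" using e(1) by (rule order_tendstoD) simp
    with e(2) show "eventually (\<lambda>x. norm (fdet (B x) - fdet A) \<le> e x * minor_series (a + 2)) \<F>"
    proof eventually_elim
      case (elim x)
      have e0: "e x \<ge> 0" and a0: "a \<ge> 0" using nuc_nonneg A elim by auto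
      have "cmod (fdet (A + - (A - B x)) - fdet A) \<le> e x * minor_series (a + e x + 1)"
        by (rule fdet_lipschitz[OF A nuc_uminus[OF elim(1)]])
      also have "\<dots> \<le> e x * minor_series (a + 2)"
        using e0 a0 elim by (intro mult_left_mono minor_series_mono) auto
      finally show ?case by simp
    qed
  qed
  then show ?thesis by (simp add: LIM_zero_iff)
qed

text \<open>The operator on the left is \<open>(1 + K) * (1 + L) - 1\<close>. For truncations to a
  finite set the claim is the product rule for finite determinants, and convergence in nuclear norm
  carries it to the limit.\<close>

theorem fdet_mult:
  assumes K: "nuc a K" and L: "nuc b L"
  shows "fdet (K + L + K * L) = fdet K * fdet L"
proof -
  obtain e where e: "(e \<longlongrightarrow> 0) (finite_subsets_at_top UNIV)"
    "\<And>F. nuc (e F) (K - proj F * K * proj F)" using nuc_truncate[OF K] by metis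
  obtain d where d: "(d \<longlongrightarrow> 0) (finite_subsets_at_top UNIV)"
    "\<And>F. nuc (d F) (L - proj F * L * proj F)" using nuc_truncate[OF L] by metis
  define KF where "KF = (\<lambda>F. proj F * K * proj F)"
  define LF where "LF = (\<lambda>F. proj F * L * proj F)"
  have n: "norm (KF F) \<le> norm K" for F
  proof -
    have "norm (KF F) \<le> norm (proj F * K) * norm (proj F)"
      unfolding KF_def by (rule norm_mult_ineq)
    also have "\<dots> \<le> (norm (proj F) * norm K) * norm (proj F)"
      by (intro mult_right_mono norm_mult_ineq) auto
    also have "\<dots> \<le> (1 * norm K) * 1"
      by (intro mult_mono norm_proj_le) auto
    finally show ?thesis by simp
  qed
  have eK: "nuc (e F) (K - KF F)" and dL: "nuc (d F) (L - LF F)" for F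
    using e(2) d(2) by (simp_all add: KF_def LF_def)
  have KL: "nuc (a + b + norm K * b) (K + L + K * L)"
    by (intro nuc_add K L nuc_mult_left)
  have t1: "((\<lambda>F. fdet (KF F + LF F + KF F * LF F)) \<longlongrightarrow> fdet (K + L + K * L)) (finite_subsets_at_top UNIV)"
  proof (rule fdet_tendsto[OF KL])
    show "((\<lambda>F. e F + d F + (norm L * e F + norm K * d F)) \<longlongrightarrow> 0) (finite_subsets_at_top UNIV)"
      using tendsto_add[OF tendsto_add[OF e(1) d(1)] tendsto_add[OF
        tendsto_mult_right_zero[OF e(1), of "norm L"] tendsto_mult_right_zero[OF d(1), of "norm K"]]] by simp
    \<comment> \<open>The difference is telescoped so that each summand contains one truncation
      error, while the other factor stays bounded uniformly in \<open>F\<close>.\<close>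
    have "nuc (e F + d F + (norm L * e F + norm K * d F)) ((K - KF F) + (L - LF F) + ((K - KF F) * L + KF F * (L - LF F)))" for F
      by (intro nuc_add nuc_mult_right nuc_mult_left_le n eK dL)
    moreover have "(K - KF F) + (L - LF F) + ((K - KF F) * L + KF F * (L - LF F))
        = K + L + K * L - (KF F + LF F + KF F * LF F)" for F
      by (simp add: algebra_simps)
    ultimately show "eventually (\<lambda>F. nuc (e F + d F + (norm L * e F + norm K * d F))
        (K + L + K * L - (KF F + LF F + KF F * LF F))) (finite_subsets_at_top UNIV)"
      by simp
  qed
  have t2: "((\<lambda>F. fdet (KF F) * fdet (LF F)) \<longlongrightarrow> fdet K * fdet L) (finite_subsets_at_top UNIV)"
    using e d by (intro tendsto_mult fdet_tendsto[OF K e(1)] fdet_tendsto[OF L d(1)]) (simp_all add: KF_def LF_def)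
  have ev: "eventually (\<lambda>F. fdet (KF F) * fdet (LF F) = fdet (KF F + LF F + KF F * LF F)) (finite_subsets_at_top UNIV)"
  proof (rule eventually_finite_subsets_at_top_weakI)
    fix F :: "'a set" assume F: "finite F"
    have k: "entry (KF F) i j = (if i \<in> F \<and> j \<in> F then entry K i j else 0)" for i j
      by (simp add: KF_def entry_mult_proj entry_proj_mult)
    have l: "entry (LF F) i j = (if i \<in> F \<and> j \<in> F then entry L i j else 0)" for i j
      by (simp add: LF_def entry_mult_proj entry_proj_mult)
    have kl: "entry (KF F * LF F) i j = (\<Sum>k\<in>F. entry (KF F) i k * entry (LF F) k j)" for i j
      by (rule entry_mult_finite[OF F]) (simp add: k)
    let ?I = "\<lambda>i j. if i = j then 1 else (0 :: complex)"
    have "fdet (KF F) * fdet (LF F) = minor F (\<lambda>i j. ?I i j + entry (KF F) i j) * minor F (\<lambda>i j. ?I i j + entry (LF F) i j)"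
      unfolding fdet_def by (intro arg_cong2[where f = "(*)"] fredholm_finite_rows F) (auto simp: k l)
    also have "\<dots> = minor F (\<lambda>i j. \<Sum>k\<in>F. (?I i k + entry (KF F) i k) * (?I k j + entry (LF F) k j))"
      by (rule minor_mult[OF F, symmetric])
    also have "\<dots> = minor F (\<lambda>i j. ?I i j + entry (KF F + LF F + KF F * LF F) i j)"
    proof (rule minor_cong)
      fix i j assume ij: "i \<in> F" "j \<in> F"
      have "(\<Sum>k\<in>F. (?I i k + entry (KF F) i k) * (?I k j + entry (LF F) k j))
          = (\<Sum>k\<in>F. ?I i k * ?I k j) + (\<Sum>k\<in>F. ?I i k * entry (LF F) k j)
            + (\<Sum>k\<in>F. entry (KF F) i k * ?I k j) + (\<Sum>k\<in>F. entry (KF F) i k * entry (LF F) k j)"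
        by (simp add: sum.distrib algebra_simps del: mult_if_delta)
      also have "(\<Sum>k\<in>F. ?I i k * ?I k j) = ?I i j"
        using F ij by (simp add: if_distrib[where f = "\<lambda>x. x * _"] cong: if_cong)
      also have "(\<Sum>k\<in>F. ?I i k * entry (LF F) k j) = entry (LF F) i j"
        using F ij by (simp add: if_distrib[where f = "\<lambda>x. x * _"] cong: if_cong)
      also have "(\<Sum>k\<in>F. entry (KF F) i k * ?I k j) = entry (KF F) i j"
        using F ij by (simp add: if_distrib[where f = "\<lambda>x. _ * x"] cong: if_cong)
      finally show "(\<Sum>k\<in>F. (?I i k + entry (KF F) i k) * (?I k j + entry (LF F) k j))
          = ?I i j + entry (KF F + LF F + KF F * LF F) i j"
        by (simp add: kl)
    qed
    also have "\<dots> = fdet (KF F + LF F + KF F * LF F)"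
      unfolding fdet_def by (rule fredholm_finite_rows[OF F, symmetric]) (simp add: kl, simp add: k l)
    finally show "fdet (KF F) * fdet (LF F) = fdet (KF F + LF F + KF F * LF F)" .
  qed
  show ?thesis
    by (rule tendsto_unique[OF finite_subsets_at_top_neq_bot t1 Lim_transform_eventually[OF t2 ev]])
qed

text \<open>\<open>A\<close> is merely bounded, so only \<open>K\<close> is truncated. Then
  \<open>A * KF F\<close> has finitely many nonzero columns and \<open>KF F * A\<close> finitely
  many nonzero rows, and Sylvester's identity compares the two finite determinants.\<close>

theorem fdet_commute:
  assumes K: "nuc a K"
  shows "fdet (A * K) = fdet (K * A)"
proof -
  obtain e where e: "(e \<longlongrightarrow> 0) (finite_subsets_at_top UNIV)"
    "\<And>F. nuc (e F) (K - proj F * K * proj F)" using nuc_truncate[OF K] by metis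
  define KF where "KF = (\<lambda>F. proj F * K * proj F)"
  have e': "((\<lambda>F. norm A * e F) \<longlongrightarrow> 0) (finite_subsets_at_top UNIV)"
    using tendsto_mult_right_zero[OF e(1)] .
  have t2: "((\<lambda>F. fdet (A * KF F)) \<longlongrightarrow> fdet (A * K)) (finite_subsets_at_top UNIV)"
    using nuc_mult_left[OF e(2), of A] 
    by (intro fdet_tendsto[OF nuc_mult_left[OF K] e']) (simp add: KF_def right_diff_distrib)
  have t1: "((\<lambda>F. fdet (KF F * A)) \<longlongrightarrow> fdet (K * A)) (finite_subsets_at_top UNIV)"
    using nuc_mult_right[OF e(2), of A] 
    by (intro fdet_tendsto[OF nuc_mult_right[OF K] e']) (simp add: KF_def left_diff_distrib)
  have ev: "eventually (\<lambda>F. fdet (A * KF F) = fdet (KF F * A)) (finite_subsets_at_top UNIV)"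
  proof (rule eventually_finite_subsets_at_top_weakI)
    fix F :: "'a set" assume F: "finite F"
    have k: "entry (KF F) i j = (if i \<in> F \<and> j \<in> F then entry K i j else 0)" for i j
      by (simp add: KF_def entry_mult_proj entry_proj_mult)
    have ak: "entry (A * KF F) i j = (\<Sum>k\<in>F. entry A i k * entry (KF F) k j)" for i j
      by (rule entry_mult_finite[OF F]) (simp add: k)
    have ka: "entry (KF F * A) i j = (\<Sum>k\<in>F. entry (KF F) i k * entry A k j)" for i j
      by (rule entry_mult_finite[OF F]) (simp add: k)
    have "fdet (A * KF F) = minor F (\<lambda>i j. (if i = j then 1 else 0) + entry (A * KF F) i j)"
      unfolding fdet_def by (rule fredholm_finite_cols[OF F]) (simp add: ak k)
    also have "\<dots> = minor F (\<lambda>i j. (if i = j then 1 else 0) + entry (KF F * A) i j)"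
      unfolding ak ka by (rule minor_one_plus_mult_commute[OF F])
    also have "\<dots> = fdet (KF F * A)"
      unfolding fdet_def by (rule fredholm_finite_rows[OF F, symmetric]) (simp add: ka k)
    finally show "fdet (A * KF F) = fdet (KF F * A)" .
  qed
  show ?thesis
    by (rule tendsto_unique[OF finite_subsets_at_top_neq_bot Lim_transform_eventually[OF t2 ev] t1])
qed

section \<open>Exponentials with a nuclear commutator\<close>

definition trace_class :: "'i cop \<Rightarrow> bool" where
  "trace_class A \<longleftrightarrow> (\<exists>c. nuc c A)"

lemma trace_class_add: "trace_class A \<Longrightarrow> trace_class B \<Longrightarrow> trace_class (A + B)"
  unfolding trace_class_def using nuc_add by blast

lemma trace_class_mult_left: "trace_class K \<Longrightarrow> trace_class (A * K)"
  unfolding trace_class_def using nuc_mult_left by blast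

lemma trace_class_mult_right: "trace_class K \<Longrightarrow> trace_class (K * A)"
  unfolding trace_class_def using nuc_mult_right by blast

definition gdet :: "'i cop \<Rightarrow> complex" where
  "gdet G = fdet (G - 1)"

lemma fredholm_det_eq_gdet: "fredholm_det (op_of G) = gdet G"
  by (simp add: fredholm_det_op_of gdet_def fdet_def)

definition near_one :: "'i cop \<Rightarrow> bool" where
  "near_one G \<longleftrightarrow> trace_class (G - 1)"

lemma near_one_1: "near_one 1"
  using nuc_0 by (auto simp: near_one_def trace_class_def)

lemma gdet_1: "gdet 1 = 1"
proof -
  have "entry (0 :: 'a cop) = (\<lambda>i j. 0)" by (intro ext) simp
  then show ?thesis
    using fredholm_finite_rows[of "{}" "\<lambda>i j. 0"] by (simp add: gdet_def fdet_def)
qed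

lemma near_one_mult:
  assumes "near_one G" "near_one H"
  shows "near_one (G * H)"
proof -
  have eq: "G * H - 1 = (G - 1) * H + (H - 1)" by (simp add: algebra_simps)
  show ?thesis
    using assms unfolding near_one_def eq by (intro trace_class_add trace_class_mult_right)
qed

lemma gdet_mult:
  assumes "near_one G" "near_one H"
  shows "gdet (G * H) = gdet G * gdet H"
proof -
  have "G * H - 1 = (G - 1) + (H - 1) + (G - 1) * (H - 1)" by (simp add: algebra_simps)
  then show ?thesis
    using assms unfolding near_one_def trace_class_def gdet_def by (metis fdet_mult)
qed

lemma near_one_conj:
  assumes "near_one G" "V * W = 1"
  shows "near_one (V * G * W)"
proof -
  have "V * G * W - 1 = V * (G - 1) * W" using assms(2) by (simp add: algebra_simps)
  then show ?thesis
    using assms(1) unfolding near_one_def by (simp add: trace_class_mult_left trace_class_mult_right)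
qed

text \<open>\<open>V\<close> and \<open>W\<close> may be far from the identity; cyclicity of the
  determinant moves \<open>V\<close> past the nuclear factor \<open>(G - 1) * W\<close>.\<close>

lemma gdet_conj:
  assumes "near_one G" "V * W = 1" "W * V = 1"
  shows "gdet (V * G * W) = gdet G"
proof -
  obtain c where c: "nuc c ((G - 1) * W)"
    using trace_class_mult_right[of "G - 1" W] assms(1) unfolding near_one_def trace_class_def by blast
  have "V * G * W - 1 = V * ((G - 1) * W)" using assms(2) by (simp add: algebra_simps)
  then have "gdet (V * G * W) = fdet ((G - 1) * W * V)"
    using fdet_commute[OF c, of V] by (simp add: gdet_def)
  also have "(G - 1) * W * V = G - 1" using assms(3) by (simp add: mult.assoc)
  finally show ?thesis by (simp add: gdet_def)
qed

text \<open>Abstracts \<open>e^{A/n}\<close>, \<open>e^{B/n}\<close>, \<open>e^{-(A+B)/n}\<close>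
  and the inverses of the first two. The single factors have no determinants in general; only their
  group commutator and their product do.\<close>

locale near_commuting =
  fixes X Y Z X' Y' :: "'i cop"
  assumes X: "X * X' = 1" "X' * X = 1" and Y: "Y * Y' = 1" "Y' * Y = 1"
    and comm: "near_one (X * Y * X' * Y')" and prod: "near_one (X * Y * Z)"
begin

lemma Xn: "X ^ n * X' ^ n = 1" "X' ^ n * X ^ n = 1"
  by (induction n) (simp_all add: X power_commutes mult.assoc,
    metis X mult.assoc mult.right_neutral power_commutes, metis X mult.assoc mult.right_neutral power_commutes)

text \<open>Group commutators multiply up to conjugation: that of \<open>X ^ Suc n\<close> and
  \<open>Y\<close> is the conjugate by \<open>X\<close> of that of \<open>X ^ n\<close> and
  \<open>Y\<close>, times that of \<open>X\<close> and \<open>Y\<close>.\<close>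

lemma gdet_commutator_power:
  "near_one (X ^ n * Y * X' ^ n * Y') \<and> gdet (X ^ n * Y * X' ^ n * Y') = gdet (X * Y * X' * Y') ^ n"
proof (induction n)
  case 0
  then show ?case by (simp add: Y near_one_1 gdet_1)
next
  case (Suc n)
  let ?C = "X ^ n * Y * X' ^ n * Y'"
  have "Y' * (Y * W) = W" "X' * (X * W) = W" "X * (X' * W) = W" "Y * (Y' * W) = W" for W
    by (metis X Y mult.assoc mult_1)+
  then have "X ^ Suc n * Y * X' ^ Suc n * Y' = (X * ?C * X') * (X * Y * X' * Y')"
    by (simp add: mult.assoc power_commutes[symmetric]) (metis mult.assoc power_commutes)
  then show ?case
    using Suc comm X near_one_conj[of ?C X X'] gdet_conj[of ?C X X']
    by (simp add: near_one_mult gdet_mult)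
qed

text \<open>Going from \<open>n\<close> to \<open>Suc n\<close> moves one \<open>Y\<close> across
  \<open>X ^ n\<close>. This costs the commutator of \<open>X ^ n\<close> and \<open>Y\<close>,
  worth \<open>n\<close> elementary commutators; everything else is a conjugation or one more factor
  \<open>X * Y * Z\<close>. Adding up the costs gives the exponent.\<close>

lemma gdet_power:
  "near_one (X ^ n * Y ^ n * Z ^ n) \<and>
   gdet (X ^ n * Y ^ n * Z ^ n) = gdet (X * Y * Z) ^ n * gdet (X * Y * X' * Y') ^ (\<Sum>j<n. j)"
proof (induction n)
  case 0
  then show ?case by (simp add: near_one_1 gdet_1)
next
  case (Suc n)
  let ?C = "X ^ n * Y * X' ^ n * Y'" and ?G = "X ^ n * Y ^ n * Z ^ n"
  have c: "Y' * (Y * W) = W" "X' * (X * W) = W" "X * (X' * W) = W" "Y * (Y' * W) = W"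
    "X' ^ n * (X ^ n * W) = W" for W
    by (metis X Y Xn mult.assoc mult_1)+
  have "(X * ?C * X') * ((X * Y) * ?G * (Y' * X')) * (X * Y * Z) = X * X ^ n * Y * Y ^ n * Z ^ n * Z"
    by (simp add: mult.assoc c)
  also have "\<dots> = X ^ Suc n * Y ^ Suc n * Z ^ Suc n"
    by (simp add: mult.assoc power_commutes)
  finally have eq: "X ^ Suc n * Y ^ Suc n * Z ^ Suc n = (X * ?C * X') * ((X * Y) * ?G * (Y' * X')) * (X * Y * Z)" ..
  have XY: "(X * Y) * (Y' * X') = 1" "(Y' * X') * (X * Y) = 1"
    by (simp_all add: mult.assoc c X Y)
  have 1: "near_one (X * ?C * X')" "gdet (X * ?C * X') = gdet (X * Y * X' * Y') ^ n"
    using gdet_commutator_power[of n] X near_one_conj[of ?C X X'] gdet_conj[of ?C X X'] by simp_all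
  have 2: "near_one ((X * Y) * ?G * (Y' * X'))"
    "gdet ((X * Y) * ?G * (Y' * X')) = gdet (X * Y * Z) ^ n * gdet (X * Y * X' * Y') ^ (\<Sum>j<n. j)"
    using Suc near_one_conj[OF _ XY(1), of ?G] gdet_conj[OF _ XY, of ?G] by simp_all
  note 3 = near_one_mult[OF 1(1) 2(1)]
  show ?case unfolding eq gdet_mult[OF 3 prod] gdet_mult[OF 1(1) 2(1)] 1(2) 2(2)
    using near_one_mult[OF 3 prod] by (simp add: power_add)
qed

end

text \<open>Telescoping produces \<open>n\<close> terms of size \<open>norm A ^ (n - 1)\<close>; the
  power of \<open>norm A + 1\<close> is a coarser bound with a simple recursion.\<close>

lemma nuc_commutator_power:
  assumes "nuc \<kappa> (A * B - B * A)"
  shows "nuc (\<kappa> * (norm A + 1) ^ n) (A ^ n * B - B * A ^ n)"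
proof (induction n)
  case 0
  then show ?case using nuc_mono[OF nuc_0 nuc_nonneg[OF assms]] by simp
next
  case (Suc n)
  have k: "\<kappa> \<ge> 0" by (rule nuc_nonneg[OF assms])
  have "norm (A ^ n) \<le> (norm A + 1) ^ n"
    by (rule order_trans[OF norm_power_ineq power_mono]) auto
  from nuc_add[OF nuc_mult_left[OF Suc.IH, of A] nuc_mult_right_le[OF assms this]]
  have "nuc (norm A * (\<kappa> * (norm A + 1) ^ n) + (norm A + 1) ^ n * \<kappa>)
      (A * (A ^ n * B - B * A ^ n) + (A * B - B * A) * A ^ n)" .
  moreover have "norm A * (\<kappa> * (norm A + 1) ^ n) + (norm A + 1) ^ n * \<kappa> = \<kappa> * (norm A + 1) ^ Suc n"
    by (simp add: algebra_simps)
  ultimately show ?case by (simp add: algebra_simps)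
qed

lemma exp_sums: "(\<lambda>n. x ^ n /\<^sub>R fact n) sums exp (x :: 'i cop)"
  by (rule exp_converges)

lemma exp_real_sums: "(\<lambda>n. x ^ n / fact n) sums exp (x :: real)"
  using exp_converges[of x] by (simp add: divide_inverse mult.commute)

text \<open>Replacing \<open>exp A\<close> by \<open>A\<close> in the commutator with
  \<open>B\<close> costs an error with an additional factor \<open>norm A\<close>. After both
  operators are scaled by 1/n, the error is one order smaller than the commutator.\<close>

lemma nuc_exp_commutator:
  assumes k: "nuc \<kappa> (A * B - B * A)" and a: "norm A \<le> 1"
  shows "nuc (\<kappa> * norm A * exp 2) ((exp A * B - B * exp A) - (A * B - B * A))"
proof -
  have k0: "\<kappa> \<ge> 0" by (rule nuc_nonneg[OF k])
  \<comment> \<open>The exact factor \<open>n * norm A ^ (n - 1)\<close> is kept, since for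
    \<open>n \<ge> 2\<close> it leaves one power of \<open>norm A\<close> over. Bounding
    \<open>n\<close> by \<open>2 ^ n\<close> then leads to \<open>exp 2\<close>.\<close>
  have pow: "nuc (\<kappa> * (n * norm A ^ (n - 1))) (A ^ n * B - B * A ^ n)" for n
  proof (induction n)
    case 0
    then show ?case using nuc_0 by simp
  next
    case (Suc n)
    have eq: "norm A * (\<kappa> * (n * norm A ^ (n - 1))) + norm A ^ n * \<kappa> = \<kappa> * (Suc n * norm A ^ (Suc n - 1))"
      by (cases n) (simp_all add: algebra_simps)
    have "nuc (norm A * (\<kappa> * (n * norm A ^ (n - 1))) + norm A ^ n * \<kappa>)
        (A * (A ^ n * B - B * A ^ n) + (A * B - B * A) * A ^ n)"
      by (intro nuc_add nuc_mult_left[OF Suc.IH] nuc_mult_right_le[OF k] norm_power_ineq)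
    then show ?case unfolding eq by (simp add: algebra_simps)
  qed
  let ?t = "\<lambda>n. (A ^ n * B - B * A ^ n) /\<^sub>R fact n - (if n = 1 then A * B - B * A else 0)"
  have t: "nuc (\<kappa> * norm A * (2 ^ n / fact n)) (?t n)" for n
  proof (cases "n \<ge> 2")
    case True
    have "nuc (\<bar>inverse (fact n)\<bar> * (\<kappa> * (n * norm A ^ (n - 1)))) ((A ^ n * B - B * A ^ n) /\<^sub>R fact n)"
      by (rule nuc_scaleR[OF pow])
    moreover have "\<bar>inverse (fact n)\<bar> * (\<kappa> * (n * norm A ^ (n - 1))) \<le> \<kappa> * norm A * (2 ^ n / fact n)"
    proof -
      obtain k where "n = 2 + k" using True le_Suc_ex by blast
      then have "norm A ^ (n - 1) = norm A * norm A ^ (n - 2)" by simp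
      also have "\<dots> \<le> norm A * 1"
        using a by (intro mult_left_mono power_le_one) auto
      finally have "n * norm A ^ (n - 1) \<le> 2 ^ n * norm A"
        using of_nat_less_two_power[of n, where 'a = real] by (intro mult_mono) auto
      then have "\<kappa> * (n * norm A ^ (n - 1)) / fact n \<le> \<kappa> * (2 ^ n * norm A) / fact n"
        using k0 by (intro divide_right_mono mult_left_mono) auto
      then show ?thesis by (simp add: divide_inverse mult_ac)
    qed
    ultimately show ?thesis using True nuc_mono by simp
  next
    case False
    then have "n = 0 \<or> n = 1" by linarith
    then have z: "?t n = 0" by auto
    show ?thesis unfolding z by (rule nuc_mono[OF nuc_0]) (use k0 in simp)
  qed
  have sB: "(\<lambda>n. (A ^ n * B - B * A ^ n) /\<^sub>R fact n) sums (exp A * B - B * exp A)"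
    using sums_diff[OF sums_mult2[OF exp_sums, of A B] sums_mult[OF exp_sums, of B A]]
    by (simp add: scaleR_diff_right)
  have s1: "(\<lambda>n. if n = 1 then A * B - B * A else 0) sums (A * B - B * A)"
    using sums_single[of 1 "\<lambda>_. A * B - B * A"] by simp
  have c: "(\<lambda>n. \<kappa> * norm A * (2 ^ n / fact n)) sums (\<kappa> * norm A * exp 2)"
    by (intro sums_mult exp_real_sums)
  show ?thesis
    using nuc_sums[OF t _ sums_diff[OF sB s1]] c by (simp add: sums_iff)
qed

text \<open>\<open>E n\<close> and \<open>S (A + B) n\<close> are the parts of degree
  \<open>n\<close> of \<open>exp A * exp B\<close> and \<open>exp (A + B)\<close>. Their difference
  obeys a recursion whose inhomogeneous term is the commutator of \<open>E n\<close> with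
  \<open>B\<close>, which is nuclear; the resulting bounds are the terms of an exponential
  series.\<close>

lemma nuc_exp_product:
  assumes k: "nuc \<kappa> (A * B - B * A)"
  shows "nuc (\<kappa> * exp (norm A + norm B + 2)) (exp A * exp B - exp (A + B))"
proof -
  define S where "S = (\<lambda>(x :: 'a cop) n. x ^ n /\<^sub>R fact n)"
  define E where "E = (\<lambda>n. \<Sum>i\<le>n. S A i * S B (n - i))"
  define s where "s = norm A + norm B + 1"
  have k0: "\<kappa> \<ge> 0" by (rule nuc_nonneg[OF k])
  have s: "norm (A + B) \<le> s" "s \<ge> 0"
    using norm_triangle_ineq[of A B] by (auto simp: s_def add_nonneg_nonneg)
  have SSuc: "real (Suc n) *\<^sub>R S x (Suc n) = x * S x n" "real (Suc n) *\<^sub>R S x (Suc n) = S x n * x" for x n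
    by (simp_all add: S_def field_simps power_commutes del: of_nat_Suc)
  \<comment> \<open>The power series form of a differential equation: the derivative of
    \<open>e^{tA} e^{tB}\<close> in \<open>t\<close> is \<open>A\<close> times this product plus
    this product times \<open>B\<close>.\<close>
  have ESuc: "real (Suc n) *\<^sub>R E (Suc n) = A * E n + E n * B" for n
  proof -
    have "real (Suc n) *\<^sub>R E (Suc n) = (\<Sum>i\<le>Suc n. real i *\<^sub>R (S A i * S B (Suc n - i)))
        + (\<Sum>i\<le>Suc n. real (Suc n - i) *\<^sub>R (S A i * S B (Suc n - i)))"
      unfolding E_def scaleR_sum_right sum.distrib[symmetric]
      by (intro sum.cong refl) (simp add: of_nat_diff flip: scaleR_left_distrib)
    also have "(\<Sum>i\<le>Suc n. real i *\<^sub>R (S A i * S B (Suc n - i))) = (\<Sum>i\<le>n. real (Suc i) *\<^sub>R (S A (Suc i) * S B (n - i)))"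
      by (subst sum.atMost_Suc_shift) simp
    also have "\<dots> = A * E n"
      unfolding E_def sum_distrib_left
      by (intro sum.cong refl) (simp only: mult_scaleR_left[symmetric] SSuc(1) mult.assoc)
    also have "(\<Sum>i\<le>Suc n. real (Suc n - i) *\<^sub>R (S A i * S B (Suc n - i))) = (\<Sum>i\<le>n. real (Suc (n - i)) *\<^sub>R (S A i * S B (Suc (n - i))))"
      by (auto simp: Suc_diff_le simp del: of_nat_Suc of_nat_diff intro!: sum.cong)
    also have "\<dots> = E n * B"
      unfolding E_def sum_distrib_right
      by (intro sum.cong refl) (simp only: mult_scaleR_right[symmetric] SSuc(2) mult.assoc)
    finally show ?thesis .
  qed
  \<comment> \<open>\<open>B\<close> commutes with its own powers, so only the powers of
    \<open>A\<close> contribute. The binomial theorem collects the bounds into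
    \<open>s ^ n\<close>.\<close>
  have EB: "nuc (\<kappa> * (s ^ n / fact n)) (E n * B - B * E n)" for n
  proof -
    have "nuc (norm B ^ (n - i) / fact (n - i) * (\<kappa> * (norm A + 1) ^ i / fact i)) ((S A i * B - B * S A i) * S B (n - i))" for i
    proof (rule nuc_mult_right_le)
      show "nuc (\<kappa> * (norm A + 1) ^ i / fact i) (S A i * B - B * S A i)"
        using nuc_scaleR[OF nuc_commutator_power[OF k, of i], of "inverse (fact i)"]
        by (simp add: S_def scaleR_diff_right divide_inverse mult_ac)
      show "norm (S B (n - i)) \<le> norm B ^ (n - i) / fact (n - i)"
        using norm_power_ineq[of B "n - i"] by (simp add: S_def field_simps)
    qed
    then have "nuc (\<Sum>i\<le>n. norm B ^ (n - i) / fact (n - i) * (\<kappa> * (norm A + 1) ^ i / fact i))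
        (\<Sum>i\<le>n. (S A i * B - B * S A i) * S B (n - i))"
      by (rule nuc_sum)
    also have "(\<Sum>i\<le>n. norm B ^ (n - i) / fact (n - i) * (\<kappa> * (norm A + 1) ^ i / fact i)) = \<kappa> * (s ^ n / fact n)"
    proof -
      have "((norm A + 1) + norm B) ^ n /\<^sub>R fact n
          = (\<Sum>i\<le>n. ((norm A + 1) ^ i /\<^sub>R fact i) * (norm B ^ (n - i) /\<^sub>R fact (n - i)))"
        by (rule exp_series_add_commuting) (rule mult.commute)
      then have "s ^ n / fact n = (\<Sum>i\<le>n. ((norm A + 1) ^ i / fact i) * (norm B ^ (n - i) / fact (n - i)))"
        by (simp add: s_def divide_inverse mult.commute add_ac)
      then show ?thesis by (simp add: sum_distrib_left mult_ac)
    qed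
    also have "(\<Sum>i\<le>n. (S A i * B - B * S A i) * S B (n - i)) = E n * B - B * E n"
    proof -
      have "S B m * B = B * S B m" for m by (simp add: S_def power_commutes)
      then show ?thesis
        unfolding E_def sum_distrib_left sum_distrib_right sum_subtractf[symmetric]
        by (intro sum.cong refl) (simp add: algebra_simps)
    qed
    finally show ?thesis .
  qed
  \<comment> \<open>Each step multiplies by at most \<open>s\<close> and adds a term bounded by
    \<open>s ^ n \<le> (s + 1) ^ n\<close>, hence the base \<open>s + 1\<close>.\<close>
  have D: "nuc (\<kappa> * ((s + 1) ^ n / fact n)) (E n - S (A + B) n)" for n
  proof (induction n)
    case 0
    then show ?case using k0 nuc_mono[OF nuc_0] by (simp add: E_def S_def)
  next
    case (Suc n)
    have "real (Suc n) *\<^sub>R (E (Suc n) - S (A + B) (Suc n)) = (A * E n + E n * B) - (A + B) * S (A + B) n"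
      unfolding scaleR_diff_right ESuc SSuc(1) ..
    also have "\<dots> = (A + B) * (E n - S (A + B) n) + (E n * B - B * E n)"
      by (simp add: algebra_simps)
    finally have eq: "E (Suc n) - S (A + B) (Suc n)
        = inverse (Suc n) *\<^sub>R ((A + B) * (E n - S (A + B) n) + (E n * B - B * E n))"
      by (metis (no_types, lifting) of_nat_neq_0 left_inverse scaleR_one scaleR_scaleR)
    have "nuc (\<bar>inverse (real (Suc n))\<bar> * (s * (\<kappa> * ((s + 1) ^ n / fact n)) + \<kappa> * (s ^ n / fact n)))
        (E (Suc n) - S (A + B) (Suc n))"
      unfolding eq by (intro nuc_scaleR nuc_add nuc_mult_left_le[OF Suc.IH s(1)] EB)
    moreover have "\<bar>inverse (real (Suc n))\<bar> * (s * (\<kappa> * ((s + 1) ^ n / fact n)) + \<kappa> * (s ^ n / fact n))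
        \<le> \<kappa> * ((s + 1) ^ Suc n / fact (Suc n))"
    proof -
      have "s * (s + 1) ^ n + s ^ n \<le> s * (s + 1) ^ n + (s + 1) ^ n"
        using s by (intro add_left_mono power_mono) auto
      also have "\<dots> = (s + 1) ^ Suc n" by (simp add: algebra_simps)
      finally have "\<kappa> * (s * (s + 1) ^ n + s ^ n) / fact (Suc n) \<le> \<kappa> * (s + 1) ^ Suc n / fact (Suc n)"
        using k0 by (intro divide_right_mono mult_left_mono) auto
      moreover have "\<bar>inverse (real (Suc n))\<bar> * (s * (\<kappa> * ((s + 1) ^ n / fact n)) + \<kappa> * (s ^ n / fact n))
          = \<kappa> * (s * (s + 1) ^ n + s ^ n) / fact (Suc n)"
        by (simp add: field_simps del: of_nat_Suc)
      ultimately show ?thesis by simp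
    qed
    ultimately show ?case by (rule nuc_mono)
  qed
  have "E sums (exp A * exp B)"
    unfolding E_def exp_def S_def by (intro Cauchy_product_sums summable_norm_exp)
  then have d: "(\<lambda>n. E n - S (A + B) n) sums (exp A * exp B - exp (A + B))"
    unfolding S_def by (intro sums_diff exp_sums)
  have c: "(\<lambda>n. \<kappa> * ((s + 1) ^ n / fact n)) sums (\<kappa> * exp (s + 1))"
    by (intro sums_mult exp_real_sums)
  show ?thesis
    using nuc_sums[OF D _ d] c by (simp add: sums_iff s_def add.assoc)
qed

lemma norm_exp_minus_one_le: "norm (exp A - 1) \<le> exp (norm A) - 1" for A :: "'i cop"
proof -
  have s: "(\<lambda>n. A ^ Suc n /\<^sub>R fact (Suc n)) sums (exp A - 1)"
    using exp_sums[of A] sums_Suc_iff[of "\<lambda>n. A ^ n /\<^sub>R fact n" "exp A - 1"] by simp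
  have r: "(\<lambda>n. norm A ^ Suc n / fact (Suc n)) sums (exp (norm A) - 1)"
    using exp_real_sums[of "norm A"] sums_Suc_iff[of "\<lambda>n. norm A ^ n / fact n"] by simp
  have le: "norm (A ^ Suc n /\<^sub>R fact (Suc n)) \<le> norm A ^ Suc n / fact (Suc n)" for n
    using divide_right_mono[OF norm_power_ineq[of A "Suc n"], of "fact (Suc n)"]
    by (simp add: divide_inverse mult.commute del: power_Suc fact_Suc)
  have sm: "summable (\<lambda>n. norm (A ^ Suc n /\<^sub>R fact (Suc n)))"
    by (rule summable_comparison_test'[where g = "\<lambda>n. norm A ^ Suc n / fact (Suc n)"])
       (use r le in \<open>auto simp: sums_iff simp del: power_Suc fact_Suc\<close>)
  have "norm (exp A - 1) \<le> (\<Sum>n. norm (A ^ Suc n /\<^sub>R fact (Suc n)))"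
    using summable_norm[OF sm] s by (simp add: sums_iff)
  also have "\<dots> \<le> (\<Sum>n. norm A ^ Suc n / fact (Suc n))"
    by (intro suminf_le le sm) (use r in \<open>simp add: sums_iff\<close>)
  finally show ?thesis using r by (simp add: sums_iff)
qed

text \<open>The logarithm of the power is \<open>m n * x n\<close> up to an error of size
  \<open>m n * norm (x n) ^ 2\<close>, which vanishes because \<open>m n * x n\<close> stays
  bounded. Exponents of order n as well as of order n^2 are required later, hence the sequence
  \<open>m\<close>.\<close>

lemma complex_power_tendsto_exp:
  fixes x :: "nat \<Rightarrow> complex" and m :: "nat \<Rightarrow> nat"
  assumes mx: "(\<lambda>n. of_nat (m n) * x n) \<longlonglongrightarrow> l" and x: "x \<longlonglongrightarrow> 0"
  shows "(\<lambda>n. (1 + x n) ^ m n) \<longlonglongrightarrow> exp l"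
proof -
  have ev: "eventually (\<lambda>n. norm (x n) < 1 / 2) sequentially"
    by (rule order_tendstoD(2)[OF tendsto_norm[OF x]]) simp
  have "(\<lambda>n. of_nat (m n) * (ln (1 + x n) - x n)) \<longlonglongrightarrow> 0"
  proof (rule Lim_null_comparison)
    show "eventually (\<lambda>n. norm (of_nat (m n) * (ln (1 + x n) - x n)) \<le> 2 * norm (of_nat (m n) * x n) * norm (x n)) sequentially"
      using ev
    proof eventually_elim
      case (elim n)
      have "norm (ln (1 + x n) - x n) \<le> norm (x n) ^ 2 / (1 - norm (x n))"
        by (rule Ln_approx_linear) (use elim in simp)
      also have "\<dots> \<le> norm (x n) ^ 2 / (1 / 2)"
        using elim by (intro divide_left_mono) auto
      finally have "of_nat (m n) * norm (ln (1 + x n) - x n) \<le> of_nat (m n) * (2 * norm (x n) ^ 2)"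
        by (intro mult_left_mono) auto
      then show ?case by (simp add: norm_mult power2_eq_square mult_ac)
    qed
    have "(\<lambda>n. 2 * norm (of_nat (m n) * x n) * norm (x n)) \<longlonglongrightarrow> 2 * norm l * norm (0 :: complex)"
      by (intro tendsto_intros mx x)
    then show "(\<lambda>n. 2 * norm (of_nat (m n) * x n) * norm (x n)) \<longlonglongrightarrow> 0" by simp
  qed
  from tendsto_add[OF this mx]
  have "(\<lambda>n. of_nat (m n) * ln (1 + x n)) \<longlonglongrightarrow> l"
    by (simp add: algebra_simps)
  then have "(\<lambda>n. exp (of_nat (m n) * ln (1 + x n))) \<longlonglongrightarrow> exp l"
    by (intro tendsto_intros)
  moreover have "eventually (\<lambda>n. exp (of_nat (m n) * ln (1 + x n)) = (1 + x n) ^ m n) sequentially"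
    using ev
  proof eventually_elim
    case (elim n)
    have "1 + x n \<noteq> 0"
    proof
      assume "1 + x n = 0"
      then have "x n = -1" by (simp add: eq_neg_iff_add_eq_0 add.commute)
      then show False using elim by simp
    qed
    then show ?case by (simp add: exp_of_nat_mult)
  qed
  ultimately show ?thesis by (rule Lim_transform_eventually)
qed

lemma exp_scaleR_power: "exp (real n *\<^sub>R A) = exp A ^ n" for A :: "'i cop"
proof (induction n)
  case (Suc n)
  have "exp (A + real n *\<^sub>R A) = exp A * exp (real n *\<^sub>R A)"
    by (rule exp_add_commuting) simp
  then show ?case by (simp add: Suc scaleR_left_distrib)
qed simp

definition cop_trace :: "'i cop \<Rightarrow> complex" where
  "cop_trace K = (\<Sum>\<^sub>\<infinity>i. entry K i i)"

lemma cop_trace_add: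
  assumes "nuc a K" "nuc b L"
  shows "cop_trace (K + L) = cop_trace K + cop_trace L"
proof -
  have "(\<lambda>i. entry K i i) summable_on UNIV" "(\<lambda>i. entry L i i) summable_on UNIV"
    using abs_summable_summable[OF nuclear_summable_diag(1)] assms unfolding nuc_def by blast+
  then show ?thesis
    unfolding cop_trace_def by (simp add: infsum_add)
qed

lemma cop_trace_scaleR: "cop_trace (r *\<^sub>R K) = r *\<^sub>R cop_trace K"
  unfolding cop_trace_def by (simp add: scaleR_conv_of_real[where 'a = complex] infsum_cmult_right')

lemma norm_cop_trace_le:
  assumes "nuc a K"
  shows "cmod (cop_trace K) \<le> a"
  unfolding cop_trace_def
  by (rule order_trans[OF norm_infsum_bound[OF nuclear_summable_diag(1)] nuclear_summable_diag(2)])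
    (use assms in \<open>simp_all add: nuc_def\<close>)

lemma gdet_first_order:
  assumes "nuc c (G - 1)" "c \<le> 1 / 2"
  shows "cmod (gdet G - 1 - cop_trace (G - 1)) \<le> 2 * c\<^sup>2"
  using fredholm_first_order[OF assms(1)[unfolded nuc_def] assms(2)]
  by (simp add: gdet_def fdet_def cop_trace_def diff_diff_eq)

lemma nuc_exp_product_inverse:
  assumes k: "nuc \<kappa> (A * B - B * A)"
  shows "nuc (exp (norm A + norm B) * (\<kappa> * exp (norm A + norm B + 2))) (exp A * exp B * exp (- (A + B)) - 1)"
proof -
  have "norm (exp (- (A + B))) \<le> exp (norm A + norm B)"
    by (rule order_trans[OF norm_exp]) (simp only: norm_minus_cancel exp_le_cancel_iff norm_triangle_ineq)
  from nuc_mult_right_le[OF nuc_exp_product[OF k] this] show ?thesis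
    unfolding left_diff_distrib exp_minus_inverse .
qed

lemma exp_minus_one_le: "exp x - 1 \<le> x * exp x" for x :: real
proof -
  have "exp x * (1 - x) \<le> exp x * exp (- x)"
    using exp_ge_add_one_self[of "- x"] by (intro mult_left_mono) auto
  also have "\<dots> = 1" by (simp flip: exp_add)
  finally show ?thesis by (simp add: algebra_simps)
qed

text \<open>With \<open>W = e^{-A} e^{-B}\<close> the group commutator minus 1 equals
  \<open>(exp A * exp B - exp B * exp A) * W\<close>. Two uses of \<open>nuc_exp_commutator\<close>,
  for \<open>A\<close> against \<open>B\<close> and for \<open>B\<close> against
  \<open>exp A\<close>, linearize the bracket, and \<open>W - 1\<close> is of size
  \<open>norm A + norm B\<close>.\<close>

lemma nuc_group_commutator:
  assumes k: "nuc \<kappa> (A * B - B * A)" and a: "norm A \<le> 1" and b: "norm B \<le> 1"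
  shows "nuc (\<kappa> * (norm A + norm B) * (exp 2 * (exp 2 * (1 + exp 2)) + exp 2))
    ((exp A * exp B * exp (- A) * exp (- B) - 1) - (A * B - B * A))"
proof -
  have k0: "\<kappa> \<ge> 0" by (rule nuc_nonneg[OF k])
  define W where "W = exp (- A) * exp (- B)"
  define R1 where "R1 = (exp A * B - B * exp A) - (A * B - B * A)"
  \<comment> \<open>\<open>R1 - R2\<close> is \<open>exp A * exp B - exp B * exp A\<close> minus the
    commutator of \<open>A\<close> and \<open>B\<close>, since the mixed terms with
    \<open>exp A\<close> and \<open>B\<close> cancel.\<close>
  define R2 where "R2 = (exp B * exp A - exp A * exp B) - (B * exp A - exp A * B)"
  have R1: "nuc (\<kappa> * norm A * exp 2) R1"
    unfolding R1_def by (rule nuc_exp_commutator[OF k a])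
  have "nuc (\<kappa> * norm A * exp 2 + \<kappa>) (- (R1 + (A * B - B * A)))"
    by (rule nuc_uminus[OF nuc_add[OF R1 k]])
  moreover have "\<kappa> * norm A * exp 2 + \<kappa> \<le> \<kappa> * (1 + exp 2)"
    using k0 a mult_left_mono[of "norm A" 1 "\<kappa> * exp 2"] by (simp add: algebra_simps)
  moreover have "- (R1 + (A * B - B * A)) = B * exp A - exp A * B"
    by (simp add: R1_def)
  ultimately have "nuc (\<kappa> * (1 + exp 2)) (B * exp A - exp A * B)"
    using nuc_mono by metis
  from nuc_exp_commutator[OF this b] have R2: "nuc (\<kappa> * (1 + exp 2) * norm B * exp 2) R2"
    unfolding R2_def .
  have eA: "norm (exp (- A)) \<le> exp (norm A)" and eB: "norm (exp (- B)) \<le> exp (norm B)"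
    using norm_exp[of "- A"] norm_exp[of "- B"] by simp_all
  have e2: "exp (norm A + norm B) \<le> exp 2" using a b by simp
  have W: "norm W \<le> exp 2"
  proof -
    have "norm W \<le> norm (exp (- A)) * norm (exp (- B))"
      unfolding W_def by (rule norm_mult_ineq)
    also have "\<dots> \<le> exp (norm A) * exp (norm B)"
      by (intro mult_mono eA eB) auto
    finally show ?thesis using e2 by (simp add: exp_add)
  qed
  have W1: "norm (W - 1) \<le> (norm A + norm B) * exp 2"
  proof -
    have "W - 1 = (exp (- A) - 1) * exp (- B) + (exp (- B) - 1)"
      by (simp add: W_def algebra_simps)
    then have "norm (W - 1) \<le> norm ((exp (- A) - 1) * exp (- B)) + norm (exp (- B) - 1)"
      using norm_triangle_ineq by metis
    also have "\<dots> \<le> norm (exp (- A) - 1) * norm (exp (- B)) + norm (exp (- B) - 1)"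
      by (intro add_right_mono norm_mult_ineq)
    also have "\<dots> \<le> (exp (norm A) - 1) * exp (norm B) + (exp (norm B) - 1)"
      using norm_exp_minus_one_le[of "- A"] norm_exp_minus_one_le[of "- B"] eB
      by (intro add_mono mult_mono) auto
    also have "\<dots> = exp (norm A + norm B) - 1"
      by (simp add: exp_add algebra_simps)
    also have "\<dots> \<le> (norm A + norm B) * exp (norm A + norm B)"
      by (rule exp_minus_one_le)
    also have "\<dots> \<le> (norm A + norm B) * exp 2"
      by (intro mult_left_mono e2) auto
    finally show ?thesis .
  qed
  have n1: "nuc (exp 2 * (\<kappa> * norm A * exp 2 + \<kappa> * (1 + exp 2) * norm B * exp 2) + (norm A + norm B) * exp 2 * \<kappa>)
      ((R1 - R2) * W + (A * B - B * A) * (W - 1))"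
    by (intro nuc_add nuc_mult_right_le[OF nuc_diff[OF R1 R2] W] nuc_mult_right_le[OF k W1])
  have n2: "exp 2 * (\<kappa> * norm A * exp 2 + \<kappa> * (1 + exp 2) * norm B * exp 2) + (norm A + norm B) * exp 2 * \<kappa>
      \<le> \<kappa> * (norm A + norm B) * (exp 2 * (exp 2 * (1 + exp 2)) + exp 2)"
    using k0 by (simp add: algebra_simps)
  have n3: "(R1 - R2) * W + (A * B - B * A) * (W - 1) = (exp A * exp B * exp (- A) * exp (- B) - 1) - (A * B - B * A)"
  proof -
    have "exp B * (exp A * (exp (- A) * exp (- B))) = 1"
      by (simp add: mult.assoc[symmetric] exp_minus_inverse)
    then have "(exp A * exp B - exp B * exp A) * W = exp A * exp B * exp (- A) * exp (- B) - 1"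
      by (simp add: W_def left_diff_distrib mult.assoc)
    moreover have "(R1 - R2) * W + (A * B - B * A) * (W - 1) = (exp A * exp B - exp B * exp A) * W - (A * B - B * A)"
      by (simp add: R1_def R2_def algebra_simps)
    ultimately show ?thesis by simp
  qed
  show ?thesis using nuc_mono[OF n1 n2] unfolding n3 .
qed

theorem gdet_exp_product:
  assumes k: "nuc \<kappa> (A * B - B * A)"
  shows "near_one (exp A * exp B * exp (- (A + B)))"
    and "gdet (exp A * exp B * exp (- (A + B))) = exp (cop_trace (A * B - B * A) / 2)"
proof -
  show no: "near_one (exp A * exp B * exp (- (A + B)))"
    using nuc_exp_product_inverse[OF k] by (auto simp: near_one_def trace_class_def)
  define \<tau> where "\<tau> = cop_trace (A * B - B * A)"
  \<comment> \<open>The step size 1/n, with value 0 at \<open>n = 0\<close> because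
    \<open>inverse 0 = 0\<close>. The bounds tolerate this value, and the limits are taken over
    \<open>n > 0\<close>.\<close>
  define t where "t = (\<lambda>n::nat. inverse (real n))"
  have t0: "t \<longlonglongrightarrow> 0" unfolding t_def by (rule lim_inverse_n)
  have tn: "t n \<ge> 0" "t n \<le> 1" for n by (cases n; simp add: t_def field_simps)+
  define X where "X = (\<lambda>n. exp (t n *\<^sub>R A))"
  define Y where "Y = (\<lambda>n. exp (t n *\<^sub>R B))"
  define X' where "X' = (\<lambda>n. exp (- (t n *\<^sub>R A)))"
  define Y' where "Y' = (\<lambda>n. exp (- (t n *\<^sub>R B)))"
  define Z where "Z = (\<lambda>n. exp (- (t n *\<^sub>R A + t n *\<^sub>R B)))"
  define C where "C = exp 2 * (exp 2 * (1 + exp 2)) + exp (2 :: real)"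
  define s where "s = norm A + norm B"
  have k0: "\<kappa> \<ge> 0" and C0: "C \<ge> 0" and s0: "s \<ge> 0"
    using nuc_nonneg[OF k] by (auto simp: C_def s_def intro: add_nonneg_nonneg)
  have comm: "(t n *\<^sub>R A) * (t n *\<^sub>R B) - (t n *\<^sub>R B) * (t n *\<^sub>R A) = (t n)\<^sup>2 *\<^sub>R (A * B - B * A)" for n
    by (simp add: power2_eq_square scaleR_diff_right)
  have kt: "nuc (\<kappa> * (t n)\<^sup>2) ((t n *\<^sub>R A) * (t n *\<^sub>R B) - (t n *\<^sub>R B) * (t n *\<^sub>R A))" for n
    unfolding comm using nuc_scaleR[OF k, of "(t n)\<^sup>2"] by (simp add: mult.commute)
  have ns: "norm (t n *\<^sub>R A) + norm (t n *\<^sub>R B) = t n * s" for n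
    using tn by (simp add: s_def distrib_left)
  \<comment> \<open>For the product of the three exponentials a bound of order
    \<open>(t n)\<^sup>2\<close> is enough, because this determinant enters only with the exponent
    \<open>n\<close>.\<close>
  define kb where "kb = (\<lambda>n. exp s * (\<kappa> * (t n)\<^sup>2 * exp (s + 2)))"
  have B1: "nuc (kb n) (X n * Y n * Z n - 1)" for n
  proof -
    have "nuc (exp (t n * s) * (\<kappa> * (t n)\<^sup>2 * exp (t n * s + 2))) (X n * Y n * Z n - 1)"
      using nuc_exp_product_inverse[OF kt[of n]] unfolding ns X_def Y_def Z_def .
    moreover have "t n * s \<le> s" using tn s0 mult_right_mono[of "t n" 1 s] by simp
    then have "exp (t n * s) * (\<kappa> * (t n)\<^sup>2 * exp (t n * s + 2)) \<le> kb n"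
      unfolding kb_def using k0 by (intro mult_mono) auto
    ultimately show ?thesis by (rule nuc_mono)
  qed
  define r where "r = (\<lambda>n. \<kappa> * (t n)\<^sup>2 * (t n * s) * C)"
  have evA: "eventually (\<lambda>n. norm (t n *\<^sub>R A) \<le> 1 \<and> norm (t n *\<^sub>R B) \<le> 1) sequentially"
  proof -
    have "(\<lambda>n. t n * s) \<longlonglongrightarrow> 0" using tendsto_mult_left_zero[OF t0] .
    then have "eventually (\<lambda>n. t n * s < 1) sequentially" by (rule order_tendstoD) simp
    then show ?thesis
    proof eventually_elim
      case (elim n)
      then show ?case
        unfolding ns[symmetric] using norm_ge_zero[of "t n *\<^sub>R A"] norm_ge_zero[of "t n *\<^sub>R B"] by linarith
    qed
  qed
  have C1: "nuc (r n) ((X n * Y n * X' n * Y' n - 1) - (t n)\<^sup>2 *\<^sub>R (A * B - B * A))"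
    if "norm (t n *\<^sub>R A) \<le> 1 \<and> norm (t n *\<^sub>R B) \<le> 1" for n
    using nuc_group_commutator[OF kt[of n]] that
    unfolding comm ns X_def Y_def X'_def Y'_def r_def C_def by blast
  have C2: "nuc (\<kappa> * (t n)\<^sup>2 + r n) (X n * Y n * X' n * Y' n - 1)"
    if "norm (t n *\<^sub>R A) \<le> 1 \<and> norm (t n *\<^sub>R B) \<le> 1" for n
    using nuc_add[OF kt[of n, unfolded comm] C1[OF that]] by simp
  define x where "x = (\<lambda>n. gdet (X n * Y n * X' n * Y' n) - 1)"
  define y where "y = (\<lambda>n. gdet (X n * Y n * Z n) - 1)"
  have small: "eventually (\<lambda>n. c n \<le> 1 / 2) sequentially" if "c \<longlonglongrightarrow> 0" for c :: "nat \<Rightarrow> real"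
    using order_tendstoD(2)[OF that, of "1 / 2"] by (auto elim: eventually_mono)
  have pos: "eventually (\<lambda>n::nat. n > 0) sequentially" by (rule eventually_gt_at_top)
  have kb0: "kb \<longlonglongrightarrow> 0"
  proof -
    have "kb \<longlonglongrightarrow> exp s * (\<kappa> * 0\<^sup>2 * exp (s + 2))"
      unfolding kb_def by (intro tendsto_intros t0)
    then show ?thesis by simp
  qed
  have r0: "(\<lambda>n. \<kappa> * (t n)\<^sup>2 + r n) \<longlonglongrightarrow> 0"
  proof -
    have "(\<lambda>n. \<kappa> * (t n)\<^sup>2 + r n) \<longlonglongrightarrow> \<kappa> * 0\<^sup>2 + \<kappa> * 0\<^sup>2 * (0 * s) * C"
      unfolding r_def by (intro tendsto_intros t0)
    then show ?thesis by simp
  qed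
  have ny: "(\<lambda>n. of_nat n * y n) \<longlonglongrightarrow> 0"
  proof (rule Lim_null_comparison)
    show "(\<lambda>n. exp s * (\<kappa> * t n * exp (s + 2)) * (1 + 2 * kb n)) \<longlonglongrightarrow> 0"
    proof -
      have "(\<lambda>n. exp s * (\<kappa> * t n * exp (s + 2)) * (1 + 2 * kb n)) \<longlonglongrightarrow> exp s * (\<kappa> * 0 * exp (s + 2)) * (1 + 2 * 0)"
        by (intro tendsto_intros t0 kb0)
      then show ?thesis by simp
    qed
    show "eventually (\<lambda>n. norm (of_nat n * y n) \<le> exp s * (\<kappa> * t n * exp (s + 2)) * (1 + 2 * kb n)) sequentially"
      using small[OF kb0] pos
    proof eventually_elim
      case (elim n)
      have "norm (y n) \<le> norm (y n - cop_trace (X n * Y n * Z n - 1)) + norm (cop_trace (X n * Y n * Z n - 1))"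
        using norm_triangle_sub by (metis add.commute)
      also have "\<dots> \<le> 2 * (kb n)\<^sup>2 + kb n"
        unfolding y_def by (intro add_mono gdet_first_order norm_cop_trace_le B1 elim)
      also have "\<dots> = kb n * (1 + 2 * kb n)" by (simp add: power2_eq_square algebra_simps)
      finally have "real n * norm (y n) \<le> real n * (kb n * (1 + 2 * kb n))"
        by (intro mult_left_mono) auto
      also have "real n * kb n = exp s * (\<kappa> * t n * exp (s + 2))"
        using elim by (simp add: kb_def t_def power2_eq_square)
      then have "real n * (kb n * (1 + 2 * kb n)) = exp s * (\<kappa> * t n * exp (s + 2)) * (1 + 2 * kb n)"
        by (simp only: mult.assoc[symmetric])
      finally show ?case by (simp add: norm_mult)
    qed
  qed
  \<comment> \<open>The trace of the group commutator minus 1 is \<open>(t n)\<^sup>2\<close> times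
    \<open>\<tau>\<close> up to order \<open>(t n) ^ 3\<close>, and the remainder of the determinant
    beyond the trace is of order \<open>(t n) ^ 4\<close>. Both errors vanish after multiplication
    by \<open>n * n\<close>.\<close>
  have nx: "(\<lambda>n. of_nat n * of_nat n * x n) \<longlonglongrightarrow> \<tau>"
  proof -
    have "(\<lambda>n. of_nat n * of_nat n * x n - \<tau>) \<longlonglongrightarrow> 0"
    proof (rule Lim_null_comparison)
      show "(\<lambda>n. 2 * (t n * (\<kappa> + \<kappa> * (t n * s) * C))\<^sup>2 + \<kappa> * (t n * s) * C) \<longlonglongrightarrow> 0"
      proof -
        have "(\<lambda>n. 2 * (t n * (\<kappa> + \<kappa> * (t n * s) * C))\<^sup>2 + \<kappa> * (t n * s) * C)
            \<longlonglongrightarrow> 2 * (0 * (\<kappa> + \<kappa> * (0 * s) * C))\<^sup>2 + \<kappa> * (0 * s) * C"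
          by (intro tendsto_intros t0)
        then show ?thesis by simp
      qed
      show "eventually (\<lambda>n. norm (of_nat n * of_nat n * x n - \<tau>)
          \<le> 2 * (t n * (\<kappa> + \<kappa> * (t n * s) * C))\<^sup>2 + \<kappa> * (t n * s) * C) sequentially"
        using small[OF r0] pos evA
      proof eventually_elim
        case (elim n)
        let ?K = "X n * Y n * X' n * Y' n - 1"
        have tr: "cop_trace ?K = (t n)\<^sup>2 *\<^sub>R \<tau> + cop_trace (?K - (t n)\<^sup>2 *\<^sub>R (A * B - B * A))"
          using cop_trace_add[OF kt[of n, unfolded comm] C1[OF elim(3)]] by (simp add: cop_trace_scaleR \<tau>_def)
        have "norm (x n - (t n)\<^sup>2 *\<^sub>R \<tau>) \<le> norm (x n - cop_trace ?K) + norm (cop_trace (?K - (t n)\<^sup>2 *\<^sub>R (A * B - B * A)))"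
          using norm_triangle_ineq[of "x n - cop_trace ?K" "cop_trace (?K - (t n)\<^sup>2 *\<^sub>R (A * B - B * A))"]
          by (simp add: tr)
        also have "\<dots> \<le> 2 * (\<kappa> * (t n)\<^sup>2 + r n)\<^sup>2 + r n"
          unfolding x_def by (intro add_mono gdet_first_order norm_cop_trace_le C1 C2 elim)
        finally have 1: "real n * real n * norm (x n - (t n)\<^sup>2 *\<^sub>R \<tau>) \<le> real n * real n * (2 * (\<kappa> * (t n)\<^sup>2 + r n)\<^sup>2 + r n)"
          by (intro mult_left_mono) auto
        have nt: "real n * t n = 1" using elim by (simp add: t_def)
        have "real n * real n * r n = (real n * t n) * (real n * t n) * (\<kappa> * (t n * s) * C)"
          by (simp add: r_def power2_eq_square mult_ac)
        then have 2: "real n * real n * r n = \<kappa> * (t n * s) * C" by (simp add: nt)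
        have "\<kappa> * (t n)\<^sup>2 + r n = t n * (t n * (\<kappa> + \<kappa> * (t n * s) * C))"
          by (simp add: r_def power2_eq_square algebra_simps)
        then have "real n * real n * (\<kappa> * (t n)\<^sup>2 + r n)\<^sup>2 = (real n * t n)\<^sup>2 * (t n * (\<kappa> + \<kappa> * (t n * s) * C))\<^sup>2"
          by (simp add: power2_eq_square mult_ac)
        then have 3: "real n * real n * (\<kappa> * (t n)\<^sup>2 + r n)\<^sup>2 = (t n * (\<kappa> + \<kappa> * (t n * s) * C))\<^sup>2"
          by (simp add: nt)
        have "of_nat n * of_nat n * x n - \<tau> = of_nat n * of_nat n * (x n - (t n)\<^sup>2 *\<^sub>R \<tau>)"
          using elim by (simp add: t_def scaleR_conv_of_real power2_eq_square field_simps)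
        then have "norm (of_nat n * of_nat n * x n - \<tau>) = real n * real n * norm (x n - (t n)\<^sup>2 *\<^sub>R \<tau>)"
          by (simp add: norm_mult)
        also note 1
        also have "real n * real n * (2 * (\<kappa> * (t n)\<^sup>2 + r n)\<^sup>2 + r n)
            = 2 * (t n * (\<kappa> + \<kappa> * (t n * s) * C))\<^sup>2 + \<kappa> * (t n * s) * C"
          using 2 3 by (simp add: distrib_left mult.left_commute[of _ 2])
        finally show ?case .
      qed
    qed
    then show ?thesis by (simp add: LIM_zero_iff)
  qed
  have x0: "x \<longlonglongrightarrow> 0" and y0: "y \<longlonglongrightarrow> 0"
  proof -
    have ct: "(\<lambda>n. complex_of_real (t n)) \<longlonglongrightarrow> 0"
      using tendsto_of_real[OF t0] by simp
    have a: "(\<lambda>n. of_real (t n) * of_real (t n) * (of_nat n * of_nat n * x n)) \<longlonglongrightarrow> 0 * 0 * \<tau>"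
      by (intro tendsto_mult ct nx)
    have b: "eventually (\<lambda>n. of_real (t n) * of_real (t n) * (of_nat n * of_nat n * x n) = x n) sequentially"
      using pos by eventually_elim (simp add: t_def field_simps)
    from Lim_transform_eventually[OF a b] show "x \<longlonglongrightarrow> 0" by simp
    have c: "(\<lambda>n. of_real (t n) * (of_nat n * y n)) \<longlonglongrightarrow> 0 * 0"
      by (intro tendsto_mult ct ny)
    have d: "eventually (\<lambda>n. of_real (t n) * (of_nat n * y n) = y n) sequentially"
      using pos by eventually_elim (simp add: t_def)
    from Lim_transform_eventually[OF c d] show "y \<longlonglongrightarrow> 0" by simp
  qed
  have m: "2 * (\<Sum>j<n. j) + n = n * n" for n :: nat
    by (induction n) (auto simp: algebra_simps)
  have mx: "(\<lambda>n. of_nat (\<Sum>j<n. j) * x n) \<longlonglongrightarrow> \<tau> / 2"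
  proof -
    have "(\<lambda>n. (1 - of_real (t n)) / 2 * (of_nat n * of_nat n * x n)) \<longlonglongrightarrow> (1 - of_real 0) / 2 * \<tau>"
      by (intro tendsto_intros t0 nx) simp
    moreover have "eventually (\<lambda>n. (1 - of_real (t n)) / 2 * (of_nat n * of_nat n * x n) = of_nat (\<Sum>j<n. j) * x n) sequentially"
      using pos
    proof eventually_elim
      case (elim n)
      have "2 * complex_of_nat (\<Sum>j<n. j) = of_nat n * of_nat n - of_nat n"
        using arg_cong[OF m[of n], of complex_of_nat] by (simp add: algebra_simps)
      then have c: "complex_of_nat (\<Sum>j<n. j) = (of_nat n * of_nat n - of_nat n) / 2" by (simp add: field_simps)
      show ?case unfolding c using elim by (simp add: t_def field_simps)
    qed
    ultimately have "(\<lambda>n. of_nat (\<Sum>j<n. j) * x n) \<longlonglongrightarrow> (1 - of_real 0) / 2 * \<tau>"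
      by (rule Lim_transform_eventually)
    then show ?thesis by simp
  qed
  have "(\<lambda>n. (1 + y n) ^ n * (1 + x n) ^ (\<Sum>j<n. j)) \<longlonglongrightarrow> exp 0 * exp (\<tau> / 2)"
    by (intro tendsto_mult complex_power_tendsto_exp ny y0 mx x0)
  \<comment> \<open>By \<open>gdet_power\<close> the sequence is eventually constant, so its limit
    is the exact value of the determinant.\<close>
  moreover have "eventually (\<lambda>n. (1 + y n) ^ n * (1 + x n) ^ (\<Sum>j<n. j) = gdet (exp A * exp B * exp (- (A + B)))) sequentially"
    using pos evA
  proof eventually_elim
    case (elim n)
    interpret near_commuting "X n" "Y n" "Z n" "X' n" "Y' n"
    proof
      show "X n * X' n = 1" "X' n * X n = 1" "Y n * Y' n = 1" "Y' n * Y n = 1"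
        using exp_minus_inverse[of "t n *\<^sub>R A"] exp_minus_inverse[of "- (t n *\<^sub>R A)"]
          exp_minus_inverse[of "t n *\<^sub>R B"] exp_minus_inverse[of "- (t n *\<^sub>R B)"]
        by (simp_all add: X_def Y_def X'_def Y'_def)
      show "near_one (X n * Y n * X' n * Y' n)"
        using C2[OF elim(2)] by (auto simp: near_one_def trace_class_def)
      show "near_one (X n * Y n * Z n)"
        using B1[of n] by (auto simp: near_one_def trace_class_def)
    qed
    have nt: "real n * t n = 1" using elim by (simp add: t_def)
    have "X n ^ n = exp A" "Y n ^ n = exp B" "Z n ^ n = exp (- (A + B))"
      using exp_scaleR_power[of n "t n *\<^sub>R A"] exp_scaleR_power[of n "t n *\<^sub>R B"]
        exp_scaleR_power[of n "- (t n *\<^sub>R A + t n *\<^sub>R B)"]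
      by (simp_all add: X_def Y_def Z_def nt scaleR_diff_right)
    then show ?case using gdet_power[of n] by (simp add: x_def y_def)
  qed
  ultimately have "(\<lambda>n::nat. gdet (exp A * exp B * exp (- (A + B)))) \<longlonglongrightarrow> exp 0 * exp (\<tau> / 2)"
    by (rule Lim_transform_eventually)
  then show "gdet (exp A * exp B * exp (- (A + B))) = exp (cop_trace (A * B - B * A) / 2)"
    by (simp add: LIMSEQ_const_iff \<tau>_def)
qed

section \<open>Compressions and Hilbert--Schmidt corners\<close>

text \<open>The Hilbert-Schmidt norm is at most \<open>h\<close>, tested on finite blocks so that no
  summability has to be carried along.\<close>

definition hs :: "real \<Rightarrow> 'i cop \<Rightarrow> bool" where
  "hs h A \<longleftrightarrow> h \<ge> 0 \<and> (\<forall>I J. finite I \<longrightarrow> finite J \<longrightarrow> (\<Sum>i\<in>I. \<Sum>j\<in>J. (cmod (entry A i j))\<^sup>2) \<le> h\<^sup>2)"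

lemma hs_nonneg: "hs h A \<Longrightarrow> h \<ge> 0"
  by (simp add: hs_def)

lemma hsD: "hs h A \<Longrightarrow> finite I \<Longrightarrow> finite J \<Longrightarrow> (\<Sum>i\<in>I. \<Sum>j\<in>J. (cmod (entry A i j))\<^sup>2) \<le> h\<^sup>2"
  by (simp add: hs_def)

lemma hs_mono: "hs h A \<Longrightarrow> h \<le> k \<Longrightarrow> hs k A"
  unfolding hs_def by (meson order_trans power_mono)

lemma hs_0: "hs 0 0"
  by (simp add: hs_def)

lemma hs_add:
  assumes "hs h A" "hs k B"
  shows "hs (h + k) (A + B)"
  unfolding hs_def
proof (intro conjI allI impI)
  have pos: "h \<ge> 0" "k \<ge> 0" using assms hs_nonneg by auto
  then show "h + k \<ge> 0" by simp
  fix I J :: "'a set" assume IJ: "finite I" "finite J"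
  let ?f = "\<lambda>A p. cmod (entry A (fst p) (snd p))"
  have L: "L2_set (?f A) (I \<times> J) \<le> h" if "hs h A" for A h
    unfolding L2_set_def
    by (rule real_le_lsqrt)
      (use hsD[OF that IJ] hs_nonneg[OF that] in \<open>simp_all add: sum.cartesian_product case_prod_beta sum_nonneg\<close>)
  have "L2_set (?f (A + B)) (I \<times> J) \<le> L2_set (\<lambda>p. ?f A p + ?f B p) (I \<times> J)"
    by (rule L2_set_mono) (auto simp: norm_triangle_ineq)
  also have "\<dots> \<le> L2_set (?f A) (I \<times> J) + L2_set (?f B) (I \<times> J)"
    by (rule L2_set_triangle_ineq)
  also have "\<dots> \<le> h + k"
    by (intro add_mono L assms)
  finally have "sqrt (\<Sum>p\<in>I \<times> J. (?f (A + B) p)\<^sup>2) \<le> h + k"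
    by (simp add: L2_set_def)
  then have "(\<Sum>p\<in>I \<times> J. (?f (A + B) p)\<^sup>2) \<le> (h + k)\<^sup>2"
    by (rule sqrt_le_D)
  then show "(\<Sum>i\<in>I. \<Sum>j\<in>J. (cmod (entry (A + B) i j))\<^sup>2) \<le> (h + k)\<^sup>2"
    by (simp add: sum.cartesian_product case_prod_beta)
qed

lemma norm_sq_sum_le:
  assumes "\<And>F. finite F \<Longrightarrow> (\<Sum>j\<in>J. \<Sum>i\<in>F. (cmod (ell2_coord (x j) i))\<^sup>2) \<le> C"
  shows "(\<Sum>j\<in>J. (norm (x j))\<^sup>2) \<le> C"
proof (rule tendsto_upperbound)
  show "((\<lambda>F. \<Sum>j\<in>J. (norm (restr F (x j)))\<^sup>2) \<longlongrightarrow> (\<Sum>j\<in>J. (norm (x j))\<^sup>2)) (finite_subsets_at_top UNIV)"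
    by (intro tendsto_sum tendsto_power tendsto_norm tendsto_restr)
  show "eventually (\<lambda>F. (\<Sum>j\<in>J. (norm (restr F (x j)))\<^sup>2) \<le> C) (finite_subsets_at_top UNIV)"
    by (rule eventually_finite_subsets_at_top_weakI) (use assms in \<open>simp add: norm_sq_restr_finite\<close>)
qed simp

lemma hs_columns:
  assumes "hs h A" "finite J"
  shows "(\<Sum>j\<in>J. (norm (capply A (ell2_basis j)))\<^sup>2) \<le> h\<^sup>2"
proof (rule norm_sq_sum_le)
  fix F :: "'a set" assume "finite F"
  from hsD[OF assms(1) this assms(2)] show "(\<Sum>j\<in>J. \<Sum>i\<in>F. (cmod (ell2_coord (capply A (ell2_basis j)) i))\<^sup>2) \<le> h\<^sup>2"
    by (subst sum.swap) (simp add: entry_def)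
qed

lemma hs_rows:
  assumes "hs h A" "finite I" "\<And>i j. ell2_coord (w i) j = entry A i j"
  shows "(\<Sum>i\<in>I. (norm (w i))\<^sup>2) \<le> h\<^sup>2"
  by (rule norm_sq_sum_le) (use hsD[OF assms(1,2)] in \<open>simp add: assms(3)\<close>)

lemma hs_mult_left:
  assumes A: "hs h A"
  shows "hs (norm S * h) (S * A)"
  unfolding hs_def
proof (intro conjI allI impI)
  show "norm S * h \<ge> 0" using hs_nonneg[OF A] by simp
  fix I J :: "'a set" assume IJ: "finite I" "finite J"
  have "(\<Sum>i\<in>I. \<Sum>j\<in>J. (cmod (entry (S * A) i j))\<^sup>2) = (\<Sum>j\<in>J. \<Sum>i\<in>I. (cmod (ell2_coord (capply S (capply A (ell2_basis j))) i))\<^sup>2)"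
    by (subst sum.swap) (simp add: entry_def)
  also have "\<dots> \<le> (\<Sum>j\<in>J. (norm (capply S (capply A (ell2_basis j))))\<^sup>2)"
    by (intro sum_mono ell2_sum_le_norm_sq IJ)
  also have "\<dots> \<le> (\<Sum>j\<in>J. (norm S * norm (capply A (ell2_basis j)))\<^sup>2)"
    by (intro sum_mono power_mono norm_capply_le) auto
  also have "\<dots> = (norm S)\<^sup>2 * (\<Sum>j\<in>J. (norm (capply A (ell2_basis j)))\<^sup>2)"
    by (simp add: power_mult_distrib sum_distrib_left)
  also have "\<dots> \<le> (norm S)\<^sup>2 * h\<^sup>2"
    by (intro mult_left_mono hs_columns[OF A] IJ) auto
  finally show "(\<Sum>i\<in>I. \<Sum>j\<in>J. (cmod (entry (S * A) i j))\<^sup>2) \<le> (norm S * h)\<^sup>2"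
    by (simp add: power_mult_distrib)
qed

lemma row_vectors:
  obtains w where "\<And>i j. ell2_coord (w i) j = entry A i j"
    "\<And>i x. ell2_coord (capply A x) i = pairing (w i) x"
proof -
  have "\<exists>w. (\<forall>j. ell2_coord w j = entry A i j) \<and> (\<forall>x. ell2_coord (capply A x) i = pairing w x)" for i
    using row_vector[of A i] by metis
  then have "\<forall>i. \<exists>w. (\<forall>j. ell2_coord w j = entry A i j) \<and> (\<forall>x. ell2_coord (capply A x) i = pairing w x)"
    by blast
  from choice[OF this] show thesis using that by blast
qed

lemma hs_mult_right:
  assumes A: "hs h A"
  shows "hs (norm S * h) (A * S)"
  unfolding hs_def
proof (intro conjI allI impI)
  show "norm S * h \<ge> 0" using hs_nonneg[OF A] by simp
  fix I J :: "'a set" assume IJ: "finite I" "finite J"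
  obtain w where w: "\<And>i j. ell2_coord (w i) j = entry A i j"
    "\<And>i x. ell2_coord (capply A x) i = pairing (w i) x"
    using row_vectors[of A] by blast
  have "(\<Sum>j\<in>J. (cmod (entry (A * S) i j))\<^sup>2) \<le> (norm S)\<^sup>2 * (norm (w i))\<^sup>2" for i
  proof -
    obtain v where v: "\<And>x. pairing v x = pairing (w i) (capply S x)" "norm v \<le> norm (w i) * norm S"
      using transpose_vector[of "w i" S] by blast
    have "entry (A * S) i j = ell2_coord v j" for j
      using v(1)[of "ell2_basis j"] by (simp add: entry_def w(2))
    then have "(\<Sum>j\<in>J. (cmod (entry (A * S) i j))\<^sup>2) \<le> (norm v)\<^sup>2"
      using ell2_sum_le_norm_sq[OF IJ(2), of v] by simp
    also have "\<dots> \<le> (norm (w i) * norm S)\<^sup>2"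
      by (intro power_mono v) auto
    finally show ?thesis by (simp add: power_mult_distrib mult.commute)
  qed
  then have "(\<Sum>i\<in>I. \<Sum>j\<in>J. (cmod (entry (A * S) i j))\<^sup>2) \<le> (\<Sum>i\<in>I. (norm S)\<^sup>2 * (norm (w i))\<^sup>2)"
    by (intro sum_mono)
  also have "\<dots> \<le> (norm S)\<^sup>2 * h\<^sup>2"
    unfolding sum_distrib_left[symmetric] by (intro mult_left_mono hs_rows[OF A IJ(1) w(1)]) auto
  finally show "(\<Sum>i\<in>I. \<Sum>j\<in>J. (cmod (entry (A * S) i j))\<^sup>2) \<le> (norm S * h)\<^sup>2"
    by (simp add: power_mult_distrib)
qed

lemma hs_mult_left_le: "hs h A \<Longrightarrow> norm S \<le> s \<Longrightarrow> hs (s * h) (S * A)"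
  using hs_mono[OF hs_mult_left] hs_nonneg mult_right_mono by metis

lemma hs_mult_right_le: "hs h A \<Longrightarrow> norm S \<le> s \<Longrightarrow> hs (s * h) (A * S)"
  using hs_mono[OF hs_mult_right] hs_nonneg mult_right_mono by metis

text \<open>The columns of the first factor and the rows of the second form a rank-one expansion of
  the product, and Cauchy-Schwarz separates the two norms. The index type itself numbers the terms,
  hence its countability.\<close>

lemma nuc_hs_mult:
  fixes A B :: "'i::countable cop"
  assumes A: "hs a A" and B: "hs b B"
  shows "nuc (a * b) (A * B)"
proof -
  obtain w where w: "\<And>i j. ell2_coord (w i) j = entry B i j"
    "\<And>i x. ell2_coord (capply B x) i = pairing (w i) x"
    using row_vectors[of B] by blast
  show ?thesis unfolding nuc_def
  proof (rule nuclearI[where u = "\<lambda>k. capply A (ell2_basis k)" and w = w])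
    fix F :: "'i set" assume F: "finite F"
    have "(\<Sum>k\<in>F. norm (capply A (ell2_basis k)) * norm (w k))
        \<le> sqrt (\<Sum>k\<in>F. (norm (capply A (ell2_basis k)))\<^sup>2) * sqrt (\<Sum>k\<in>F. (norm (w k))\<^sup>2)"
      using L2_set_mult_ineq[where f = "\<lambda>k. norm (capply A (ell2_basis k))" and g = "\<lambda>k. norm (w k)" and A = F]
      by (simp add: L2_set_def)
    also have "\<dots> \<le> a * b"
      by (intro mult_mono real_le_lsqrt hs_columns[OF A F] hs_rows[OF B F w(1)])
         (use hs_nonneg[OF A] hs_nonneg[OF B] in \<open>auto intro: sum_nonneg\<close>)
    finally show "(\<Sum>k\<in>F. norm (capply A (ell2_basis k)) * norm (w k)) \<le> a * b" .
  next
    fix i j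
    show "((\<lambda>k. ell2_coord (capply A (ell2_basis k)) i * ell2_coord (w k) j) has_sum entry (A * B) i j) UNIV"
      using entry_mult[of A i B j] by (simp add: w(1) entry_def)
  qed
qed

section \<open>Compression along an injection of index sets\<close>

definition ell2_ext :: "('i \<Rightarrow> 'j) \<Rightarrow> 'i ell2 \<Rightarrow> 'j ell2" where
  "ell2_ext \<iota> x = Abs_ell2 (\<lambda>k. if k \<in> range \<iota> then ell2_coord x (inv_into UNIV \<iota> k) else 0)"

definition ell2_res :: "('i \<Rightarrow> 'j) \<Rightarrow> 'j ell2 \<Rightarrow> 'i ell2" where
  "ell2_res \<iota> y = Abs_ell2 (\<lambda>i. ell2_coord y (\<iota> i))"

text \<open>The prototype is the passage from a Laurent operator on all integers to the Toeplitz
  operator with the same symbol.\<close>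

definition pull :: "('i \<Rightarrow> 'j) \<Rightarrow> 'j cop \<Rightarrow> 'i cop" where
  "pull \<iota> A = Abs_cop (Blinfun (\<lambda>x. ell2_res \<iota> (capply A (ell2_ext \<iota> x))))"

locale compression =
  fixes \<iota> :: "'i \<Rightarrow> 'j::countable"
  assumes inj: "inj \<iota>"
begin

lemma ext_sum_le:
  assumes F: "finite F"
  shows "(\<Sum>k\<in>F. (cmod (if k \<in> range \<iota> then ell2_coord x (inv_into UNIV \<iota> k) else 0))\<^sup>2) \<le> (norm x)\<^sup>2"
proof -
  have i: "inj_on (inv_into UNIV \<iota>) (F \<inter> range \<iota>)"
    by (rule inj_onI) (metis IntD2 f_inv_into_f)
  have "(\<Sum>k\<in>F. (cmod (if k \<in> range \<iota> then ell2_coord x (inv_into UNIV \<iota> k) else 0))\<^sup>2)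
      = (\<Sum>k\<in>F \<inter> range \<iota>. (cmod (ell2_coord x (inv_into UNIV \<iota> k)))\<^sup>2)"
    using F by (subst sum.inter_restrict) (auto intro!: sum.cong)
  also have "\<dots> = (\<Sum>i\<in>inv_into UNIV \<iota> ` (F \<inter> range \<iota>). (cmod (ell2_coord x i))\<^sup>2)"
    by (simp add: sum.reindex[OF i])
  also have "\<dots> \<le> (norm x)\<^sup>2" using F by (intro ell2_sum_le_norm_sq) simp
  finally show ?thesis .
qed

lemma res_sum_le:
  assumes F: "finite F"
  shows "(\<Sum>i\<in>F. (cmod (ell2_coord y (\<iota> i)))\<^sup>2) \<le> (norm y)\<^sup>2"
proof -
  have "(\<Sum>i\<in>F. (cmod (ell2_coord y (\<iota> i)))\<^sup>2) = (\<Sum>k\<in>\<iota> ` F. (cmod (ell2_coord y k))\<^sup>2)"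
    using inj by (subst sum.reindex) (auto simp: inj_on_def)
  also have "\<dots> \<le> (norm y)\<^sup>2" using F by (intro ell2_sum_le_norm_sq) simp
  finally show ?thesis .
qed

lemma coord_ext: "ell2_coord (ell2_ext \<iota> x) k = (if k \<in> range \<iota> then ell2_coord x (inv_into UNIV \<iota> k) else 0)"
  unfolding ell2_ext_def by (subst ell2_memI) (rule ext_sum_le, auto)

lemma coord_res: "ell2_coord (ell2_res \<iota> y) i = ell2_coord y (\<iota> i)"
  unfolding ell2_res_def by (subst ell2_memI) (rule res_sum_le, auto)

lemma norm_ext_le: "norm (ell2_ext \<iota> x) \<le> norm x"
  by (rule ell2_norm_leI) (simp_all only: coord_ext ext_sum_le norm_ge_zero)

lemma norm_res_le: "norm (ell2_res \<iota> y) \<le> norm y"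
  by (rule ell2_norm_leI) (simp_all only: coord_res res_sum_le norm_ge_zero)

lemma bounded_linear_ext: "bounded_linear (ell2_ext \<iota>)"
  by (rule bounded_linear_intro[where K = 1]) (auto intro!: ell2_eqI simp: coord_ext norm_ext_le)

lemma bounded_linear_res: "bounded_linear (ell2_res \<iota>)"
  by (rule bounded_linear_intro[where K = 1]) (auto intro!: ell2_eqI simp: coord_res norm_res_le)

lemma capply_pull: "capply (pull \<iota> A) x = ell2_res \<iota> (capply A (ell2_ext \<iota> x))"
proof -
  have e: "ell2_ext \<iota> (cscale c x) = cscale c (ell2_ext \<iota> x)" for c x
    by (rule ell2_eqI) (simp add: coord_ext)
  have r: "ell2_res \<iota> (cscale c x) = cscale c (ell2_res \<iota> x)" for c x
    by (rule ell2_eqI) (simp add: coord_res)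
  show ?thesis
    unfolding pull_def
    by (subst cop_make)
       (auto simp: e r capply_cscale intro!: bounded_linear_compose[OF bounded_linear_res]
          bounded_linear_compose[OF bounded_linear_capply] bounded_linear_ext)
qed

lemma ext_basis: "ell2_ext \<iota> (ell2_basis j) = ell2_basis (\<iota> j)"
  by (rule ell2_eqI) (use inj in \<open>auto simp: coord_ext inv_f_f\<close>)

lemma entry_pull [simp]: "entry (pull \<iota> A) i j = entry A (\<iota> i) (\<iota> j)"
  by (simp add: entry_def capply_pull ext_basis coord_res)

lemma norm_pull_le: "norm (pull \<iota> A) \<le> norm A"
proof (rule norm_cop_leI)
  fix x
  have "norm (capply (pull \<iota> A) x) \<le> norm A * norm (ell2_ext \<iota> x)"
    unfolding capply_pull by (rule order_trans[OF norm_res_le norm_capply_le])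
  also have "\<dots> \<le> norm A * norm x" by (intro mult_left_mono norm_ext_le) auto
  finally show "norm (capply (pull \<iota> A) x) \<le> norm A * norm x" .
qed simp

lemma bounded_linear_pull: "bounded_linear (pull \<iota>)"
  by (rule bounded_linear_intro[where K = 1]) (auto intro!: cop_eqI simp: norm_pull_le)

lemma pull_add: "pull \<iota> (A + B) = pull \<iota> A + pull \<iota> B"
  by (rule cop_eqI) simp

lemma pull_1: "pull \<iota> 1 = 1"
  by (rule cop_eqI) (use inj in \<open>auto simp: inj_eq\<close>)

text \<open>An index outside the range never occurs as an intermediate index. This is the common
  source of \<open>T(f g) = T(f) T(g)\<close> for antianalytic \<open>f\<close> and for analytic
  \<open>g\<close>.\<close>

lemma pull_mult:
  assumes "\<And>i j k. k \<notin> range \<iota> \<Longrightarrow> entry A (\<iota> i) k = 0 \<or> entry B k (\<iota> j) = 0"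
  shows "pull \<iota> (A * B) = pull \<iota> A * pull \<iota> B"
proof (rule cop_eqI)
  fix i j
  have "((\<lambda>k. entry A (\<iota> i) k * entry B k (\<iota> j)) has_sum entry (A * B) (\<iota> i) (\<iota> j)) (range \<iota>)"
    using entry_mult[of A "\<iota> i" B "\<iota> j"]
    by (subst has_sum_cong_neutral[where T = UNIV and g = "\<lambda>k. entry A (\<iota> i) k * entry B k (\<iota> j)"])
       (use assms[of _ i j] in auto)
  then have "((\<lambda>k. entry (pull \<iota> A) i k * entry (pull \<iota> B) k j) has_sum entry (A * B) (\<iota> i) (\<iota> j)) UNIV"
    using inj by (subst (asm) has_sum_reindex) (auto simp: o_def)
  from has_sum_unique[OF this entry_mult]
  show "entry (pull \<iota> (A * B)) i j = entry (pull \<iota> A * pull \<iota> B) i j"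
    unfolding entry_pull[of "A * B"] .
qed

text \<open>The rows of \<open>A\<close> inside the range stay inside, so each power splits off one
  compression of \<open>A\<close> at a time, whatever \<open>B\<close> is; the series is then summed
  termwise. In the application \<open>A\<close> has an antianalytic symbol.\<close>

lemma pull_exp_left:
  assumes "\<And>i k. k \<notin> range \<iota> \<Longrightarrow> entry A (\<iota> i) k = 0"
  shows "pull \<iota> (exp A * B) = exp (pull \<iota> A) * pull \<iota> B"
proof -
  have p: "pull \<iota> (A ^ n * B) = pull \<iota> A ^ n * pull \<iota> B" for n
  proof (induction n)
    case (Suc n)
    have "pull \<iota> (A * (A ^ n * B)) = pull \<iota> A * pull \<iota> (A ^ n * B)"
      by (rule pull_mult) (use assms in auto)
    then show ?case by (simp add: Suc mult.assoc)
  qed simp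
  have "(\<lambda>n. pull \<iota> (A ^ n /\<^sub>R fact n * B)) sums pull \<iota> (exp A * B)"
    by (intro bounded_linear.sums[OF bounded_linear_pull] sums_mult2 exp_sums)
  moreover have "pull \<iota> (A ^ n /\<^sub>R fact n * B) = pull \<iota> A ^ n /\<^sub>R fact n * pull \<iota> B" for n
    using linear_scale[OF bounded_linear.linear[OF bounded_linear_pull]] by (simp add: p)
  ultimately have "(\<lambda>n. pull \<iota> A ^ n /\<^sub>R fact n * pull \<iota> B) sums pull \<iota> (exp A * B)"
    by simp
  then show ?thesis
    using sums_unique2[OF sums_mult2[OF exp_sums[of "pull \<iota> A"], of "pull \<iota> B"]] by simp
qed

lemma pull_exp_right:
  assumes "\<And>k j. k \<notin> range \<iota> \<Longrightarrow> entry A k (\<iota> j) = 0"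
  shows "pull \<iota> (B * exp A) = pull \<iota> B * exp (pull \<iota> A)"
proof -
  have p: "pull \<iota> (B * A ^ n) = pull \<iota> B * pull \<iota> A ^ n" for n
  proof (induction n)
    case (Suc n)
    have "pull \<iota> ((B * A ^ n) * A) = pull \<iota> (B * A ^ n) * pull \<iota> A"
      by (rule pull_mult) (use assms in auto)
    then show ?case by (simp add: Suc mult.assoc power_Suc2 del: power_Suc)
  qed simp
  have "(\<lambda>n. pull \<iota> (B * (A ^ n /\<^sub>R fact n))) sums pull \<iota> (B * exp A)"
    by (intro bounded_linear.sums[OF bounded_linear_pull] sums_mult exp_sums)
  moreover have "pull \<iota> (B * (A ^ n /\<^sub>R fact n)) = pull \<iota> B * (pull \<iota> A ^ n /\<^sub>R fact n)" for n
    using linear_scale[OF bounded_linear.linear[OF bounded_linear_pull]] by (simp add: p)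
  ultimately have "(\<lambda>n. pull \<iota> B * (pull \<iota> A ^ n /\<^sub>R fact n)) sums pull \<iota> (B * exp A)"
    by simp
  then show ?thesis
    using sums_unique2[OF sums_mult[OF exp_sums[of "pull \<iota> A"], of "pull \<iota> B"]] by simp
qed

lemma nuc_pull:
  assumes "nuc c K"
  shows "nuc c (pull \<iota> K)"
proof -
  obtain u w :: "nat \<Rightarrow> 'j ell2" where
    c: "\<And>F. finite F \<Longrightarrow> (\<Sum>k\<in>F. norm (u k) * norm (w k)) \<le> c" and
    M: "\<And>i j. ((\<lambda>k. ell2_coord (u k) i * ell2_coord (w k) j) has_sum entry K i j) UNIV"
    using nuclearE[OF assms[unfolded nuc_def]] by blast
  show ?thesis unfolding nuc_def
  proof (rule nuclearI[where u = "\<lambda>k. ell2_res \<iota> (u k)" and w = "\<lambda>k. ell2_res \<iota> (w k)"])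
    fix F :: "nat set" assume "finite F"
    have "(\<Sum>k\<in>F. norm (ell2_res \<iota> (u k)) * norm (ell2_res \<iota> (w k))) \<le> (\<Sum>k\<in>F. norm (u k) * norm (w k))"
      by (intro sum_mono mult_mono norm_res_le) auto
    also have "\<dots> \<le> c" by (rule c) fact
    finally show "(\<Sum>k\<in>F. norm (ell2_res \<iota> (u k)) * norm (ell2_res \<iota> (w k))) \<le> c" .
  qed (use M in \<open>simp add: coord_res\<close>)
qed

abbreviation P :: "'j cop" where "P \<equiv> proj (range \<iota>)"
abbreviation P' :: "'j cop" where "P' \<equiv> proj (- range \<iota>)"

text \<open>The abstract form of \<open>T(f g) = T(f) T(g) + H(f) H(g~)\<close>: the second term
  collects the paths through the complement of the range.\<close>

lemma pull_split: "pull \<iota> (A * B) = pull \<iota> A * pull \<iota> B + pull \<iota> (A * P' * B)"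
proof -
  have "pull \<iota> ((A * P) * B) = pull \<iota> (A * P) * pull \<iota> B"
    by (rule pull_mult) (simp add: entry_mult_proj)
  moreover have "pull \<iota> (A * P) = pull \<iota> A"
    by (rule cop_eqI) (simp add: entry_mult_proj)
  moreover have "A * B = (A * P) * B + A * P' * B"
    by (simp add: distrib_right[symmetric] distrib_left[symmetric] proj_compl)
  ultimately show ?thesis by (simp add: pull_add)
qed

text \<open>For a Laurent operator the two off-diagonal corners are, up to reindexing, the Hankel
  operators of the symbol and of its reflection.\<close>

definition corners_hs :: "real \<Rightarrow> 'j cop \<Rightarrow> bool" where
  "corners_hs h A \<longleftrightarrow> hs h (P * A * P') \<and> hs h (P' * A * P)"

lemma nuc_pull_corner:
  assumes "hs a (P * A * P')" "hs b (P' * B * P)"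
  shows "nuc (a * b) (pull \<iota> (A * P' * B))"
proof -
  have "nuc (a * b) (pull \<iota> ((P * A * P') * (P' * B * P)))"
    by (intro nuc_pull nuc_hs_mult assms)
  moreover have "pull \<iota> ((P * A * P') * (P' * B * P)) = pull \<iota> (A * P' * B)"
  proof -
    have "(P * A * P') * (P' * B * P) = P * (A * P' * B) * P"
      by (simp add: mult.assoc) (simp add: mult.assoc[symmetric] proj_idem)
    then show ?thesis by (intro cop_eqI) (simp add: entry_mult_proj entry_proj_mult)
  qed
  ultimately show ?thesis by simp
qed

text \<open>The defect of compressing \<open>R ^ n\<close> is governed by the lower corner of
  \<open>R ^ n\<close>. The extra term in each recursion is absorbed by enlarging the base of the
  bound by 1: from \<open>\<rho> + 1\<close> for the power to \<open>\<rho> + 2\<close> for its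
  corner and \<open>\<rho> + 3\<close> for the defect.\<close>

lemma nuc_pull_exp:
  assumes R: "corners_hs h R"
  shows "nuc (h\<^sup>2 * exp (norm R + 3)) (pull \<iota> (exp R) - exp (pull \<iota> R))"
proof -
  define \<rho> where "\<rho> = norm R"
  have \<rho>: "\<rho> \<ge> 0" "norm (P' * R) \<le> \<rho>" "norm (R ^ n * P) \<le> (\<rho> + 1) ^ n" for n
  proof -
    show "\<rho> \<ge> 0" by (simp add: \<rho>_def)
    have "norm (P' * R) \<le> norm P' * norm R" by (rule norm_mult_ineq)
    also have "\<dots> \<le> 1 * norm R" by (intro mult_right_mono norm_proj_le) auto
    finally show "norm (P' * R) \<le> \<rho>" by (simp add: \<rho>_def)
    have "norm (R ^ n * P) \<le> norm (R ^ n) * norm P" by (rule norm_mult_ineq)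
    also have "\<dots> \<le> (\<rho> + 1) ^ n * 1"
      unfolding \<rho>_def by (intro mult_mono norm_proj_le order_trans[OF norm_power_ineq power_mono]) auto
    finally show "norm (R ^ n * P) \<le> (\<rho> + 1) ^ n" by simp
  qed
  have h1: "hs h (P * R * P')" and h2: "hs h (P' * R * P)" using R by (auto simp: corners_hs_def)
  have h0: "h \<ge> 0" by (rule hs_nonneg[OF h1])
  have X: "hs (h * (\<rho> + 2) ^ n) (P' * R ^ n * P)" for n
  proof (induction n)
    case 0
    have "P' * P = 0" by (rule cop_eqI) (auto simp: entry_proj_mult entry_proj)
    then show ?case using h0 hs_mono[OF hs_0] by simp
  next
    case (Suc n)
    have "R * R ^ n = R * (P + P') * R ^ n" by (simp add: proj_compl)
    then have eq: "P' * R ^ Suc n * P = (P' * R * P) * (P * R ^ n * P) + (P' * R) * (P' * R ^ n * P)"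
      by (simp add: algebra_simps) (simp add: mult.assoc[symmetric] proj_idem)
    have n: "norm (P * R ^ n * P) \<le> (\<rho> + 1) ^ n"
    proof -
      have "norm (P * (R ^ n * P)) \<le> norm P * norm (R ^ n * P)" by (rule norm_mult_ineq)
      also have "\<dots> \<le> 1 * (\<rho> + 1) ^ n" by (intro mult_mono norm_proj_le \<rho>) auto
      finally show ?thesis by (simp add: mult.assoc)
    qed
    have "hs ((\<rho> + 1) ^ n * h + \<rho> * (h * (\<rho> + 2) ^ n)) (P' * R ^ Suc n * P)"
      unfolding eq by (intro hs_add hs_mult_right_le[OF h2 n] hs_mult_left_le[OF Suc.IH \<rho>(2)])
    moreover have "(\<rho> + 1) ^ n * h + \<rho> * (h * (\<rho> + 2) ^ n) \<le> h * (\<rho> + 2) ^ Suc n"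
    proof -
      have "(\<rho> + 1) ^ n * h \<le> (\<rho> + 2) ^ n * h"
        using \<rho>(1) h0 by (intro mult_right_mono power_mono) auto
      moreover have "0 \<le> (\<rho> + 2) ^ n * h" using \<rho>(1) h0 by simp
      ultimately show ?thesis by (simp add: algebra_simps)
    qed
    ultimately show ?case by (rule hs_mono)
  qed
  have Y: "nuc (h\<^sup>2 * (\<rho> + 3) ^ n) (pull \<iota> (R ^ n) - pull \<iota> R ^ n)" for n
  proof (induction n)
    case 0
    then show ?case using nuc_mono[OF nuc_0, of "h\<^sup>2"] by (simp add: pull_1)
  next
    case (Suc n)
    have eq: "pull \<iota> (R ^ Suc n) - pull \<iota> R ^ Suc n
        = pull \<iota> R * (pull \<iota> (R ^ n) - pull \<iota> R ^ n) + pull \<iota> (R * P' * R ^ n)"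
      using pull_split[of R "R ^ n"] by (simp add: algebra_simps)
    have n: "norm (pull \<iota> R) \<le> \<rho>" unfolding \<rho>_def by (rule norm_pull_le)
    have "nuc (\<rho> * (h\<^sup>2 * (\<rho> + 3) ^ n) + h * (h * (\<rho> + 2) ^ n)) (pull \<iota> (R ^ Suc n) - pull \<iota> R ^ Suc n)"
      unfolding eq by (intro nuc_add nuc_mult_left_le[OF Suc.IH n] nuc_pull_corner h1 X)
    moreover have "\<rho> * (h\<^sup>2 * (\<rho> + 3) ^ n) + h * (h * (\<rho> + 2) ^ n) \<le> h\<^sup>2 * (\<rho> + 3) ^ Suc n"
    proof -
      have "h\<^sup>2 * (\<rho> + 2) ^ n \<le> h\<^sup>2 * (\<rho> + 3) ^ n"
        using \<rho>(1) by (intro mult_left_mono power_mono) auto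
      moreover have "0 \<le> h\<^sup>2 * (\<rho> + 3) ^ n" using \<rho>(1) by simp
      ultimately show ?thesis by (simp add: algebra_simps power2_eq_square)
    qed
    ultimately show ?case by (rule nuc_mono)
  qed
  let ?t = "\<lambda>n. (pull \<iota> (R ^ n) - pull \<iota> R ^ n) /\<^sub>R fact n"
  have t: "nuc (h\<^sup>2 * ((\<rho> + 3) ^ n / fact n)) (?t n)" for n
    using nuc_scaleR[OF Y[of n], of "inverse (fact n)"] by (simp add: divide_inverse mult_ac)
  have s1: "(\<lambda>n. pull \<iota> (R ^ n) /\<^sub>R fact n) sums pull \<iota> (exp R)"
    using bounded_linear.sums[OF bounded_linear_pull exp_sums[of R]]
      linear_scale[OF bounded_linear.linear[OF bounded_linear_pull]] by simp
  have s: "?t sums (pull \<iota> (exp R) - exp (pull \<iota> R))"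
    unfolding scaleR_diff_right by (rule sums_diff[OF s1 exp_sums])
  have c: "(\<lambda>n. h\<^sup>2 * ((\<rho> + 3) ^ n / fact n)) sums (h\<^sup>2 * exp (\<rho> + 3))"
    by (intro sums_mult exp_real_sums)
  show ?thesis unfolding \<rho>_def[symmetric]
    using nuc_sums[OF t _ s] c by (simp add: sums_iff)
qed

text \<open>The factorization \<open>T(e\<^sup>M e\<^sup>Q e\<^sup>A) = e\<^bsup>T(M)\<^esup> T(e\<^sup>Q) e\<^bsup>T(A)\<^esup>\<close> for an antianalytic \<open>M\<close> and an
  analytic \<open>A\<close> reduces the determinant to two instances of \<open>gdet_exp_product\<close>.\<close>

theorem gdet_wiener_hopf:
  fixes M Q A :: "'j cop"
  assumes M0: "\<And>i k. k \<notin> range \<iota> \<Longrightarrow> entry M (\<iota> i) k = 0"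
    and A0: "\<And>k j. k \<notin> range \<iota> \<Longrightarrow> entry A k (\<iota> j) = 0"
    and hs: "corners_hs m M" "corners_hs q Q" "corners_hs a A"
    and comm: "M * Q = Q * M" "A * Q = Q * A" "M * A = A * M"
  shows "gdet (pull \<iota> (exp (M + Q + A)) * exp (- pull \<iota> (M + Q + A)))
       = gdet (pull \<iota> (exp Q) * exp (- pull \<iota> Q))
         * exp ((cop_trace (pull \<iota> (A * P' * Q)) + cop_trace (pull \<iota> (Q * P' * M))
             + cop_trace (pull \<iota> (A * P' * M))) / 2)"
proof -
  define m' x' a' where "m' = pull \<iota> M" and "x' = pull \<iota> Q" and "a' = pull \<iota> A"
  define y where "y = x' + a'"
  have s': "pull \<iota> (M + Q + A) = m' + y"
    by (simp add: m'_def x'_def a'_def y_def pull_add add.assoc)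
  have "exp (M + Q + A) = exp M * (exp Q * exp A)"
  proof -
    have "exp (M + (Q + A)) = exp M * exp (Q + A)"
      by (rule exp_add_commuting) (simp add: distrib_left distrib_right comm)
    moreover have "exp (Q + A) = exp Q * exp A"
      by (rule exp_add_commuting) (simp add: comm)
    ultimately show ?thesis by (simp add: add.assoc)
  qed
  then have fact: "pull \<iota> (exp (M + Q + A)) = exp m' * (pull \<iota> (exp Q) * exp a')"
    by (simp add: pull_exp_left[OF M0] pull_exp_right[OF A0] m'_def a'_def)
  \<comment> \<open>\<open>Q\<close> and \<open>A\<close> commute before compression, and in the
    order \<open>Q * A\<close> compression is multiplicative. The commutator of the compressions is
    therefore exactly the corner term that arises in the order \<open>A * Q\<close>.\<close>
  have c1: "x' * a' - a' * x' = pull \<iota> (A * P' * Q)"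
  proof -
    have "pull \<iota> (Q * A) = x' * a'"
      unfolding x'_def a'_def by (rule pull_mult) (use A0 in auto)
    then show ?thesis
      using pull_split[of A Q] by (simp add: comm x'_def a'_def)
  qed
  have mul: "pull \<iota> (M * B) = m' * pull \<iota> B" for B
    unfolding m'_def by (rule pull_mult) (use M0 in auto)
  have c2: "m' * (x' + a') - (x' + a') * m' = pull \<iota> (Q * P' * M) + pull \<iota> (A * P' * M)"
    using mul[of Q] mul[of A] pull_split[of Q M] pull_split[of A M]
    by (simp add: comm x'_def a'_def m'_def algebra_simps)
  have n1: "nuc (a * q) (pull \<iota> (A * P' * Q))" and n2: "nuc (q * m) (pull \<iota> (Q * P' * M))"
    and n3: "nuc (a * m) (pull \<iota> (A * P' * M))"
    using hs unfolding corners_hs_def by (auto intro: nuc_pull_corner)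
  have k1: "nuc (a * q) (x' * a' - a' * x')" using n1 by (simp add: c1)
  have k2: "nuc (q * m + a * m) (m' * (x' + a') - (x' + a') * m')"
    unfolding c2 by (rule nuc_add[OF n2 n3])
  note b1 = gdet_exp_product[OF k1, folded y_def] and b2 = gdet_exp_product[OF k2, folded y_def]
  define G where "G = pull \<iota> (exp Q) * exp (- x')"
  have G: "near_one G"
  proof -
    have "G - 1 = (pull \<iota> (exp Q) - exp x') * exp (- x')"
      by (simp add: G_def left_diff_distrib exp_minus_inverse)
    then show ?thesis
      using nuc_mult_right[OF nuc_pull_exp[OF hs(2)], of "exp (- x')"]
      by (auto simp: near_one_def trace_class_def x'_def)
  qed
  have e: "exp (- B) * (exp B * C) = C" "exp B * (exp (- B) * C) = C" for B C :: "'i cop"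
    using exp_minus_inverse[of B] exp_minus_inverse[of "- B"] by (simp_all add: mult.assoc[symmetric])
  have V: "exp m' * exp (- m') = 1" "exp (- m') * exp m' = 1"
    using exp_minus_inverse[of m'] exp_minus_inverse[of "- m'"] by simp_all
  let ?H = "exp x' * exp a' * exp (- y)"
  let ?L = "exp m' * exp y * exp (- (m' + y))"
  \<comment> \<open>Inserting \<open>exp (- x') * exp x'\<close> and
    \<open>exp (- y) * exp y\<close> separates three factors that have determinants; the
    conjugations by \<open>exp m'\<close> do not change them.\<close>
  have "pull \<iota> (exp (M + Q + A)) * exp (- pull \<iota> (M + Q + A))
      = (exp m' * G * exp (- m')) * (exp m' * ?H * exp (- m')) * ?L"
    unfolding fact s' G_def by (simp add: mult.assoc e)
  then have "gdet (pull \<iota> (exp (M + Q + A)) * exp (- pull \<iota> (M + Q + A)))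
      = gdet G * gdet ?H * gdet ?L"
    using gdet_mult[OF near_one_mult[OF near_one_conj[OF G V(1)] near_one_conj[OF b1(1) V(1)]] b2(1)]
      gdet_mult[OF near_one_conj[OF G V(1)] near_one_conj[OF b1(1) V(1)]]
      gdet_conj[OF G V] gdet_conj[OF b1(1) V]
    by simp
  also have "gdet ?H * gdet ?L = exp ((cop_trace (pull \<iota> (A * P' * Q)) + cop_trace (pull \<iota> (Q * P' * M))
             + cop_trace (pull \<iota> (A * P' * M))) / 2)"
    unfolding b1(2) b2(2) c1 c2[folded y_def] cop_trace_add[OF n2 n3]
    by (simp add: exp_add[symmetric] add_divide_distrib add.assoc)
  then have "gdet G * gdet ?H * gdet ?L = gdet G * exp ((cop_trace (pull \<iota> (A * P' * Q)) + cop_trace (pull \<iota> (Q * P' * M))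
             + cop_trace (pull \<iota> (A * P' * M))) / 2)"
    by (simp only: mult.assoc)
  finally show ?thesis by (simp add: G_def x'_def)
qed

end

section \<open>Laurent operators\<close>

lemma op_of_eq: "op_of A = Blinfun (\<lambda>x. Abs_ell2 (\<lambda>i. \<Sum>\<^sub>\<infinity>j. entry A i j * ell2_coord x j))"
proof -
  have "(\<lambda>i. \<Sum>\<^sub>\<infinity>j. entry A i j * ell2_coord x j) = ell2_coord (capply A x)" for x
    by (rule ext) (rule infsumI[OF capply_has_sum])
  then have "(\<lambda>x. Abs_ell2 (\<lambda>i. \<Sum>\<^sub>\<infinity>j. entry A i j * ell2_coord x j)) = blinfun_apply (op_of A)"
    by (simp add: ell2_coord_inverse capply_def fun_eq_iff)
  then show ?thesis by (simp add: blinfun_apply_inverse)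
qed

text \<open>Each \<open>cmod (M i j)\<close> is split into two square roots before Cauchy-Schwarz:
  one half is absorbed by the row bound, the other by the column bound after the sums are
  exchanged.\<close>

lemma schur_test:
  fixes M :: "'i \<Rightarrow> 'i \<Rightarrow> complex"
  assumes row: "\<And>i J. finite J \<Longrightarrow> (\<Sum>j\<in>J. cmod (M i j)) \<le> c"
    and col: "\<And>j I. finite I \<Longrightarrow> (\<Sum>i\<in>I. cmod (M i j)) \<le> c"
  obtains A where "\<And>i j. entry A i j = M i j"
proof -
  have c0: "c \<ge> 0" using row[of "{}"] by simp
  define f where "f = (\<lambda>x i. \<Sum>\<^sub>\<infinity>j. M i j * ell2_coord x j)"
  have summ: "(\<lambda>j. M i j * ell2_coord x j) summable_on UNIV" for x i
  proof (rule abs_summable_summable, rule nonneg_bdd_above_summable_on)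
    show "bdd_above (sum (\<lambda>j. norm (M i j * ell2_coord x j)) ` {F. F \<subseteq> UNIV \<and> finite F})"
    proof (rule bdd_aboveI2)
      fix J :: "'i set" assume "J \<in> {F. F \<subseteq> UNIV \<and> finite F}"
      then have J: "finite J" by simp
      have "(\<Sum>j\<in>J. norm (M i j * ell2_coord x j)) \<le> (\<Sum>j\<in>J. cmod (M i j) * norm x)"
        by (intro sum_mono) (simp add: norm_mult mult_left_mono ell2_coord_le_norm)
      also have "\<dots> \<le> c * norm x"
        unfolding sum_distrib_right[symmetric] by (intro mult_right_mono row J) auto
      finally show "(\<Sum>j\<in>J. norm (M i j * ell2_coord x j)) \<le> c * norm x" .
    qed
  qed simp
  have fin: "(\<Sum>i\<in>I. (cmod (\<Sum>j\<in>J. M i j * ell2_coord x j))\<^sup>2) \<le> (c * norm x)\<^sup>2"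
    if I: "finite I" and J: "finite J" for I J x
  proof -
    have "(cmod (\<Sum>j\<in>J. M i j * ell2_coord x j))\<^sup>2 \<le> c * (\<Sum>j\<in>J. cmod (M i j) * (cmod (ell2_coord x j))\<^sup>2)" for i
    proof -
      have "cmod (\<Sum>j\<in>J. M i j * ell2_coord x j)
          \<le> (\<Sum>j\<in>J. \<bar>sqrt (cmod (M i j))\<bar> * \<bar>sqrt (cmod (M i j)) * cmod (ell2_coord x j)\<bar>)"
        by (rule sum_norm_le) (simp add: norm_mult mult.assoc[symmetric])
      also have "\<dots> \<le> L2_set (\<lambda>j. sqrt (cmod (M i j))) J * L2_set (\<lambda>j. sqrt (cmod (M i j)) * cmod (ell2_coord x j)) J"
        by (rule L2_set_mult_ineq)
      finally have "(cmod (\<Sum>j\<in>J. M i j * ell2_coord x j))\<^sup>2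
          \<le> (L2_set (\<lambda>j. sqrt (cmod (M i j))) J * L2_set (\<lambda>j. sqrt (cmod (M i j)) * cmod (ell2_coord x j)) J)\<^sup>2"
        by (intro power_mono) auto
      also have "\<dots> = (\<Sum>j\<in>J. cmod (M i j)) * (\<Sum>j\<in>J. cmod (M i j) * (cmod (ell2_coord x j))\<^sup>2)"
        by (simp add: L2_set_def power_mult_distrib sum_nonneg)
      also have "\<dots> \<le> c * (\<Sum>j\<in>J. cmod (M i j) * (cmod (ell2_coord x j))\<^sup>2)"
        by (intro mult_right_mono row J) (simp add: sum_nonneg)
      finally show ?thesis .
    qed
    then have "(\<Sum>i\<in>I. (cmod (\<Sum>j\<in>J. M i j * ell2_coord x j))\<^sup>2)
        \<le> (\<Sum>i\<in>I. c * (\<Sum>j\<in>J. cmod (M i j) * (cmod (ell2_coord x j))\<^sup>2))"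
      by (intro sum_mono)
    also have "\<dots> = c * (\<Sum>j\<in>J. (\<Sum>i\<in>I. cmod (M i j)) * (cmod (ell2_coord x j))\<^sup>2)"
      unfolding sum_distrib_left[symmetric] sum_distrib_right by (subst sum.swap) (rule refl)
    also have "\<dots> \<le> c * (\<Sum>j\<in>J. c * (cmod (ell2_coord x j))\<^sup>2)"
      by (intro mult_left_mono sum_mono mult_right_mono col I c0) auto
    also have "\<dots> = c\<^sup>2 * (\<Sum>j\<in>J. (cmod (ell2_coord x j))\<^sup>2)"
      by (simp add: sum_distrib_left power2_eq_square mult.assoc)
    also have "\<dots> \<le> c\<^sup>2 * (norm x)\<^sup>2"
      by (intro mult_left_mono ell2_sum_le_norm_sq J) auto
    finally show ?thesis by (simp add: power_mult_distrib)
  qed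
  have lim: "(\<Sum>i\<in>I. (cmod (f x i))\<^sup>2) \<le> (c * norm x)\<^sup>2" if I: "finite I" for I x
  proof (rule tendsto_upperbound)
    show "((\<lambda>J. \<Sum>i\<in>I. (cmod (\<Sum>j\<in>J. M i j * ell2_coord x j))\<^sup>2) \<longlongrightarrow> (\<Sum>i\<in>I. (cmod (f x i))\<^sup>2)) (finite_subsets_at_top UNIV)"
      using has_sum_infsum[OF summ] unfolding has_sum_def f_def
      by (intro tendsto_sum tendsto_power tendsto_norm) auto
    show "eventually (\<lambda>J. (\<Sum>i\<in>I. (cmod (\<Sum>j\<in>J. M i j * ell2_coord x j))\<^sup>2) \<le> (c * norm x)\<^sup>2) (finite_subsets_at_top UNIV)"
      by (rule eventually_finite_subsets_at_top_weakI) (rule fin[OF I])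
  qed simp
  define g where "g = (\<lambda>x. Abs_ell2 (f x))"
  have cg: "ell2_coord (g x) i = f x i" for x i
    unfolding g_def by (subst ell2_memI[OF lim]) (assumption, rule refl)
  have ng: "norm (g x) \<le> c * norm x" for x
    by (rule ell2_norm_leI) (use lim c0 in \<open>simp_all add: cg\<close>)
  have bl: "bounded_linear g"
  proof (rule bounded_linear_intro[where K = c])
    show "g (x + y) = g x + g y" for x y
      by (rule ell2_eqI) (simp add: cg f_def distrib_left infsum_add[OF summ summ])
    show "g (r *\<^sub>R x) = r *\<^sub>R g x" for r x
      by (rule ell2_eqI) (simp add: cg f_def scaleR_conv_of_real mult.left_commute infsum_cmult_right')
    show "norm (g x) \<le> norm x * c" for x using ng[of x] by (simp add: mult.commute)
  qed
  have cs: "g (cscale z x) = cscale z (g x)" for z x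
    by (rule ell2_eqI) (simp add: cg f_def mult.left_commute infsum_cmult_right')
  have "entry (Abs_cop (Blinfun g)) i j = M i j" for i j
  proof -
    have "entry (Abs_cop (Blinfun g)) i j = f (ell2_basis j) i"
      by (simp add: entry_def cop_make[OF bl cs] cg)
    also have "\<dots> = (\<Sum>\<^sub>\<infinity>k\<in>{j}. M i k)"
      unfolding f_def by (rule infsum_cong_neutral) auto
    finally show ?thesis by simp
  qed
  then show thesis by (rule that)
qed

type_synonym 'n coeffs = "int \<Rightarrow> 'n \<Rightarrow> 'n \<Rightarrow> complex"

definition wiener :: "'n coeffs \<Rightarrow> bool" where
  "wiener f \<longleftrightarrow> (\<forall>r s. (\<lambda>k. cmod (f k r s)) summable_on UNIV)"

text \<open>For \<open>wiener\<close> coefficients \<open>schur_test\<close> provides such an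
  operator, and its entries determine it; for other coefficients the choice is unspecified.\<close>

definition laurent :: "'n coeffs \<Rightarrow> (int \<times> 'n) cop" where
  "laurent f = (SOME A. \<forall>j r k s. entry A (j, r) (k, s) = f (j - k) r s)"

lemma entry_laurent:
  fixes f :: "'n::finite coeffs"
  assumes f: "wiener f"
  shows "entry (laurent f) (j, r) (k, s) = f (j - k) r s"
proof -
  define c where "c = (\<Sum>r\<in>UNIV. \<Sum>s\<in>UNIV. \<Sum>\<^sub>\<infinity>k. cmod (f k r s))"
  have fin: "(\<Sum>k\<in>K. cmod (f (h k) r s)) \<le> (\<Sum>\<^sub>\<infinity>k. cmod (f k r s))" if "finite K" "inj h" for K h r s
  proof -
    have "(\<Sum>k\<in>K. cmod (f (h k) r s)) = (\<Sum>m\<in>h ` K. cmod (f m r s))"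
      using inj_on_subset[OF that(2), of K] by (simp add: sum.reindex)
    also have "\<dots> \<le> (\<Sum>\<^sub>\<infinity>k. cmod (f k r s))"
      using f that by (intro finite_sum_le_infsum) (auto simp: wiener_def)
    finally show ?thesis .
  qed
  have pos: "0 \<le> (\<Sum>\<^sub>\<infinity>k. cmod (f k r s))" for r s by (rule infsum_nonneg) simp
  let ?M = "\<lambda>p q. f (fst p - fst q) (snd p) (snd q)"
  have row: "(\<Sum>q\<in>J. cmod (?M p q)) \<le> c" if J: "finite J" for p J
  proof -
    have "(\<Sum>q\<in>J. cmod (?M p q)) \<le> (\<Sum>q\<in>fst ` J \<times> UNIV. cmod (?M p q))"
      using J by (intro sum_mono2) (auto, force)
    also have "\<dots> = (\<Sum>s\<in>UNIV. \<Sum>k\<in>fst ` J. cmod (f (fst p - k) (snd p) s))"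
      by (subst sum.swap) (simp add: sum.cartesian_product case_prod_beta)
    also have "\<dots> \<le> (\<Sum>s\<in>UNIV. \<Sum>\<^sub>\<infinity>k. cmod (f k (snd p) s))"
      using J by (intro sum_mono fin) (auto simp: inj_def)
    also have "\<dots> \<le> c"
      unfolding c_def by (rule member_le_sum[of "snd p"]) (auto intro: sum_nonneg pos)
    finally show ?thesis .
  qed
  have col: "(\<Sum>p\<in>I. cmod (?M p q)) \<le> c" if I: "finite I" for q I
  proof -
    have "(\<Sum>p\<in>I. cmod (?M p q)) \<le> (\<Sum>p\<in>fst ` I \<times> UNIV. cmod (?M p q))"
      using I by (intro sum_mono2) (auto, force)
    also have "\<dots> = (\<Sum>r\<in>UNIV. \<Sum>j\<in>fst ` I. cmod (f (j - fst q) r (snd q)))"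
      by (subst sum.swap) (simp add: sum.cartesian_product case_prod_beta)
    also have "\<dots> \<le> (\<Sum>r\<in>UNIV. \<Sum>\<^sub>\<infinity>k. cmod (f k r (snd q)))"
      using I by (intro sum_mono fin) (auto simp: inj_def)
    also have "\<dots> \<le> c"
      unfolding c_def by (intro sum_mono member_le_sum[of "snd q"]) (auto intro: pos)
    finally show ?thesis .
  qed
  obtain A where "\<And>p q. entry A p q = ?M p q"
    using schur_test[of ?M c] row col by blast
  then have "\<forall>j r k s. entry A (j, r) (k, s) = f (j - k) r s" by simp
  then have "\<forall>j r k s. entry (laurent f) (j, r) (k, s) = f (j - k) r s"
    unfolding laurent_def by (rule someI)
  then show ?thesis by blast
qed

definition diag_coeffs :: "(int \<Rightarrow> complex) \<Rightarrow> 'n coeffs" where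
  "diag_coeffs b = (\<lambda>k r s. if r = s then b k else 0)"

lemma wiener_diag:
  assumes "(\<lambda>k. cmod (b k)) summable_on UNIV"
  shows "wiener (diag_coeffs b)"
  unfolding wiener_def diag_coeffs_def
proof (intro allI)
  fix r s
  show "(\<lambda>k. cmod (if r = s then b k else 0)) summable_on UNIV"
    using assms by (cases "r = s") simp_all
qed

lemma wiener_add:
  assumes "wiener f" "wiener g"
  shows "wiener (\<lambda>k r s. f k r s + g k r s)"
  unfolding wiener_def
proof (intro allI)
  fix r s
  show "(\<lambda>k. cmod (f k r s + g k r s)) summable_on UNIV"
  proof (rule summable_on_comparison_test)
    show "(\<lambda>k. cmod (f k r s) + cmod (g k r s)) summable_on UNIV"
      using assms by (intro summable_on_add) (auto simp: wiener_def)
  qed (auto simp: norm_triangle_ineq)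
qed

lemma laurent_add:
  fixes f g :: "'n::finite coeffs"
  assumes "wiener f" "wiener g"
  shows "laurent (\<lambda>k r s. f k r s + g k r s) = laurent f + laurent g"
  by (rule cop_eqI)
     (auto simp: entry_laurent[OF wiener_add[OF assms]] entry_laurent[OF assms(1)] entry_laurent[OF assms(2)])

lemma has_sum_pair_neutral:
  assumes "\<And>l t. t \<noteq> s \<Longrightarrow> h (l, t) = 0"
  shows "(h has_sum x) UNIV \<longleftrightarrow> ((\<lambda>l. h (l, s)) has_sum x) UNIV"
proof -
  have "(h has_sum x) UNIV \<longleftrightarrow> (h has_sum x) (range (\<lambda>l. (l, s)))"
    by (rule has_sum_cong_neutral) (use assms in \<open>auto simp: image_iff\<close>)
  also have "\<dots> \<longleftrightarrow> ((\<lambda>l. h (l, s)) has_sum x) UNIV"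
    by (subst has_sum_reindex) (auto simp: inj_on_def o_def)
  finally show ?thesis .
qed

text \<open>A scalar symbol commutes with matrices: both entries are the same convolution, and the
  substitution of \<open>j + k - l\<close> for \<open>l\<close> exchanges its two factors.\<close>

lemma laurent_diag_commute:
  fixes f :: "'n::finite coeffs"
  assumes f: "wiener f" and b: "(\<lambda>k. cmod (b k)) summable_on UNIV"
  shows "laurent (diag_coeffs b) * laurent f = laurent f * laurent (diag_coeffs b)"
proof (rule cop_eqI)
  fix p q :: "int \<times> 'n"
  obtain j r k s where pq: "p = (j, r)" "q = (k, s)" by (cases p, cases q) auto
  have e: "entry (laurent (diag_coeffs b :: 'n coeffs)) (j, r) (k, s) = (if r = s then b (j - k) else 0)" for j r k s
    unfolding entry_laurent[OF wiener_diag[OF b]] by (simp add: diag_coeffs_def)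
  have 1: "((\<lambda>l. b (j - l) * f (l - k) r s) has_sum entry (laurent (diag_coeffs b) * laurent f) p q) UNIV"
    using entry_mult[of "laurent (diag_coeffs b)" p "laurent f" q]
    unfolding pq by (subst (asm) has_sum_pair_neutral[where s = r])
      (auto simp: e entry_laurent[OF f])
  have 2: "((\<lambda>l. f (j - l) r s * b (l - k)) has_sum entry (laurent f * laurent (diag_coeffs b)) p q) UNIV"
    using entry_mult[of "laurent f" p "laurent (diag_coeffs b)" q]
    unfolding pq by (subst (asm) has_sum_pair_neutral[where s = s])
      (auto simp: e entry_laurent[OF f])
  have bij: "bij (\<lambda>l. j + k - l)"
    by (rule bij_betw_byWitness[where f' = "\<lambda>l. j + k - l"]) auto
  have "((\<lambda>l. f (j - (j + k - l)) r s * b ((j + k - l) - k)) has_sum entry (laurent f * laurent (diag_coeffs b)) p q) UNIV"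
    using 2 by (subst has_sum_reindex_bij_betw[OF bij, where f = "\<lambda>l. f (j - l) r s * b (l - k)"])
  then have "((\<lambda>l. b (j - l) * f (l - k) r s) has_sum entry (laurent f * laurent (diag_coeffs b)) p q) UNIV"
    by (simp add: mult.commute)
  then show "entry (laurent (diag_coeffs b) * laurent f) p q = entry (laurent f * laurent (diag_coeffs b)) p q"
    by (rule has_sum_unique[OF 1])
qed

section \<open>Corners of Laurent operators on the half-line\<close>

definition nonneg_emb :: "nat \<times> 'n \<Rightarrow> int \<times> 'n" where
  "nonneg_emb p = (int (fst p), snd p)"

lemma range_nonneg_emb: "range nonneg_emb = {p. fst p \<ge> 0}"
proof (intro equalityI subsetI)
  fix p :: "int \<times> 'n" assume "p \<in> {p. fst p \<ge> 0}"
  then have "p = nonneg_emb (nat (fst p), snd p)" by (simp add: nonneg_emb_def)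
  then show "p \<in> range nonneg_emb" by (rule range_eqI)
qed (auto simp: nonneg_emb_def)

interpretation compr: compression "nonneg_emb :: nat \<times> 'n::finite \<Rightarrow> int \<times> 'n"
  by standard (auto simp: inj_def nonneg_emb_def)

text \<open>A difference \<open>m > 0\<close> occurs exactly \<open>m\<close> times as \<open>j - k\<close> with \<open>j \<ge> 0 > k\<close>, which
  is where the weight \<open>\<bar>k\<bar>\<close> in the norm of the symbol algebra comes from.\<close>

lemma corner_sum_le:
  fixes g :: "int \<Rightarrow> real"
  assumes g: "\<And>m. g m \<ge> 0" "(\<lambda>m. \<bar>of_int m\<bar> * g m) summable_on UNIV" and A: "finite A" and B: "finite B"
  shows "(\<Sum>j\<in>A. \<Sum>k\<in>B. if j \<ge> 0 \<and> k < 0 then g (j - k) else 0) \<le> (\<Sum>\<^sub>\<infinity>m. \<bar>of_int m\<bar> * g m)"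
proof -
  let ?S = "{p \<in> A \<times> B. fst p \<ge> 0 \<and> snd p < 0}"
  let ?D = "(\<lambda>p. fst p - snd p) ` ?S"
  have fin: "finite ?S" using A B by simp
  have "(\<Sum>j\<in>A. \<Sum>k\<in>B. if j \<ge> 0 \<and> k < 0 then g (j - k) else 0) = (\<Sum>p\<in>?S. g (fst p - snd p))"
    using A B by (simp add: sum.cartesian_product case_prod_beta sum.inter_filter)
  also have "\<dots> = (\<Sum>m\<in>?D. \<Sum>p\<in>{p \<in> ?S. fst p - snd p = m}. g (fst p - snd p))"
    by (rule sum.image_gen[OF fin])
  also have "\<dots> = (\<Sum>m\<in>?D. real (card {p \<in> ?S. fst p - snd p = m}) * g m)"
    by (intro sum.cong refl) simp
  also have "\<dots> \<le> (\<Sum>m\<in>?D. \<bar>of_int m\<bar> * g m)"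
  proof (intro sum_mono mult_right_mono g)
    fix m assume "m \<in> ?D"
    then have m: "m > 0" by auto
    have "card {p \<in> ?S. fst p - snd p = m} = card (fst ` {p \<in> ?S. fst p - snd p = m})"
      by (rule card_image[symmetric]) (auto simp: inj_on_def prod_eq_iff)
    also have "\<dots> \<le> card {0..<m}"
      by (rule card_mono) auto
    finally have "card {p \<in> ?S. fst p - snd p = m} \<le> nat m" by simp
    then show "real (card {p \<in> ?S. fst p - snd p = m}) \<le> \<bar>of_int m\<bar>"
      using m by linarith
  qed
  also have "\<dots> \<le> (\<Sum>\<^sub>\<infinity>m. \<bar>of_int m\<bar> * g m)"
    using g fin by (intro finite_sum_le_infsum) auto
  finally show ?thesis .
qed

definition half_smooth :: "'n coeffs \<Rightarrow> bool" where
  "half_smooth f \<longleftrightarrow> (\<forall>r s. (\<lambda>k. \<bar>of_int k\<bar> * (cmod (f k r s))\<^sup>2) summable_on UNIV)"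

text \<open>Finite blocks are enlarged to products with the full set of matrix indices, so that
  \<open>corner_sum_le\<close> can be applied to each pair of matrix indices separately.\<close>

lemma hs_corner:
  fixes f :: "'n::finite coeffs" and A :: "(int \<times> 'n) cop"
  assumes f: "\<And>r s. (\<lambda>k. \<bar>of_int k\<bar> * (cmod (f k r s))\<^sup>2) summable_on UNIV"
    and A: "\<And>j r k s. (cmod (entry A (j, r) (k, s)))\<^sup>2 = (if j \<ge> 0 \<and> k < 0 then (cmod (f (j - k) r s))\<^sup>2 else 0)"
  shows "hs (sqrt (\<Sum>r\<in>UNIV. \<Sum>s\<in>UNIV. \<Sum>\<^sub>\<infinity>k. \<bar>of_int k\<bar> * (cmod (f k r s))\<^sup>2)) A"
  unfolding hs_def
proof (intro conjI allI impI)
  let ?h = "\<Sum>r\<in>UNIV. \<Sum>s\<in>UNIV. \<Sum>\<^sub>\<infinity>k. \<bar>of_int k\<bar> * (cmod (f k r s))\<^sup>2"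
  have pos: "?h \<ge> 0" by (intro sum_nonneg infsum_nonneg) auto
  then show "sqrt ?h \<ge> 0" by simp
  fix I J :: "(int \<times> 'n) set" assume IJ: "finite I" "finite J"
  have "(\<Sum>p\<in>I. \<Sum>q\<in>J. (cmod (entry A p q))\<^sup>2) \<le> (\<Sum>p\<in>fst ` I \<times> UNIV. \<Sum>q\<in>fst ` J \<times> UNIV. (cmod (entry A p q))\<^sup>2)"
  proof -
    have "(\<Sum>p\<in>I. \<Sum>q\<in>J. (cmod (entry A p q))\<^sup>2) \<le> (\<Sum>p\<in>I. \<Sum>q\<in>fst ` J \<times> UNIV. (cmod (entry A p q))\<^sup>2)"
      using IJ by (intro sum_mono sum_mono2) (auto, force)
    also have "\<dots> \<le> (\<Sum>p\<in>fst ` I \<times> UNIV. \<Sum>q\<in>fst ` J \<times> UNIV. (cmod (entry A p q))\<^sup>2)"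
      using IJ by (intro sum_mono2) (auto intro: sum_nonneg, force)
    finally show ?thesis .
  qed
  also have "\<dots> = (\<Sum>j\<in>fst ` I. \<Sum>r\<in>UNIV. \<Sum>k\<in>fst ` J. \<Sum>s\<in>UNIV. (cmod (entry A (j, r) (k, s)))\<^sup>2)"
    by (simp only: sum.cartesian_product')
  also have "\<dots> = (\<Sum>r\<in>UNIV. \<Sum>s\<in>UNIV. \<Sum>j\<in>fst ` I. \<Sum>k\<in>fst ` J. (cmod (entry A (j, r) (k, s)))\<^sup>2)"
  proof -
    have "(\<Sum>j\<in>fst ` I. \<Sum>k\<in>fst ` J. \<Sum>s\<in>UNIV. (cmod (entry A (j, r) (k, s)))\<^sup>2)
        = (\<Sum>s\<in>UNIV. \<Sum>j\<in>fst ` I. \<Sum>k\<in>fst ` J. (cmod (entry A (j, r) (k, s)))\<^sup>2)" for r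
    proof -
      have "(\<Sum>j\<in>fst ` I. \<Sum>k\<in>fst ` J. \<Sum>s\<in>UNIV. (cmod (entry A (j, r) (k, s)))\<^sup>2)
          = (\<Sum>j\<in>fst ` I. \<Sum>s\<in>UNIV. \<Sum>k\<in>fst ` J. (cmod (entry A (j, r) (k, s)))\<^sup>2)"
        by (rule sum.cong[OF refl sum.swap])
      also have "\<dots> = (\<Sum>s\<in>UNIV. \<Sum>j\<in>fst ` I. \<Sum>k\<in>fst ` J. (cmod (entry A (j, r) (k, s)))\<^sup>2)"
        by (rule sum.swap)
      finally show ?thesis .
    qed
    then show ?thesis by (subst sum.swap) simp
  qed
  also have "\<dots> \<le> ?h"
    unfolding A by (intro sum_mono corner_sum_le[OF _ f]) (use IJ in auto)
  finally show "(\<Sum>p\<in>I. \<Sum>q\<in>J. (cmod (entry A p q))\<^sup>2) \<le> (sqrt ?h)\<^sup>2"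
    using pos by simp
qed

lemma hs_transpose:
  assumes "hs h A" "\<And>i j. cmod (entry B i j) = cmod (entry A j i)"
  shows "hs h B"
  unfolding hs_def assms(2)
proof (intro conjI allI impI hs_nonneg[OF assms(1)])
  fix I J :: "'a set" assume "finite I" "finite J"
  then show "(\<Sum>i\<in>I. \<Sum>j\<in>J. (cmod (entry A j i))\<^sup>2) \<le> h\<^sup>2"
    by (subst sum.swap) (rule hsD[OF assms(1)])
qed

text \<open>Transposition exchanges the two corners, so the estimate for the lower one follows from
  that for the upper one with reflected frequencies and swapped matrix indices.\<close>

lemma cop_transpose:
  obtains B where "\<And>i j. entry B i j = entry A j i"
proof -
  define f where "f = (\<lambda>x. Abs_ell2 (\<lambda>j. pairing x (capply A (ell2_basis j))))"
  have ex: "\<exists>v. (\<forall>j. ell2_coord v j = pairing x (capply A (ell2_basis j))) \<and> norm v \<le> norm x * norm A" for x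
    using transpose_vector[of x A] by (metis pairing_basis)
  have f: "ell2_coord (f x) j = pairing x (capply A (ell2_basis j))" "norm (f x) \<le> norm x * norm A" for x j
  proof -
    obtain v where v: "\<And>j. ell2_coord v j = pairing x (capply A (ell2_basis j))" "norm v \<le> norm x * norm A"
      using ex[of x] by blast
    have "f x = v" unfolding f_def by (simp add: v(1)[symmetric] ell2_coord_inverse)
    then show "ell2_coord (f x) j = pairing x (capply A (ell2_basis j))" "norm (f x) \<le> norm x * norm A"
      using v by auto
  qed
  note lin = bounded_linear.linear[OF bounded_linear_pairing]
  have bl: "bounded_linear f"
    by (rule bounded_linear_intro[where K = "norm A"])
       (auto intro!: ell2_eqI simp: f pairing_commute[where x = "capply A _"] linear_add[OF lin] linear_scale[OF lin])
  have cs: "f (cscale c x) = cscale c (f x)" for c x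
    by (rule ell2_eqI) (simp add: f pairing_commute[where x = "capply A _"])
  have "entry (Abs_cop (Blinfun f)) i j = entry A j i" for i j
    by (simp add: entry_def cop_make[OF bl cs] f pairing_commute[where x = "capply A _"])
  then show thesis by (rule that)
qed

lemma corners_laurent:
  fixes f :: "'n::finite coeffs"
  assumes f: "wiener f" "half_smooth f"
  obtains h where "compr.corners_hs h (laurent f)"
proof -
  let ?L = "laurent f"
  have mem: "(j, r) \<in> range nonneg_emb \<longleftrightarrow> j \<ge> 0" for j and r :: 'n
    by (simp add: range_nonneg_emb)
  have c1: "entry (compr.P * ?L * compr.P') (j, r) (k, s) = (if j \<ge> 0 \<and> k < 0 then f (j - k) r s else 0)"
    and c2: "entry (compr.P' * ?L * compr.P) (j, r) (k, s) = (if j < 0 \<and> k \<ge> 0 then f (j - k) r s else 0)"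
    for j r k s
    by (auto simp: entry_mult_proj entry_proj_mult mem entry_laurent[OF f(1)])
  have "hs (sqrt (\<Sum>r\<in>UNIV. \<Sum>s\<in>UNIV. \<Sum>\<^sub>\<infinity>k. \<bar>of_int k\<bar> * (cmod (f k r s))\<^sup>2)) (compr.P * ?L * compr.P')"
    by (rule hs_corner) (use f(2) in \<open>auto simp: half_smooth_def c1\<close>)
  then obtain h1 where h1: "hs h1 (compr.P * ?L * compr.P')" by blast
  obtain B where B: "\<And>i j. entry B i j = entry (compr.P' * ?L * compr.P) j i"
    using cop_transpose by blast
  have "(\<lambda>k. \<bar>of_int k\<bar> * (cmod (f (- k) s r))\<^sup>2) summable_on UNIV" for r s
  proof -
    have "((\<lambda>k. \<bar>of_int k\<bar> * (cmod (f k s r))\<^sup>2) \<circ> uminus) summable_on UNIV"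
      using f(2) by (subst summable_on_reindex[symmetric]) (auto simp: half_smooth_def)
    then show ?thesis by (simp add: o_def)
  qed
  then have "hs (sqrt (\<Sum>r\<in>UNIV. \<Sum>s\<in>UNIV. \<Sum>\<^sub>\<infinity>k. \<bar>of_int k\<bar> * (cmod (f (- k) s r))\<^sup>2)) B"
    by (rule hs_corner[where f = "\<lambda>k r s. f (- k) s r"]) (auto simp: B c2)
  then obtain h2 where "hs h2 B" by blast
  then have "hs h2 (compr.P' * ?L * compr.P)"
    by (rule hs_transpose) (simp add: B)
  then have "compr.corners_hs (max h1 h2) ?L"
    unfolding compr.corners_hs_def using h1 by (auto intro: hs_mono)
  then show thesis by (rule that)
qed

lemma entry_pull_corner:
  fixes f g :: "'n::finite coeffs"
  assumes f: "wiener f" and g: "wiener g"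
  shows "((\<lambda>p. if fst p < 0 then f (int j - fst p) r (snd p) * g (fst p - int k) (snd p) s else 0)
    has_sum entry (pull nonneg_emb (laurent f * compr.P' * laurent g)) (j, r) (k, s)) UNIV"
proof -
  have mem: "p \<in> range nonneg_emb \<longleftrightarrow> fst p \<ge> 0" for p :: "int \<times> 'n"
    by (simp add: range_nonneg_emb)
  have "((\<lambda>p. entry (laurent f * compr.P') (int j, r) p * entry (laurent g) p (int k, s))
    has_sum entry (pull nonneg_emb (laurent f * compr.P' * laurent g)) (j, r) (k, s)) UNIV"
    using entry_mult[of "laurent f * compr.P'" "(int j, r)" "laurent g" "(int k, s)"]
    by (simp add: nonneg_emb_def)
  moreover have "(\<lambda>p. entry (laurent f * compr.P') (int j, r) p * entry (laurent g) p (int k, s))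
    = (\<lambda>p. if fst p < 0 then f (int j - fst p) r (snd p) * g (fst p - int k) (snd p) s else 0)"
    by (auto simp: fun_eq_iff entry_mult_proj mem entry_laurent[OF f] entry_laurent[OF g])
  ultimately show ?thesis by simp
qed

lemma cop_trace_pairs:
  fixes K :: "(nat \<times> 'n::finite) cop"
  assumes "nuc c K"
  shows "cop_trace K = (\<Sum>\<^sub>\<infinity>j. \<Sum>r\<in>UNIV. entry K (j, r) (j, r))"
proof -
  have "(\<lambda>p. entry K p p) summable_on UNIV"
    by (rule abs_summable_summable[OF nuclear_summable_diag(1)[OF assms[unfolded nuc_def]]])
  then have "(\<lambda>(j, r). entry K (j, r) (j, r)) summable_on UNIV \<times> UNIV"
    by (simp add: case_prod_unfold)
  from infsum_Sigma'_banach[OF this] show ?thesis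
    by (simp add: cop_trace_def case_prod_unfold)
qed

section \<open>Fourier series\<close>

text \<open>The Weierstrass test makes the net of finite partial sums converge uniformly, which
  allows sum and integral to be exchanged over any index set.\<close>

lemma integral_has_sum:
  fixes f :: "'i \<Rightarrow> real \<Rightarrow> complex"
  assumes cont: "\<And>i. continuous_on {a..b} (f i)"
    and bound: "\<And>i x. x \<in> {a..b} \<Longrightarrow> norm (f i x) \<le> M i" and M: "M summable_on UNIV"
  shows "((\<lambda>i. integral {a..b} (f i)) has_sum integral {a..b} (\<lambda>x. \<Sum>\<^sub>\<infinity>i. f i x)) UNIV"
    and "continuous_on {a..b} (\<lambda>x. \<Sum>\<^sub>\<infinity>i. f i x)"
proof -
  have u: "uniform_limit {a..b} (\<lambda>X x. \<Sum>i\<in>X. f i x) (\<lambda>x. \<Sum>\<^sub>\<infinity>i. f i x) (finite_subsets_at_top UNIV)"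
    by (rule Weierstrass_m_test_general[OF bound M])
  have c: "continuous_on {a..b} (\<lambda>x. \<Sum>i\<in>X. f i x)" for X
    by (intro continuous_on_sum cont)
  obtain I J where IJ: "\<And>X. ((\<lambda>x. \<Sum>i\<in>X. f i x) has_integral I X) {a..b}"
    "((\<lambda>x. \<Sum>\<^sub>\<infinity>i. f i x) has_integral J) {a..b}" "(I \<longlongrightarrow> J) (finite_subsets_at_top UNIV)"
    using uniform_limit_integral[OF u c finite_subsets_at_top_neq_bot] by blast
  have "eventually (\<lambda>X. I X = (\<Sum>i\<in>X. integral {a..b} (f i))) (finite_subsets_at_top UNIV)"
  proof (rule eventually_finite_subsets_at_top_weakI)
    fix X :: "'i set" assume "finite X"
    then have "integral {a..b} (\<lambda>x. \<Sum>i\<in>X. f i x) = (\<Sum>i\<in>X. integral {a..b} (f i))"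
      by (intro integral_sum integrable_continuous_real cont) auto
    then show "I X = (\<Sum>i\<in>X. integral {a..b} (f i))"
      using integral_unique[OF IJ(1)[of X]] by simp
  qed
  then have "((\<lambda>X. \<Sum>i\<in>X. integral {a..b} (f i)) \<longlongrightarrow> J) (finite_subsets_at_top UNIV)"
    by (rule Lim_transform_eventually[OF IJ(3)])
  then show "((\<lambda>i. integral {a..b} (f i)) has_sum integral {a..b} (\<lambda>x. \<Sum>\<^sub>\<infinity>i. f i x)) UNIV"
    unfolding has_sum_def integral_unique[OF IJ(2)] .
  show "continuous_on {a..b} (\<lambda>x. \<Sum>\<^sub>\<infinity>i. f i x)"
    by (rule uniform_limit_theorem[OF _ u]) (auto intro: always_eventually c)
qed

section \<open>Uniqueness of the Fourier coefficients of integrable functions\<close>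

lemma continuous_cis [continuous_intros]:
  "continuous_on S f \<Longrightarrow> continuous_on S (\<lambda>x. cis (f x))"
  unfolding cis_conv_exp by (intro continuous_intros)

inductive trig_poly :: "(real \<Rightarrow> complex) \<Rightarrow> bool" where
  monom: "trig_poly (\<lambda>x. c * cis (of_int k * x))"
| add: "trig_poly f \<Longrightarrow> trig_poly g \<Longrightarrow> trig_poly (\<lambda>x. f x + g x)"

lemma trig_poly_mult_monom: "trig_poly f \<Longrightarrow> trig_poly (\<lambda>x. f x * (c * cis (of_int k * x)))"
proof (induction rule: trig_poly.induct)
  case (monom d m)
  have "(\<lambda>x. (d * cis (of_int m * x)) * (c * cis (of_int k * x))) = (\<lambda>x. (d * c) * cis (of_int (m + k) * x))"
    by (auto simp: cis_mult[symmetric] algebra_simps)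
  then show ?case by (metis trig_poly.monom)
next
  case (add f g)
  then show ?case using trig_poly.add by (simp add: distrib_right)
qed

lemma trig_poly_mult: "trig_poly g \<Longrightarrow> trig_poly f \<Longrightarrow> trig_poly (\<lambda>x. f x * g x)"
proof (induction rule: trig_poly.induct)
  case (monom c k)
  then show ?case by (rule trig_poly_mult_monom)
next
  case (add g h)
  then show ?case using trig_poly.add by (simp add: distrib_left)
qed

lemma continuous_trig_poly: "trig_poly f \<Longrightarrow> continuous_on S f"
  by (induction rule: trig_poly.induct) (intro continuous_intros; assumption?)+

text \<open>Linear functionals of \<open>cis x\<close> are combinations of frequencies 1 and -1.
  This connects the Stone-Weierstrass theorem on the circle with the vanishing of Fourier
  coefficients.\<close>

lemma trig_poly_real_polynomial:
  assumes "real_polynomial_function p"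
  shows "trig_poly (\<lambda>x. complex_of_real (p (cis x)))"
  using assms
proof induction
  case (linear f)
  have f: "f (cis x) = cos x * f 1 + sin x * f \<i>" for x
  proof -
    have "cis x = cos x *\<^sub>R 1 + sin x *\<^sub>R \<i>" by (simp add: complex_eq_iff)
    then show ?thesis
      using linear_add[OF bounded_linear.linear[OF linear]] linear_scale[OF bounded_linear.linear[OF linear]] by simp
  qed
  have "complex_of_real (f (cis x)) = (f 1 / 2 - \<i> * f \<i> / 2) * cis (of_int 1 * x) + (f 1 / 2 + \<i> * f \<i> / 2) * cis (of_int (- 1) * x)" for x
    by (simp add: f complex_eq_iff field_simps)
  then have eq: "(\<lambda>x. complex_of_real (f (cis x))) = (\<lambda>x. (f 1 / 2 - \<i> * f \<i> / 2) * cis (of_int 1 * x) + (f 1 / 2 + \<i> * f \<i> / 2) * cis (of_int (- 1) * x))"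
    by (rule ext)
  show ?case unfolding eq by (rule trig_poly.add[OF trig_poly.monom trig_poly.monom])
next
  case (const c)
  show ?case using trig_poly.monom[of "complex_of_real c" 0] by simp
next
  case (add f g)
  then show ?case using trig_poly.add by simp
next
  case (mult f g)
  then show ?case using trig_poly_mult by simp
qed

text \<open>Trigonometric polynomials are dense in the continuous functions on the circle, so \<open>h\<close> is
  orthogonal to these, hence to all bounded continuous functions on the line (tapered off at the point
  \<open>1\<close> of the circle), and finally to a limit of functions close to the conjugate of \<open>h / (1 + \<bar>h\<bar>)\<close>.\<close>

lemma fourier_unique:
  fixes h :: "real \<Rightarrow> complex"
  assumes abs: "h absolutely_integrable_on {0..2*pi}"
    and zero: "\<And>k::int. integral {0..2*pi} (\<lambda>x. h x * cis (- (of_int k * x))) = 0"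
  shows "negligible {x \<in> {0..2*pi}. h x \<noteq> 0}"
proof -
  define S where "S = {0..2*pi}"
  have S: "S \<in> sets lebesgue" "compact S" by (auto simp: S_def)
  let ?M = "lebesgue_on S"
  have h: "integrable ?M h"
    using absolutely_integrable_imp_integrable[OF abs] S by (simp add: S_def)
  have hm[measurable]: "h \<in> borel_measurable ?M" using h by simp
  have cm: "g \<in> borel_measurable ?M" if "continuous_on S g" for g :: "real \<Rightarrow> complex"
    by (rule continuous_imp_measurable_on_sets_lebesgue[OF that S(1)])
  have int: "integrable ?M (\<lambda>x. h x * g x)" if g: "continuous_on S g" for g
  proof -
    obtain B where B: "\<And>x. x \<in> S \<Longrightarrow> norm (g x) \<le> B"
      using compact_imp_bounded[OF compact_continuous_image[OF g S(2)]] unfolding bounded_iff by auto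
    show ?thesis
    proof (rule Bochner_Integration.integrable_bound)
      show "integrable ?M (\<lambda>x. B * norm (h x))" using h by simp
      show "(\<lambda>x. h x * g x) \<in> borel_measurable ?M" using cm[OF g] by measurable
      show "AE x in ?M. norm (h x * g x) \<le> norm (B * norm (h x))"
      proof (rule AE_I2)
        fix x assume "x \<in> space ?M"
        then have "x \<in> S" by (simp add: space_restrict_space)
        then have "norm (g x) * norm (h x) \<le> B * norm (h x)" by (intro mult_right_mono B) auto
        then show "norm (h x * g x) \<le> norm (B * norm (h x))" by (simp add: norm_mult mult.commute)
      qed
    qed
  qed
  have trig: "(LINT x|?M. h x * g x) = 0" if "trig_poly g" for g
    using that
  proof induction
    case (monom c k)
    have "(LINT x|?M. h x * (c * cis (of_int k * x))) = c * (LINT x|?M. h x * cis (of_int k * x))"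
      by (simp add: mult.left_commute)
    also have "(LINT x|?M. h x * cis (of_int k * x)) = integral S (\<lambda>x. h x * cis (of_int k * x))"
      by (rule lebesgue_integral_eq_integral[OF int S(1)]) (intro continuous_intros)
    also have "\<dots> = 0" using zero[of "- k"] by (simp add: S_def)
    finally show ?case by simp
  next
    case (add f g)
    then show ?case
      using int[OF continuous_trig_poly[OF add.hyps(1)]] int[OF continuous_trig_poly[OF add.hyps(2)]]
      by (simp add: distrib_left)
  qed
  \<comment> \<open>Real test functions come first because the approximation is by real polynomials;
    \<open>sphc\<close> then recombines real and imaginary parts.\<close>
  have sph: "(LINT x|?M. h x * of_real (G (cis x))) = 0" if G: "continuous_on (sphere 0 1) G" for G :: "complex \<Rightarrow> real"
  proof -
    let ?I = "LINT x|?M. norm (h x)"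
    have Gc: "continuous_on S (\<lambda>x. G (cis x))"
      by (rule continuous_on_compose2[OF G]) (auto intro!: continuous_intros)
    have le: "norm (LINT x|?M. h x * of_real (G (cis x))) \<le> e * ?I" if e: "e > 0" for e
    proof -
      obtain p where p: "real_polynomial_function p" "\<And>z. z \<in> sphere 0 1 \<Longrightarrow> \<bar>G z - p z\<bar> < e"
        using Stone_Weierstrass_real_polynomial_function[OF compact_sphere G e] by metis
      note tp = trig_poly_real_polynomial[OF p(1)]
      have i1: "integrable ?M (\<lambda>x. h x * of_real (G (cis x)))"
        by (intro int continuous_intros Gc)
      have i2: "integrable ?M (\<lambda>x. h x * of_real (p (cis x)))"
        by (rule int[OF continuous_trig_poly[OF tp]])
      have "(LINT x|?M. h x * of_real (G (cis x))) = (LINT x|?M. h x * of_real (G (cis x)) - h x * of_real (p (cis x)))"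
        using trig[OF tp] by (simp add: Bochner_Integration.integral_diff[OF i1 i2])
      also have "norm \<dots> \<le> (LINT x|?M. norm (h x * of_real (G (cis x)) - h x * of_real (p (cis x))))"
        by (rule integral_norm_bound)
      also have "\<dots> \<le> (LINT x|?M. e * norm (h x))"
      proof (rule integral_mono)
        show "integrable ?M (\<lambda>x. norm (h x * of_real (G (cis x)) - h x * of_real (p (cis x))))"
          using i1 i2 by simp
        show "integrable ?M (\<lambda>x. e * norm (h x))" using h by simp
        fix x
        have "norm (h x * of_real (G (cis x)) - h x * of_real (p (cis x))) = norm (h x) * \<bar>G (cis x) - p (cis x)\<bar>"
          by (simp add: right_diff_distrib[symmetric] norm_mult flip: of_real_diff)
        also have "\<dots> \<le> norm (h x) * e"
          by (intro mult_left_mono[OF less_imp_le[OF p(2)] norm_ge_zero]) simp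
        finally show "norm (h x * of_real (G (cis x)) - h x * of_real (p (cis x))) \<le> e * norm (h x)"
          by (simp add: mult.commute)
      qed
      finally show ?thesis by simp
    qed
    have I0: "?I \<ge> 0" by simp
    then have Ip: "?I + 1 > 0" by linarith
    have "norm (LINT x|?M. h x * of_real (G (cis x))) \<le> 0"
    proof (rule field_le_epsilon)
      fix e :: real assume e: "e > 0"
      have "norm (LINT x|?M. h x * of_real (G (cis x))) \<le> e / (?I + 1) * ?I"
        using e Ip by (intro le divide_pos_pos)
      also have "\<dots> = e * (?I / (?I + 1))" by simp
      also have "\<dots> \<le> e * 1"
        by (rule mult_left_mono[OF _ less_imp_le[OF e]]) (subst divide_le_eq_1_pos[OF Ip], linarith)
      finally show "norm (LINT x|?M. h x * of_real (G (cis x))) \<le> 0 + e" by simp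
    qed
    then show ?thesis by simp
  qed
  have sphc: "(LINT x|?M. h x * G (cis x)) = 0" if G: "continuous_on (sphere 0 1) G" for G :: "complex \<Rightarrow> complex"
  proof -
    have Gc: "continuous_on S (\<lambda>x. G (cis x))"
      by (rule continuous_on_compose2[OF G]) (auto intro!: continuous_intros)
    have c: "continuous_on S (\<lambda>x. complex_of_real (Re (G (cis x))))" "continuous_on S (\<lambda>x. \<i> * complex_of_real (Im (G (cis x))))"
      by (intro continuous_intros Gc)+
    have "h x * G (cis x) = h x * of_real (Re (G (cis x))) + h x * (\<i> * of_real (Im (G (cis x))))" for x
      by (metis complex_eq distrib_left)
    then have "(LINT x|?M. h x * G (cis x)) = (LINT x|?M. h x * of_real (Re (G (cis x)))) + (LINT x|?M. h x * (\<i> * of_real (Im (G (cis x)))))"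
      using Bochner_Integration.integral_add[OF int[OF c(1)] int[OF c(2)]] by simp
    also have "(LINT x|?M. h x * (\<i> * of_real (Im (G (cis x))))) = \<i> * (LINT x|?M. h x * of_real (Im (G (cis x))))"
      by (simp add: mult.left_commute)
    finally show ?thesis
      using sph[of "\<lambda>z. Re (G z)"] sph[of "\<lambda>z. Im (G z)"] G by (simp add: continuous_intros)
  qed
  have AE2: "AE x in ?M. x \<noteq> 0 \<and> x \<noteq> 2 * pi"
  proof -
    have "{0, 2 * pi} \<in> null_sets lebesgue"
      by (intro finite_imp_null_set_lborel[THEN null_sets_completionI]) simp
    then have "AE x in lebesgue. x \<notin> {0, 2 * pi}" by (rule AE_not_in)
    then show ?thesis using S by (subst AE_restrict_space_iff) (auto elim: eventually_mono)
  qed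
  have bdd: "(LINT x|?M. h x * \<psi> x) = 0" if \<psi>: "continuous_on UNIV \<psi>" "\<And>x. norm (\<psi> x) \<le> 1" for \<psi>
  proof -
    \<comment> \<open>The cutoff vanishes at \<open>t = 1\<close>, the real part of the point 1, and
      for every other point of the circle it equals 1 once \<open>n\<close> is large. It suppresses
      the jump of \<open>Arg2pi\<close> at 1, so \<open>\<psi>\<close> may take different values at
      0 and \<open>2 * pi\<close>.\<close>
    define \<kappa> where "\<kappa> = (\<lambda>n t. min 1 (real n * (1 - t)))"
    define G where "G = (\<lambda>n z. \<psi> (Arg2pi z) * complex_of_real (\<kappa> n (Re z)))"
    have \<kappa>: "\<bar>\<kappa> n (cos x)\<bar> \<le> 1" for n x
    proof -
      have "0 \<le> real n * (1 - cos x)" by (intro mult_nonneg_nonneg) auto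
      then show ?thesis by (simp add: \<kappa>_def)
    qed
    have G: "continuous_on (sphere 0 1) (G n)" for n
      unfolding continuous_on_eq_continuous_within
    proof
      fix z :: complex assume z: "z \<in> sphere 0 1"
      show "continuous (at z within sphere 0 1) (G n)"
      proof (cases "z = 1")
        case False
        have "z \<notin> \<real>\<^sub>\<ge>\<^sub>0"
        proof
          assume "z \<in> \<real>\<^sub>\<ge>\<^sub>0"
          then obtain r where "z = of_real r" "r \<ge> 0" by (auto simp: nonneg_Reals_def)
          then show False using z False by simp
        qed
        then have "isCont Arg2pi z" using continuous_at_Arg2pi by blast
        moreover have "isCont \<psi> (Arg2pi z)" using \<psi>(1) by (simp add: continuous_on_eq_continuous_at)
        ultimately have "isCont (\<lambda>z. \<psi> (Arg2pi z)) z" by (rule isCont_o2)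
        moreover have "isCont (\<lambda>z. complex_of_real (\<kappa> n (Re z))) z"
          unfolding \<kappa>_def by (intro continuous_intros linear_continuous_at[OF bounded_linear_Re])
        ultimately have "isCont (G n) z" unfolding G_def by (rule isCont_mult)
        then show ?thesis by (rule continuous_at_imp_continuous_within)
      next
        case True
        have "(G n \<longlongrightarrow> 0) (at z within sphere 0 1)"
        proof (rule Lim_null_comparison)
          have "((\<lambda>w. \<bar>\<kappa> n (Re w)\<bar>) \<longlongrightarrow> \<bar>\<kappa> n (Re z)\<bar>) (at z within sphere 0 1)"
            unfolding \<kappa>_def by (intro tendsto_intros)
          then show "((\<lambda>w. \<bar>\<kappa> n (Re w)\<bar>) \<longlongrightarrow> 0) (at z within sphere 0 1)"
            using True by (simp add: \<kappa>_def)
          show "eventually (\<lambda>w. norm (G n w) \<le> \<bar>\<kappa> n (Re w)\<bar>) (at z within sphere 0 1)"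
            using mult_right_mono[OF \<psi>(2) abs_ge_zero]
            by (intro always_eventually allI) (simp add: G_def norm_mult)
        qed
        moreover have "G n z = 0" using True by (simp add: G_def \<kappa>_def)
        ultimately show ?thesis by (simp add: continuous_within)
      qed
    qed
    have Gx: "G n (cis x) = \<psi> x * of_real (\<kappa> n (cos x))" if x: "x \<in> S" for n x
    proof (cases "x = 2 * pi")
      case True
      then show ?thesis by (simp add: G_def \<kappa>_def)
    next
      case False
      then have "Arg2pi (cis x) = x"
        using x by (intro Arg2pi_unique[of 1]) (auto simp: S_def cis_conv_exp)
      then show ?thesis by (simp add: G_def)
    qed
    have "(\<lambda>n. LINT x|?M. h x * G n (cis x)) \<longlonglongrightarrow> (LINT x|?M. h x * \<psi> x)"
    proof (rule integral_dominated_convergence)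
      show "(\<lambda>x. h x * \<psi> x) \<in> borel_measurable ?M"
        using cm[OF continuous_on_subset[OF \<psi>(1) subset_UNIV]] by measurable
      show "(\<lambda>x. h x * G n (cis x)) \<in> borel_measurable ?M" for n
        by (intro borel_measurable_integrable int continuous_on_compose2[OF G]) (auto intro!: continuous_intros)
      show "integrable ?M (\<lambda>x. norm (h x))" using h by simp
      show "AE x in ?M. norm (h x * G n (cis x)) \<le> norm (h x)" for n
      proof (rule AE_I2)
        fix x assume "x \<in> space ?M"
        then have x: "x \<in> S" by (simp add: space_restrict_space)
        have "norm (h x) * (norm (\<psi> x) * \<bar>\<kappa> n (cos x)\<bar>) \<le> norm (h x) * (1 * 1)"
          by (intro mult_left_mono mult_mono \<psi> \<kappa>) auto
        then show "norm (h x * G n (cis x)) \<le> norm (h x)"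
          by (simp add: Gx[OF x] norm_mult)
      qed
      show "AE x in ?M. (\<lambda>n. h x * G n (cis x)) \<longlonglongrightarrow> h x * \<psi> x"
        using AE2 AE_space
      proof eventually_elim
        case (elim x)
        then have x: "x \<in> S" "0 < x" "x < 2 * pi" by (auto simp: space_restrict_space S_def)
        have "cos x \<noteq> 1"
        proof
          assume "cos x = 1"
          then obtain n :: int where "x = of_int n * 2 * pi" by (auto simp: cos_one_2pi_int)
          then have "0 < real_of_int n" "real_of_int n < 1"
            using x by (simp_all add: zero_less_mult_iff)
          then show False by simp
        qed
        then have pos: "1 - cos x > 0" using cos_le_one[of x] by linarith
        obtain n0 :: nat where n0: "1 < real n0 * (1 - cos x)"
          using reals_Archimedean3[OF pos] by auto
        have "eventually (\<lambda>n. h x * \<psi> x = h x * G n (cis x)) sequentially"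
        proof (rule eventually_sequentiallyI[of n0])
          fix n assume "n0 \<le> n"
          then have "real n0 * (1 - cos x) \<le> real n * (1 - cos x)"
            using pos by (intro mult_right_mono) auto
          then have "\<kappa> n (cos x) = 1" using n0 by (simp add: \<kappa>_def)
          then show "h x * \<psi> x = h x * G n (cis x)" by (simp add: Gx[OF x(1)])
        qed
        then show ?case by (rule Lim_transform_eventually[OF tendsto_const])
      qed
    qed
    moreover have "(LINT x|?M. h x * G n (cis x)) = 0" for n by (rule sphc[OF G])
    ultimately show ?thesis by (simp add: LIMSEQ_const_iff)
  qed
  \<comment> \<open>Measurability in this form supplies continuous functions \<open>g n\<close> that
    converge to \<open>h\<close> almost everywhere on \<open>S\<close>, but without any bound on
    them.\<close>
  have "h measurable_on S" using hm S by (simp add: measurable_on_iff_borel_measurable)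
  then obtain N g where N: "negligible N" and g: "\<And>n. continuous_on UNIV (g n)"
    "\<And>x. x \<notin> N \<Longrightarrow> (\<lambda>n. g n x) \<longlonglongrightarrow> (if x \<in> S then h x else 0)"
    unfolding measurable_on_def by blast
  have AEN: "AE x in ?M. x \<notin> N"
  proof -
    have "AE x in lebesgue. x \<notin> N" using N by (intro AE_not_in) (simp add: negligible_iff_null_sets)
    then show ?thesis using S by (subst AE_restrict_space_iff) (auto elim: eventually_mono)
  qed
  \<comment> \<open>Unlike \<open>g n\<close>, these functions are bounded by 1, so
    \<open>norm (h x)\<close> is an integrable majorant. Integrated against \<open>h\<close> they
    approach the integral of \<open>norm (h x) ^ 2 / (1 + norm (h x))\<close>, whose integrand is
    nonnegative and vanishes only where \<open>h\<close> does.\<close>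
  define \<psi> where "\<psi> = (\<lambda>n x. cnj (g n x) / of_real (1 + norm (g n x)))"
  have np: "1 + norm z \<noteq> 0" "1 + complex_of_real (norm z) \<noteq> 0" for z :: complex
  proof -
    show r: "1 + norm z \<noteq> 0" using norm_ge_zero[of z] by linarith
    have "complex_of_real (1 + norm z) \<noteq> 0" using r by (simp only: of_real_eq_0_iff not_False_eq_True)
    then show "1 + complex_of_real (norm z) \<noteq> 0" by simp
  qed
  have \<psi>c: "continuous_on UNIV (\<psi> n)" for n
    unfolding \<psi>_def by (intro continuous_intros g) (simp add: np)
  have \<psi>1: "norm (\<psi> n x) \<le> 1" for n x
  proof -
    have "norm (\<psi> n x) = norm (g n x) / (1 + norm (g n x))"
      unfolding \<psi>_def norm_divide norm_of_real by simp
    then show ?thesis by (simp add: divide_le_eq_1 add_pos_nonneg)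
  qed
  have eq: "z * (cnj z / of_real (1 + norm z)) = of_real ((norm z)\<^sup>2 / (1 + norm z))" for z
    using complex_norm_square[of z] by (simp add: np)
  have "(\<lambda>n. LINT x|?M. h x * \<psi> n x) \<longlonglongrightarrow> (LINT x|?M. complex_of_real ((norm (h x))\<^sup>2 / (1 + norm (h x))))"
  proof (rule integral_dominated_convergence)
    show "(\<lambda>x. complex_of_real ((norm (h x))\<^sup>2 / (1 + norm (h x)))) \<in> borel_measurable ?M"
      by measurable
    show "(\<lambda>x. h x * \<psi> n x) \<in> borel_measurable ?M" for n
      using cm[OF continuous_on_subset[OF \<psi>c subset_UNIV]] by measurable
    show "integrable ?M (\<lambda>x. norm (h x))" using h by simp
    show "AE x in ?M. norm (h x * \<psi> n x) \<le> norm (h x)" for n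
      using mult_left_mono[OF \<psi>1 norm_ge_zero] by (intro AE_I2) (simp add: norm_mult)
    show "AE x in ?M. (\<lambda>n. h x * \<psi> n x) \<longlonglongrightarrow> complex_of_real ((norm (h x))\<^sup>2 / (1 + norm (h x)))"
      using AEN AE_space
    proof eventually_elim
      case (elim x)
      then have "(\<lambda>n. g n x) \<longlonglongrightarrow> h x" using g(2)[of x] by (simp add: space_restrict_space)
      then have "(\<lambda>n. h x * \<psi> n x) \<longlonglongrightarrow> h x * (cnj (h x) / of_real (1 + norm (h x)))"
        unfolding \<psi>_def by (intro tendsto_intros) (simp_all add: np)
      then show ?case by (simp only: eq)
    qed
  qed
  moreover have "(LINT x|?M. h x * \<psi> n x) = 0" for n by (rule bdd[OF \<psi>c \<psi>1])
  ultimately have "(LINT x|?M. complex_of_real ((norm (h x))\<^sup>2 / (1 + norm (h x)))) = 0"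
    by (simp add: LIMSEQ_const_iff)
  then have "(LINT x|?M. (norm (h x))\<^sup>2 / (1 + norm (h x))) = 0"
    by (simp only: integral_complex_of_real of_real_eq_0_iff)
  moreover have "integrable ?M (\<lambda>x. (norm (h x))\<^sup>2 / (1 + norm (h x)))"
  proof (rule Bochner_Integration.integrable_bound)
    show "integrable ?M (\<lambda>x. norm (h x))" using h by simp
    show "AE x in ?M. norm ((norm (h x))\<^sup>2 / (1 + norm (h x))) \<le> norm (norm (h x))"
      by (intro AE_I2) (simp add: divide_le_eq add_pos_nonneg power2_eq_square algebra_simps)
  qed measurable
  ultimately have "AE x in ?M. (norm (h x))\<^sup>2 / (1 + norm (h x)) = 0"
    using integral_nonneg_eq_0_iff_AE[of ?M "\<lambda>x. (norm (h x))\<^sup>2 / (1 + norm (h x))"] by simp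
  then have "AE x in ?M. h x = 0"
    by eventually_elim (simp add: np)
  then have "AE x in lebesgue. x \<in> S \<longrightarrow> h x = 0"
    using S by (subst (asm) AE_restrict_space_iff) auto
  then obtain Z where "{x \<in> space lebesgue. \<not> (x \<in> S \<longrightarrow> h x = 0)} \<subseteq> Z" "Z \<in> null_sets lebesgue"
    by (auto elim: AE_E simp: null_sets_def)
  then have "{x \<in> S. h x \<noteq> 0} \<subseteq> Z" "negligible Z"
    by (auto simp: negligible_iff_null_sets)
  then show ?thesis unfolding S_def by (metis negligible_subset)
qed

section \<open>Absolutely convergent Fourier series\<close>

lemma integral_cis:
  "integral {0..2*pi} (\<lambda>x. cis (of_int k * x)) = (if k = 0 then complex_of_real (2*pi) else 0)"
proof (cases "k = 0")
  case False
  let ?F = "\<lambda>x. exp (\<i> * of_int k * complex_of_real x) / (\<i> * of_int k)"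
  have "(?F has_vector_derivative exp (\<i> * of_int k * complex_of_real x)) (at x within S)" for x S
  proof -
    have "((\<lambda>z. exp (\<i> * of_int k * z) / (\<i> * of_int k)) has_field_derivative exp (\<i> * of_int k * complex_of_real x)) (at (complex_of_real x))"
      using False by (auto intro!: derivative_eq_intros)
    then show ?thesis by (rule has_vector_derivative_at_within[OF has_vector_derivative_real_field])
  qed
  then have "((\<lambda>x. exp (\<i> * of_int k * complex_of_real x)) has_integral ?F (2*pi) - ?F 0) {0..2*pi}"
    by (intro fundamental_theorem_of_calculus) auto
  moreover have "exp (\<i> * of_int k * complex_of_real (2*pi)) = 1"
    unfolding exp_eq_1 by (auto intro!: exI[of _ k])
  moreover have "(\<lambda>x. cis (of_int k * x)) = (\<lambda>x. exp (\<i> * of_int k * complex_of_real x))"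
    by (simp add: cis_conv_exp mult.assoc)
  ultimately show ?thesis
    using False by (simp add: integral_unique)
qed (simp add: scaleR_conv_of_real)

definition fourier_series :: "(int \<Rightarrow> complex) \<Rightarrow> real \<Rightarrow> complex" where
  "fourier_series c x = (\<Sum>\<^sub>\<infinity>k. c k * cis (of_int k * x))"

lemma fourier_series_integral:
  fixes c :: "int \<Rightarrow> complex"
  assumes c: "(\<lambda>k. cmod (c k)) summable_on UNIV" and g: "continuous_on {0..2*pi} g"
    and b: "\<And>x. x \<in> {0..2*pi} \<Longrightarrow> cmod (g x) \<le> b"
  shows "((\<lambda>k. integral {0..2*pi} (\<lambda>x. c k * cis (of_int k * x) * g x)) has_sum
      integral {0..2*pi} (\<lambda>x. fourier_series c x * g x)) UNIV"
    and "continuous_on {0..2*pi} (\<lambda>x. fourier_series c x * g x)"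
proof -
  have s: "fourier_series c x * g x = (\<Sum>\<^sub>\<infinity>k. c k * cis (of_int k * x) * g x)" for x
    unfolding fourier_series_def by (rule infsum_cmult_left'[symmetric])
  have cont: "continuous_on {0..2*pi} (\<lambda>x. c k * cis (of_int k * x) * g x)" for k
    by (intro continuous_intros g)
  have bd: "cmod (c k * cis (of_int k * x) * g x) \<le> cmod (c k) * b" if "x \<in> {0..2*pi}" for k x
    using b[OF that] by (simp add: norm_mult mult_left_mono)
  have sm: "(\<lambda>k. cmod (c k) * b) summable_on UNIV"
    using c by (rule summable_on_cmult_left)
  show "((\<lambda>k. integral {0..2*pi} (\<lambda>x. c k * cis (of_int k * x) * g x)) has_sum
      integral {0..2*pi} (\<lambda>x. fourier_series c x * g x)) UNIV"
    unfolding s by (rule integral_has_sum(1)[OF cont bd sm])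
  show "continuous_on {0..2*pi} (\<lambda>x. fourier_series c x * g x)"
    unfolding s by (rule integral_has_sum(2)[OF cont bd sm])
qed

lemma continuous_fourier_series:
  fixes c :: "int \<Rightarrow> complex"
  assumes "(\<lambda>k. cmod (c k)) summable_on UNIV"
  shows "continuous_on {0..2*pi} (fourier_series c)"
  using fourier_series_integral(2)[OF assms, of "\<lambda>_. 1" 1] by simp

lemma fourier_series_coeff:
  fixes c :: "int \<Rightarrow> complex"
  assumes c: "(\<lambda>k. cmod (c k)) summable_on UNIV"
  shows "integral {0..2*pi} (\<lambda>x. fourier_series c x * cis (- (of_int m * x))) = 2 * pi * c m"
proof -
  have e: "c k * cis (of_int k * x) * cis (- (of_int m * x)) = c k * cis (of_int (k - m) * x)" for k x
    by (simp add: mult.assoc cis_mult algebra_simps)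
  have "integral {0..2*pi} (\<lambda>x. c k * cis (of_int k * x) * cis (- (of_int m * x))) = c k * (if k = m then complex_of_real (2*pi) else 0)" for k
    unfolding e Henstock_Kurzweil_Integration.integral_mult_right integral_cis by simp
  then have "((\<lambda>k. c k * (if k = m then complex_of_real (2*pi) else 0)) has_sum
      integral {0..2*pi} (\<lambda>x. fourier_series c x * cis (- (of_int m * x)))) UNIV"
    using fourier_series_integral(1)[OF c, of "\<lambda>x. cis (- (of_int m * x))" 1]
    by (simp add: continuous_intros)
  moreover have "((\<lambda>k. c k * (if k = m then complex_of_real (2*pi) else 0)) has_sum 2 * pi * c m) UNIV"
    by (rule has_sum_finite_neutralI[of "{m}"]) auto
  ultimately show ?thesis by (rule has_sum_unique)
qed

lemma B_alg_integrable:
  assumes "\<phi> \<in> B_alg"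
  shows "(\<lambda>x. \<phi> (cis x) * cis (- (of_int k * x))) integrable_on {0..2*pi}"
proof -
  have ai: "(\<lambda>x. \<phi> (cis x)) absolutely_integrable_on {0..2*pi}"
    using assms by (simp add: B_alg_def)
  have e: "continuous_on {0..2*pi} (\<lambda>x. cis (- (of_int k * x)))"
    by (intro continuous_intros)
  have "(\<lambda>x. cis (- (of_int k * x)) * \<phi> (cis x)) absolutely_integrable_on {0..2*pi}"
    by (rule absolutely_integrable_bounded_measurable_product[OF bilinear_times _ _ _ ai])
       (auto intro!: continuous_imp_measurable_on_sets_lebesgue e boundedI[where B = 1])
  then show ?thesis
    using set_lebesgue_integral_eq_integral(1) by (simp add: mult.commute)
qed

text \<open>The difference from the sum of the Fourier series has only zero coefficients. Membership
  in \<open>B_alg\<close> constrains a function only up to null sets on the circle, hence equality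
  almost everywhere.\<close>

lemma fourier_inversion:
  assumes \<phi>: "\<phi> \<in> B_alg"
  shows "negligible {x \<in> {0..2*pi}. \<phi> (cis x) \<noteq> fourier_series (fourier_coeff \<phi>) x}"
proof -
  let ?S = "fourier_series (fourier_coeff \<phi>)"
  have ai: "(\<lambda>x. \<phi> (cis x)) absolutely_integrable_on {0..2*pi}"
    and c: "(\<lambda>k. cmod (fourier_coeff \<phi> k)) summable_on UNIV"
    using \<phi> by (auto simp: B_alg_def)
  note cont = continuous_fourier_series[OF c]
  have aS: "?S absolutely_integrable_on {0..2*pi}"
    by (rule absolutely_integrable_continuous_real[OF cont])
  have "(\<lambda>x. \<phi> (cis x) - ?S x) absolutely_integrable_on {0..2*pi}"
    by (rule set_integral_diff(1)[OF ai aS])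
  moreover have "integral {0..2*pi} (\<lambda>x. (\<phi> (cis x) - ?S x) * cis (- (of_int k * x))) = 0" for k
  proof -
    have e: "continuous_on {0..2*pi} (\<lambda>x. cis (- (of_int k * x)))"
      by (intro continuous_intros)
    note i1 = B_alg_integrable[OF \<phi>, of k]
    have i2: "(\<lambda>x. ?S x * cis (- (of_int k * x))) integrable_on {0..2*pi}"
      by (intro integrable_continuous_real continuous_on_mult cont e)
    have "integral {0..2*pi} (\<lambda>x. (\<phi> (cis x) - ?S x) * cis (- (of_int k * x)))
      = integral {0..2*pi} (\<lambda>x. \<phi> (cis x) * cis (- (of_int k * x))) - 2 * pi * fourier_coeff \<phi> k"
      using Henstock_Kurzweil_Integration.integral_diff[OF i1 i2] fourier_series_coeff[OF c, of k]
      by (simp add: left_diff_distrib)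
    also have "\<dots> = 0" by (simp add: fourier_coeff_def)
    finally show ?thesis .
  qed
  ultimately have "negligible {x \<in> {0..2*pi}. \<phi> (cis x) - ?S x \<noteq> 0}"
    by (rule fourier_unique)
  then show ?thesis by simp
qed

lemma has_sum_sum:
  fixes f :: "'u \<Rightarrow> 'a \<Rightarrow> 'b::{comm_monoid_add, topological_comm_monoid_add}"
  assumes "finite U" "\<And>u. (f u has_sum g u) A"
  shows "((\<lambda>x. \<Sum>u\<in>U. f u x) has_sum (\<Sum>u\<in>U. g u)) A"
  using assms(1)
proof induction
  case (insert u U)
  then show ?case using has_sum_add[OF assms(2) insert.IH] by simp
qed simp

lemma has_sum_pairs:
  fixes h :: "'a \<times> 'n::finite \<Rightarrow> complex"
  assumes "\<And>t. ((\<lambda>l. h (l, t)) has_sum g t) UNIV"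
  shows "(h has_sum (\<Sum>t\<in>UNIV. g t)) UNIV"
proof -
  have "((\<lambda>p. if snd p = u then h p else 0) has_sum g u) UNIV" for u
    by (subst has_sum_pair_neutral[where s = u]) (use assms in auto)
  then have "((\<lambda>p. \<Sum>u\<in>UNIV. if snd p = u then h p else 0) has_sum (\<Sum>u\<in>UNIV. g u)) UNIV"
    by (rule has_sum_sum[OF finite_class.finite_UNIV])
  then show ?thesis by simp
qed

section \<open>Powers and exponentials of Laurent operators\<close>

definition symbol :: "'n::finite coeffs \<Rightarrow> real \<Rightarrow> complex^'n^'n" where
  "symbol f x = (\<chi> r s. fourier_series (\<lambda>k. f k r s) x)"

definition mat_pow :: "complex^'n^'n \<Rightarrow> nat \<Rightarrow> complex^'n^'n" where
  "mat_pow A n = (((**) A) ^^ n) (mat 1)"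

lemma mat_pow_0: "mat_pow A 0 $ r $ s = (if r = s then 1 else 0)"
  by (simp add: mat_pow_def Finite_Cartesian_Product.mat_def)

lemma mat_pow_Suc: "mat_pow A (Suc n) $ r $ s = (\<Sum>t\<in>UNIV. A $ r $ t * mat_pow A n $ t $ s)"
  by (simp add: mat_pow_def matrix_matrix_mult_def)

text \<open>\<open>c\<close> bounds the row sums, hence the norm of the matrix as an operator for
  the maximum norm, which is submultiplicative.\<close>

lemma mat_pow_bound:
  fixes A :: "complex^'n^'n"
  assumes "\<And>r. (\<Sum>t\<in>UNIV. cmod (A $ r $ t)) \<le> c"
  shows "cmod (mat_pow A n $ r $ s) \<le> c ^ n"
proof (induction n arbitrary: r)
  case 0
  then show ?case by (simp add: mat_pow_0)
next
  case (Suc n)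
  have "0 \<le> (\<Sum>t\<in>UNIV. cmod (A $ r $ t))" by (rule sum_nonneg) simp
  then have c: "c \<ge> 0" using assms[of r] by linarith
  have "cmod (mat_pow A (Suc n) $ r $ s) \<le> (\<Sum>t\<in>UNIV. cmod (A $ r $ t) * c ^ n)"
    unfolding mat_pow_Suc by (intro sum_norm_le) (simp add: norm_mult mult_left_mono Suc)
  also have "\<dots> \<le> c * c ^ n"
    unfolding sum_distrib_right[symmetric] using c by (intro mult_right_mono assms) auto
  finally show ?case by simp
qed

lemma symbol_bound:
  fixes f :: "'n::finite coeffs"
  assumes f: "wiener f"
  shows "(\<Sum>t\<in>UNIV. cmod (symbol f x $ r $ t)) \<le> (\<Sum>r\<in>UNIV. \<Sum>t\<in>UNIV. \<Sum>\<^sub>\<infinity>k. cmod (f k r t))"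
proof -
  have "cmod (symbol f x $ r $ t) \<le> (\<Sum>\<^sub>\<infinity>k. cmod (f k r t))" for t
  proof -
    have "cmod (fourier_series (\<lambda>k. f k r t) x) \<le> (\<Sum>\<^sub>\<infinity>k. cmod (f k r t * cis (of_int k * x)))"
      unfolding fourier_series_def using f
      by (intro norm_infsum_bound) (simp add: wiener_def norm_mult)
    then show ?thesis by (simp add: symbol_def norm_mult)
  qed
  then have "(\<Sum>t\<in>UNIV. cmod (symbol f x $ r $ t)) \<le> (\<Sum>t\<in>UNIV. \<Sum>\<^sub>\<infinity>k. cmod (f k r t))"
    by (rule sum_mono)
  also have "\<dots> \<le> (\<Sum>r\<in>UNIV. \<Sum>t\<in>UNIV. \<Sum>\<^sub>\<infinity>k. cmod (f k r t))"
    by (rule member_le_sum[of r]) (auto intro!: sum_nonneg infsum_nonneg)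
  finally show ?thesis .
qed

text \<open>The convolution rule by induction: one factor \<open>symbol f\<close> is expanded into
  its absolutely convergent series and integrated termwise against the entries of the remaining
  power. Both claims are proved together, because termwise integration relies on the continuity of
  these entries.\<close>

lemma entry_laurent_power:
  fixes f :: "'n::finite coeffs"
  assumes f: "wiener f"
  shows "continuous_on {0..2*pi} (\<lambda>x. mat_pow (symbol f x) n $ r $ s)"
    and "entry (laurent f ^ n) (j, r) (k, s) =
      integral {0..2*pi} (\<lambda>x. mat_pow (symbol f x) n $ r $ s * cis (- (of_int (j - k) * x))) / (2 * pi)"
proof (induction n arbitrary: r s j k)
  case 0
  {
    case 1
    show ?case by (simp add: mat_pow_0)
  next
    case 2
    have "(\<lambda>x. cis (- (of_int (j - k) * x))) = (\<lambda>x. cis (of_int (k - j) * x))"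
      by (simp add: algebra_simps)
    then show ?case
      using integral_cis[of "k - j"] by (auto simp: mat_pow_0)
  }
next
  case (Suc n)
  define c where "c = (\<Sum>r\<in>UNIV. \<Sum>t\<in>UNIV. \<Sum>\<^sub>\<infinity>k. cmod (f k r t))"
  have bd: "cmod (mat_pow (symbol f x) n $ r $ s) \<le> c ^ n" for x r s
    unfolding c_def by (rule mat_pow_bound[OF symbol_bound[OF f]])
  have fs: "(\<lambda>k. cmod (f k r s)) summable_on UNIV" for r s
    using f by (simp add: wiener_def)
  have sc: "continuous_on {0..2*pi} (\<lambda>x. symbol f x $ r $ s)" for r s
    using continuous_fourier_series[OF fs] by (simp add: symbol_def)
  note cont = Suc(1) and ent = Suc(2)
  {
    case 1
    show ?case unfolding mat_pow_Suc
      by (intro continuous_intros cont sc)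
  next
    case 2
    let ?g = "\<lambda>t x. mat_pow (symbol f x) n $ t $ s * cis (- (of_int (j - k) * x))"
    have g: "continuous_on {0..2*pi} (?g t)" for t
      by (intro continuous_intros cont)
    have i: "(\<lambda>x. symbol f x $ r $ t * ?g t x) integrable_on {0..2*pi}" for t
      by (intro integrable_continuous_real continuous_on_mult sc g)
    have t: "((\<lambda>l. entry (laurent f) (j, r) (l, t) * entry (laurent f ^ n) (l, t) (k, s)) has_sum
        integral {0..2*pi} (\<lambda>x. symbol f x $ r $ t * ?g t x) / (2 * pi)) UNIV" for t
    proof -
      have eq: "f (j - l) r t * cis (of_int (j - l) * x) * ?g t x
          = f (j - l) r t * (mat_pow (symbol f x) n $ t $ s * cis (- (of_int (l - k) * x)))" for l x
      proof -
        have "cis (of_int (j - l) * x) * cis (- (of_int (j - k) * x)) = cis (- (of_int (l - k) * x))"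
          by (simp add: cis_mult algebra_simps)
        then show ?thesis by (simp add: mult.left_commute mult.assoc)
      qed
      have "((\<lambda>m. integral {0..2*pi} (\<lambda>x. f m r t * cis (of_int m * x) * ?g t x)) has_sum
          integral {0..2*pi} (\<lambda>x. symbol f x $ r $ t * ?g t x)) UNIV"
        using fourier_series_integral(1)[OF fs g, where b = "c ^ n"] bd by (simp add: symbol_def norm_mult)
      moreover have "bij (\<lambda>l. j - l)"
        by (rule bij_betw_byWitness[where f' = "\<lambda>l. j - l"]) auto
      ultimately have "((\<lambda>l. integral {0..2*pi} (\<lambda>x. f (j - l) r t * cis (of_int (j - l) * x) * ?g t x)) has_sum
          integral {0..2*pi} (\<lambda>x. symbol f x $ r $ t * ?g t x)) UNIV"
        by (subst has_sum_reindex_bij_betw[where f = "\<lambda>m. integral {0..2*pi} (\<lambda>x. f m r t * cis (of_int m * x) * ?g t x)"])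
      then have "((\<lambda>l. f (j - l) r t * integral {0..2*pi} (\<lambda>x. mat_pow (symbol f x) n $ t $ s * cis (- (of_int (l - k) * x)))) has_sum
          integral {0..2*pi} (\<lambda>x. symbol f x $ r $ t * ?g t x)) UNIV"
        unfolding eq by simp
      from has_sum_cmult_left[OF this, of "1 / (2 * pi)"] show ?thesis
        by (simp add: entry_laurent[OF f] ent)
    qed
    have "((\<lambda>p. entry (laurent f) (j, r) p * entry (laurent f ^ n) p (k, s)) has_sum
        (\<Sum>t\<in>UNIV. integral {0..2*pi} (\<lambda>x. symbol f x $ r $ t * ?g t x) / (2 * pi))) UNIV"
      by (rule has_sum_pairs[OF t])
    moreover have "((\<lambda>p. entry (laurent f) (j, r) p * entry (laurent f ^ n) p (k, s)) has_sum
        entry (laurent f ^ Suc n) (j, r) (k, s)) UNIV"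
      using entry_mult[of "laurent f" "(j, r)" "laurent f ^ n" "(k, s)"] by simp
    ultimately have "entry (laurent f ^ Suc n) (j, r) (k, s) =
        (\<Sum>t\<in>UNIV. integral {0..2*pi} (\<lambda>x. symbol f x $ r $ t * ?g t x) / (2 * pi))"
      by (blast dest: has_sum_unique)
    also have "\<dots> = integral {0..2*pi} (\<lambda>x. \<Sum>t\<in>UNIV. symbol f x $ r $ t * ?g t x) / (2 * pi)"
      unfolding sum_divide_distrib[symmetric]
      by (simp only: integral_sum[OF finite_class.finite_UNIV i])
    also have "(\<lambda>x. \<Sum>t\<in>UNIV. symbol f x $ r $ t * ?g t x)
        = (\<lambda>x. mat_pow (symbol f x) (Suc n) $ r $ s * cis (- (of_int (j - k) * x)))"
      by (simp add: mat_pow_Suc sum_distrib_right mult.assoc)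
    finally show ?case .
  }
qed

lemma mat_exp_sums:
  fixes A :: "complex^'n^'n"
  shows "(\<lambda>n. mat_pow A n $ r $ s /\<^sub>R fact n) sums (mat_exp A $ r $ s)"
proof -
  define c where "c = (\<Sum>r\<in>UNIV. \<Sum>t\<in>UNIV. cmod (A $ r $ t))"
  have bd: "cmod (mat_pow A n $ r $ s) \<le> c ^ n" for n r s
    unfolding c_def by (rule mat_pow_bound, rule member_le_sum) (auto intro: sum_nonneg)
  have "summable (\<lambda>n. mat_pow A n $ r $ s /\<^sub>R fact n)" for r s
  proof (rule summable_comparison_test')
    show "summable (\<lambda>n. inverse (fact n) * c ^ n)" by (rule summable_exp)
    show "norm (mat_pow A n $ r $ s /\<^sub>R fact n) \<le> inverse (fact n) * c ^ n" for n
      using bd[of n r s] by (simp add: mult_left_mono)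
  qed
  then have "(\<lambda>n. mat_pow A n /\<^sub>R fact n) sums (\<chi> r s. \<Sum>n. mat_pow A n $ r $ s /\<^sub>R fact n)"
    unfolding sums_def
    by (intro vec_tendstoI) (simp add: sum_component summable_LIMSEQ)
  then have "(\<lambda>n. mat_pow A n /\<^sub>R fact n) sums mat_exp A"
    unfolding mat_exp_def mat_pow_def by (simp add: sums_iff)
  then have "(\<lambda>n. (\<Sum>k<n. mat_pow A k /\<^sub>R fact k) $ r $ s) \<longlonglongrightarrow> mat_exp A $ r $ s"
    unfolding sums_def by (intro tendsto_vec_nth)
  then show ?thesis unfolding sums_def by (simp add: sum_component)
qed

text \<open>The exponential series is integrated term by term with the majorant
  \<open>c ^ n / fact n\<close>, uniform in \<open>x\<close>. The Fourier coefficients of the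
  exponential symbol thus appear without any appeal to its membership in the symbol algebra.\<close>

lemma entry_exp_laurent:
  fixes f :: "'n::finite coeffs"
  assumes f: "wiener f"
  shows "entry (exp (laurent f)) (j, r) (k, s) =
      integral {0..2*pi} (\<lambda>x. mat_exp (symbol f x) $ r $ s * cis (- (of_int (j - k) * x))) / (2 * pi)"
proof -
  define c where "c = (\<Sum>r\<in>UNIV. \<Sum>t\<in>UNIV. \<Sum>\<^sub>\<infinity>k. cmod (f k r t))"
  have bd: "cmod (mat_pow (symbol f x) n $ r $ s) \<le> c ^ n" for x n r s
    unfolding c_def by (rule mat_pow_bound[OF symbol_bound[OF f]])
  have c0: "c \<ge> 0" unfolding c_def by (intro sum_nonneg infsum_nonneg) simp
  let ?e = "\<lambda>x. cis (- (of_int (j - k) * x))"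
  let ?h = "\<lambda>n x. mat_pow (symbol f x) n $ r $ s /\<^sub>R fact n * ?e x"
  let ?C = "\<lambda>n. inverse (fact n) * c ^ n"
  have C: "?C summable_on UNIV"
    by (rule norm_summable_imp_summable_on) (use c0 summable_exp[of c] in \<open>simp add: abs_mult\<close>)
  have hb: "cmod (?h n x) \<le> ?C n" for n x
    using bd[of x n r s] by (simp add: norm_mult mult_left_mono)
  have "(\<Sum>\<^sub>\<infinity>n. ?h n x) = mat_exp (symbol f x) $ r $ s * ?e x" for x
  proof (rule infsumI, rule norm_summable_imp_has_sum)
    show "summable (\<lambda>n. cmod (?h n x))"
      by (rule summable_comparison_test'[OF summable_exp[of c]]) (use hb in simp)
    show "(\<lambda>n. ?h n x) sums (mat_exp (symbol f x) $ r $ s * ?e x)"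
      by (rule sums_mult2[OF mat_exp_sums])
  qed
  then have "((\<lambda>n. integral {0..2*pi} (?h n)) has_sum
      integral {0..2*pi} (\<lambda>x. mat_exp (symbol f x) $ r $ s * ?e x)) UNIV"
    using integral_has_sum(1)[of 0 "2*pi" ?h ?C, OF _ hb C]
    by (simp add: continuous_intros entry_laurent_power(1)[OF f])
  then have "(\<lambda>n. integral {0..2*pi} (?h n) / (2 * pi)) sums
      (integral {0..2*pi} (\<lambda>x. mat_exp (symbol f x) $ r $ s * ?e x) / (2 * pi))"
    by (intro sums_divide has_sum_imp_sums)
  moreover have "integral {0..2*pi} (?h n) / (2 * pi) = entry (laurent f ^ n /\<^sub>R fact n) (j, r) (k, s)" for n
  proof -
    have "?h n = (\<lambda>x. (mat_pow (symbol f x) n $ r $ s * ?e x) /\<^sub>R fact n)"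
      by (simp add: fun_eq_iff)
    then have "integral {0..2*pi} (?h n) = integral {0..2*pi} (\<lambda>x. mat_pow (symbol f x) n $ r $ s * ?e x) /\<^sub>R fact n"
      by (simp only: integral_cmul)
    moreover have "entry (laurent f ^ n /\<^sub>R fact n) (j, r) (k, s) = entry (laurent f ^ n) (j, r) (k, s) /\<^sub>R fact n"
      by (rule linear_scale[OF bounded_linear.linear[OF bounded_linear_entry]])
    ultimately show ?thesis
      by (simp only: entry_laurent_power(2)[OF f] scaleR_conv_of_real times_divide_eq_right)
  qed
  ultimately have "(\<lambda>n. entry (laurent f ^ n /\<^sub>R fact n) (j, r) (k, s)) sums
      (integral {0..2*pi} (\<lambda>x. mat_exp (symbol f x) $ r $ s * ?e x) / (2 * pi))"
    by (simp only:)
  moreover have "(\<lambda>n. entry (laurent f ^ n /\<^sub>R fact n) (j, r) (k, s)) sums entry (exp (laurent f)) (j, r) (k, s)"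
    by (rule bounded_linear.sums[OF bounded_linear_entry exp_converges])
  ultimately show ?thesis by (rule sums_unique2[symmetric])
qed

definition matrix_coeffs :: "(complex \<Rightarrow> complex^'n^'n) \<Rightarrow> 'n coeffs" where
  "matrix_coeffs R = (\<lambda>k r s. fourier_coeff (\<lambda>z. R z $ r $ s) k)"

lemma wiener_matrix_coeffs: "R \<in> B_mat \<Longrightarrow> wiener (matrix_coeffs R)"
  by (auto simp: B_mat_def B_alg_def wiener_def matrix_coeffs_def)

lemma entry_exp_matrix_coeffs:
  fixes R :: "complex \<Rightarrow> complex^'n^'n"
  assumes R: "R \<in> B_mat"
  shows "entry (exp (laurent (matrix_coeffs R))) (j, r) (k, s) = fourier_coeff (\<lambda>z. mat_exp (R z) $ r $ s) (j - k)"
proof -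
  \<comment> \<open>One null set for each matrix entry. Off their finite union the whole matrix
    agrees with the sum of its Fourier series, hence so does its exponential.\<close>
  let ?N = "\<Union>(r, s). {x \<in> {0..2*pi}. R (cis x) $ r $ s \<noteq> fourier_series (fourier_coeff (\<lambda>z. R z $ r $ s)) x}"
  have "negligible {x \<in> {0..2*pi}. R (cis x) $ r $ s \<noteq> fourier_series (fourier_coeff (\<lambda>z. R z $ r $ s)) x}" for r s
    using R by (intro fourier_inversion) (simp add: B_mat_def)
  then have N: "negligible ?N"
    by (intro negligible_Union) auto
  have eq: "R (cis x) = symbol (matrix_coeffs R) x" if "x \<in> {0..2*pi} - ?N" for x
    using that by (auto simp: Finite_Cartesian_Product.vec_eq_iff symbol_def matrix_coeffs_def)
  have "integral {0..2*pi} (\<lambda>x. mat_exp (symbol (matrix_coeffs R) x) $ r $ s * cis (- (of_int (j - k) * x)))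
      = integral {0..2*pi} (\<lambda>x. mat_exp (R (cis x)) $ r $ s * cis (- (of_int (j - k) * x)))"
    by (rule integral_spike[OF N]) (simp only: eq)
  then show ?thesis
    by (simp add: entry_exp_laurent[OF wiener_matrix_coeffs[OF R]] fourier_coeff_def)
qed

section \<open>Toeplitz and Hankel operators\<close>

lemma fourier_coeff_add:
  assumes "\<phi> \<in> B_alg" "\<psi> \<in> B_alg"
  shows "fourier_coeff (\<lambda>z. \<phi> z + \<psi> z) k = fourier_coeff \<phi> k + fourier_coeff \<psi> k"
  using Henstock_Kurzweil_Integration.integral_add[OF B_alg_integrable[OF assms(1), of k] B_alg_integrable[OF assms(2), of k]]
  by (simp add: fourier_coeff_def distrib_right add_divide_distrib)

lemma B_alg_add:
  assumes "\<phi> \<in> B_alg" "\<psi> \<in> B_alg"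
  shows "(\<lambda>z. \<phi> z + \<psi> z) \<in> B_alg"
proof -
  let ?f = "fourier_coeff \<phi>" and ?g = "fourier_coeff \<psi>"
  have "(\<lambda>k. cmod (?f k + ?g k)) summable_on UNIV"
    by (rule summable_on_comparison_test[where f = "\<lambda>k. cmod (?f k) + cmod (?g k)"])
       (use assms in \<open>auto simp: B_alg_def norm_triangle_ineq intro: summable_on_add\<close>)
  moreover have "(\<lambda>k. \<bar>of_int k\<bar> * (cmod (?f k + ?g k))\<^sup>2) summable_on UNIV"
  proof (rule summable_on_comparison_test)
    show "(\<lambda>k. 2 * (\<bar>of_int k\<bar> * (cmod (?f k))\<^sup>2) + 2 * (\<bar>of_int k\<bar> * (cmod (?g k))\<^sup>2)) summable_on UNIV"
      using assms by (intro summable_on_add summable_on_cmult_right) (auto simp: B_alg_def)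
    fix k :: int
    have "(cmod (?f k + ?g k))\<^sup>2 \<le> (cmod (?f k) + cmod (?g k))\<^sup>2"
      by (intro power_mono norm_triangle_ineq) simp
    also have "\<dots> \<le> 2 * (cmod (?f k))\<^sup>2 + 2 * (cmod (?g k))\<^sup>2"
      using sum_squares_bound[of "cmod (?f k)" "cmod (?g k)"] by (simp add: power2_sum)
    finally have "\<bar>of_int k\<bar> * (cmod (?f k + ?g k))\<^sup>2 \<le> \<bar>of_int k\<bar> * (2 * (cmod (?f k))\<^sup>2 + 2 * (cmod (?g k))\<^sup>2)"
      by (intro mult_left_mono) auto
    then show "\<bar>of_int k\<bar> * (cmod (?f k + ?g k))\<^sup>2 \<le> 2 * (\<bar>of_int k\<bar> * (cmod (?f k))\<^sup>2) + 2 * (\<bar>of_int k\<bar> * (cmod (?g k))\<^sup>2)"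
      by (simp add: algebra_simps)
  qed auto
  moreover have "(\<lambda>x. \<phi> (cis x) + \<psi> (cis x)) absolutely_integrable_on {0..2*pi}"
    using assms by (intro set_integral_add(1)) (auto simp: B_alg_def)
  ultimately show ?thesis
    unfolding B_alg_def using fourier_coeff_add[OF assms] by simp
qed

lemma B_mat_add_scalar:
  fixes Q :: "complex \<Rightarrow> complex^'n^'n"
  assumes Q: "Q \<in> B_mat" and a: "a \<in> B_alg"
  shows "(\<lambda>z. mat (a z) + Q z) \<in> B_mat"
    and "matrix_coeffs (\<lambda>z. mat (a z) + Q z)
      = (\<lambda>k r s. diag_coeffs (fourier_coeff a) k r s + matrix_coeffs Q k r s)"
proof -
  have q: "(\<lambda>z. Q z $ r $ s) \<in> B_alg" for r s using Q by (simp add: B_mat_def)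
  have e: "(\<lambda>z. (mat (a z) + Q z) $ r $ s) = (if r = s then (\<lambda>z. a z + Q z $ r $ s) else (\<lambda>z. Q z $ r $ s))" for r s
    by (auto simp: Finite_Cartesian_Product.mat_def)
  show "(\<lambda>z. mat (a z) + Q z) \<in> B_mat"
    unfolding B_mat_def mem_Collect_eq e by (auto intro: q B_alg_add[OF a q])
  show "matrix_coeffs (\<lambda>z. mat (a z) + Q z)
      = (\<lambda>k r s. diag_coeffs (fourier_coeff a) k r s + matrix_coeffs Q k r s)"
    unfolding matrix_coeffs_def e by (auto simp: fun_eq_iff diag_coeffs_def fourier_coeff_add[OF a q])
qed

lemma half_smooth_matrix_coeffs: "R \<in> B_mat \<Longrightarrow> half_smooth (matrix_coeffs R)"
  by (auto simp: B_mat_def B_alg_def half_smooth_def matrix_coeffs_def)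

lemma half_smooth_diag:
  assumes "(\<lambda>k. \<bar>of_int k\<bar> * (cmod (b k))\<^sup>2) summable_on UNIV"
  shows "half_smooth (diag_coeffs b)"
  unfolding half_smooth_def
proof (intro allI)
  fix r s
  show "(\<lambda>k. \<bar>of_int k\<bar> * (cmod (diag_coeffs b k r s))\<^sup>2) summable_on UNIV"
    using assms by (cases "r = s") (simp_all add: diag_coeffs_def)
qed

lemma trace_matrix_coeffs:
  fixes Q :: "complex \<Rightarrow> complex^'n^'n"
  assumes Q: "Q \<in> B_mat" and tr: "\<And>z. z \<in> sphere 0 1 \<Longrightarrow> trace (Q z) = 0"
  shows "(\<Sum>r\<in>UNIV. matrix_coeffs Q k r r) = 0"
proof -
  have q: "(\<lambda>z. Q z $ r $ r) \<in> B_alg" for r using Q by (simp add: B_mat_def)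
  have "(\<Sum>r\<in>UNIV. integral {0..2*pi} (\<lambda>x. Q (cis x) $ r $ r * cis (- (of_int k * x))))
      = integral {0..2*pi} (\<lambda>x. \<Sum>r\<in>UNIV. Q (cis x) $ r $ r * cis (- (of_int k * x)))"
    by (rule integral_sum[symmetric]) (auto intro: B_alg_integrable[OF q])
  also have "\<dots> = 0"
    using tr by (simp add: sum_distrib_right[symmetric] trace_def)
  finally show ?thesis
    by (simp add: matrix_coeffs_def fourier_coeff_def sum_divide_distrib[symmetric])
qed

text \<open>The substitution of \<open>2 * pi - x\<close> for \<open>x\<close>, under which
  \<open>cis x\<close> is conjugated and the exponential factor changes the sign of its
  frequency.\<close>

lemma fourier_coeff_reflect:
  assumes a: "a \<in> B_alg"
  shows "fourier_coeff (circle_reflect a) m = fourier_coeff a (- m)"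
proof -
  let ?F = "\<lambda>x. a (cis x) * cis (- (of_int (- m) * x))"
  have F: "(?F has_integral integral {0..2*pi} ?F) (cbox 0 (2*pi))"
    using B_alg_integrable[OF a, of "- m"] by (simp add: integrable_integral)
  have img: "(\<lambda>x::real. (1 / - 1) *\<^sub>R x + - ((1 / - 1) *\<^sub>R (2*pi))) ` cbox 0 (2*pi) = {0..2*pi}"
  proof (intro equalityI subsetI)
    fix x :: real assume "x \<in> {0..2*pi}"
    then show "x \<in> (\<lambda>x::real. (1 / - 1) *\<^sub>R x + - ((1 / - 1) *\<^sub>R (2*pi))) ` cbox 0 (2*pi)"
      by (intro image_eqI[of _ _ "2*pi - x"]) auto
  qed auto
  have "((\<lambda>x. ?F (2*pi - x)) has_integral integral {0..2*pi} ?F) {0..2*pi}"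
    using has_integral_affinity[OF F, of "-1" "2*pi"] unfolding img by simp
  moreover have "?F (2*pi - x) = circle_reflect a (cis x) * cis (- (of_int m * x))" for x
  proof -
    have "cis (2*pi - x) = cnj (cis x)" by (simp add: complex_eq_iff)
    moreover have "cis (- (of_int (- m) * (2*pi - x))) = cis (2 * pi * of_int m) * cis (- (of_int m * x))"
      by (simp add: cis_mult algebra_simps)
    moreover have "cis (2 * pi * of_int m) = 1" by (rule cis_multiple_2pi) simp
    ultimately show ?thesis by (simp add: circle_reflect_def)
  qed
  ultimately have "integral {0..2*pi} (\<lambda>x. circle_reflect a (cis x) * cis (- (of_int m * x))) = integral {0..2*pi} ?F"
    by (simp add: integral_unique)
  then show ?thesis by (simp add: fourier_coeff_def)
qed

text \<open>An operator with these entries acts by the very formula under \<open>Blinfun\<close>, so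
  its existence settles boundedness and square summability for \<open>toeplitz\<close>.\<close>

lemma toeplitz_eq_op_of:
  fixes \<Phi> :: "complex \<Rightarrow> complex^'n^'n"
  assumes "\<And>j r k s. entry A (j, r) (k, s) = fourier_coeff (\<lambda>z. \<Phi> z $ r $ s) (int j - int k)"
  shows "toeplitz \<Phi> = op_of A"
proof -
  have "(\<lambda>(j, r). \<Sum>\<^sub>\<infinity>(k, s). fourier_coeff (\<lambda>z. \<Phi> z $ r $ s) (int j - int k) * ell2_coord x (k, s))
      = (\<lambda>i. \<Sum>\<^sub>\<infinity>p. entry A i p * ell2_coord x p)" for x
  proof (rule ext)
    fix i :: "nat \<times> 'n"
    obtain j r where i: "i = (j, r)" by (cases i)
    show "(case i of (j, r) \<Rightarrow> \<Sum>\<^sub>\<infinity>(k, s). fourier_coeff (\<lambda>z. \<Phi> z $ r $ s) (int j - int k) * ell2_coord x (k, s))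
        = (\<Sum>\<^sub>\<infinity>p. entry A i p * ell2_coord x p)"
      unfolding i by (auto simp: assms intro!: infsum_cong)
  qed
  then show ?thesis unfolding toeplitz_def op_of_eq by simp
qed

lemma toeplitz_B_mat:
  fixes R :: "complex \<Rightarrow> complex^'n^'n"
  assumes "R \<in> B_mat"
  shows "toeplitz R = op_of (pull nonneg_emb (laurent (matrix_coeffs R)))"
    and "toeplitz (\<lambda>z. mat_exp (R z)) = op_of (pull nonneg_emb (exp (laurent (matrix_coeffs R))))"
  by (rule toeplitz_eq_op_of,
      simp add: nonneg_emb_def entry_laurent[OF wiener_matrix_coeffs[OF assms]] entry_exp_matrix_coeffs[OF assms],
      simp add: matrix_coeffs_def)
     (rule toeplitz_eq_op_of, simp add: nonneg_emb_def entry_exp_matrix_coeffs[OF assms])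

text \<open>Each row and each column of a Hankel matrix runs injectively through the Fourier
  coefficients, so the Schur test applies with the sum of their moduli.\<close>

lemma hankel_cop:
  assumes "(\<lambda>k. cmod (fourier_coeff \<phi> k)) summable_on UNIV"
  obtains H where "hankel \<phi> = op_of H" "\<And>j k. entry H j k = fourier_coeff \<phi> (int j + int k + 1)"
proof -
  have fin: "(\<Sum>k\<in>K. cmod (fourier_coeff \<phi> (h k))) \<le> (\<Sum>\<^sub>\<infinity>k. cmod (fourier_coeff \<phi> k))"
    if "finite K" "inj h" for K :: "nat set" and h
  proof -
    have "(\<Sum>k\<in>K. cmod (fourier_coeff \<phi> (h k))) = (\<Sum>m\<in>h ` K. cmod (fourier_coeff \<phi> m))"
      using inj_on_subset[OF that(2), of K] by (simp add: sum.reindex)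
    also have "\<dots> \<le> (\<Sum>\<^sub>\<infinity>k. cmod (fourier_coeff \<phi> k))"
      using assms that by (intro finite_sum_le_infsum) auto
    finally show ?thesis .
  qed
  obtain H :: "nat cop" where H: "\<And>j k. entry H j k = fourier_coeff \<phi> (int j + int k + 1)"
    by (rule schur_test[of "\<lambda>j k. fourier_coeff \<phi> (int j + int k + 1)" "\<Sum>\<^sub>\<infinity>k. cmod (fourier_coeff \<phi> k)"])
       (auto intro!: fin simp: inj_def)
  have "hankel \<phi> = op_of H" by (simp add: hankel_def op_of_eq H)
  then show thesis using H by (rule that)
qed

lemma fredholm_det_exp_quotient:
  "fredholm_det (op_of A o\<^sub>L op_exp (- op_of B)) = gdet (A * exp (- B))"
  by (simp add: fredholm_det_eq_gdet op_exp_op_of flip: times_cop.rep_eq uminus_cop.rep_eq)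

text \<open>A scalar factor leaves the matrix indices alone, so the block trace of the corner
  depends on \<open>g\<close> only through the traces of its coefficients.\<close>

lemma corner_diag_sum_left:
  fixes g :: "'n::finite coeffs"
  assumes b: "(\<lambda>k. cmod (b k)) summable_on UNIV" and g: "wiener g"
  shows "((\<lambda>l. if l < 0 then b (int j - l) * (\<Sum>r\<in>UNIV. g (l - int j) r r) else 0) has_sum
    (\<Sum>r\<in>UNIV. entry (pull nonneg_emb (laurent (diag_coeffs b) * compr.P' * laurent g)) (j, r) (j, r))) UNIV"
proof -
  have "((\<lambda>l. if l < 0 then b (int j - l) * g (l - int j) r r else 0) has_sum
      entry (pull nonneg_emb (laurent (diag_coeffs b) * compr.P' * laurent g)) (j, r) (j, r)) UNIV" for r
    using entry_pull_corner[OF wiener_diag[OF b] g, of j r j r]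
    by (subst (asm) has_sum_pair_neutral[where s = r]) (auto simp: diag_coeffs_def cong: if_cong)
  then have "((\<lambda>l. \<Sum>r\<in>UNIV. if l < 0 then b (int j - l) * g (l - int j) r r else 0) has_sum
      (\<Sum>r\<in>UNIV. entry (pull nonneg_emb (laurent (diag_coeffs b) * compr.P' * laurent g)) (j, r) (j, r))) UNIV"
    by (rule has_sum_sum[OF finite_class.finite_UNIV])
  moreover have "(\<Sum>r\<in>UNIV. if l < 0 then b (int j - l) * g (l - int j) r r else 0)
      = (if l < 0 then b (int j - l) * (\<Sum>r\<in>UNIV. g (l - int j) r r) else 0)" for l
    by (simp add: sum_distrib_left)
  ultimately show ?thesis by (simp only:)
qed

lemma corner_diag_sum_right:
  fixes g :: "'n::finite coeffs"
  assumes b: "(\<lambda>k. cmod (b k)) summable_on UNIV" and g: "wiener g"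
  shows "((\<lambda>l. if l < 0 then (\<Sum>r\<in>UNIV. g (int j - l) r r) * b (l - int j) else 0) has_sum
    (\<Sum>r\<in>UNIV. entry (pull nonneg_emb (laurent g * compr.P' * laurent (diag_coeffs b))) (j, r) (j, r))) UNIV"
proof -
  have "((\<lambda>l. if l < 0 then g (int j - l) r r * b (l - int j) else 0) has_sum
      entry (pull nonneg_emb (laurent g * compr.P' * laurent (diag_coeffs b))) (j, r) (j, r)) UNIV" for r
    using entry_pull_corner[OF g wiener_diag[OF b], of j r j r]
    by (subst (asm) has_sum_pair_neutral[where s = r]) (auto simp: diag_coeffs_def cong: if_cong)
  then have "((\<lambda>l. \<Sum>r\<in>UNIV. if l < 0 then g (int j - l) r r * b (l - int j) else 0) has_sum
      (\<Sum>r\<in>UNIV. entry (pull nonneg_emb (laurent g * compr.P' * laurent (diag_coeffs b))) (j, r) (j, r))) UNIV"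
    by (rule has_sum_sum[OF finite_class.finite_UNIV])
  moreover have "(\<Sum>r\<in>UNIV. if l < 0 then g (int j - l) r r * b (l - int j) else 0)
      = (if l < 0 then (\<Sum>r\<in>UNIV. g (int j - l) r r) * b (l - int j) else 0)" for l
    by (simp add: sum_distrib_right)
  ultimately show ?thesis by (simp only:)
qed

theorem theorem2p3:
  fixes Q :: "complex \<Rightarrow> complex^'n^'n" and a :: "complex \<Rightarrow> complex"
  assumes "Q \<in> B_mat"
    and "\<And>z. z \<in> sphere 0 1 \<Longrightarrow> trace (Q z) = 0"
    and "a \<in> B_alg"
  shows "fredholm_det (toeplitz (\<lambda>z. mat_exp (mat (a z) + Q z))
                         o\<^sub>L op_exp (- toeplitz (\<lambda>z. mat (a z) + Q z)))
       = exp (of_nat CARD('n) / 2 * op_trace (hankel a o\<^sub>L hankel (circle_reflect a)))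
         * fredholm_det (toeplitz (\<lambda>z. mat_exp (Q z)) o\<^sub>L op_exp (- toeplitz Q))"
proof -
  define f where "f = fourier_coeff a"
  \<comment> \<open>Strictly negative frequencies only; the constant coefficient goes to the
    analytic part \<open>fp\<close>.\<close>
  define fm where "fm = (\<lambda>k. if k < 0 then f k else 0)"
  define fp where "fp = (\<lambda>k. if k < 0 then 0 else f k)"
  define q where "q = matrix_coeffs Q"
  define dm where "dm = (diag_coeffs fm :: 'n coeffs)"
  define dp where "dp = (diag_coeffs fp :: 'n coeffs)"
  let ?R = "\<lambda>z. mat (a z) + Q z"
  have fs: "(\<lambda>k. cmod (f k)) summable_on UNIV" "(\<lambda>k. \<bar>of_int k\<bar> * (cmod (f k))\<^sup>2) summable_on UNIV"
    using assms(3) by (simp_all add: B_alg_def f_def)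
  have s: "(\<lambda>k. cmod (fm k)) summable_on UNIV" "(\<lambda>k. cmod (fp k)) summable_on UNIV"
    by (rule summable_on_comparison_test[OF fs(1)]; simp add: fm_def fp_def)+
  have h: "(\<lambda>k. \<bar>of_int k\<bar> * (cmod (fm k))\<^sup>2) summable_on UNIV" "(\<lambda>k. \<bar>of_int k\<bar> * (cmod (fp k))\<^sup>2) summable_on UNIV"
    by (rule summable_on_comparison_test[OF fs(2)]; auto simp: fm_def fp_def mult_nonpos_nonneg)+
  have wm: "wiener dm" and wp: "wiener dp" and wq: "wiener q"
    unfolding dm_def dp_def q_def by (rule wiener_diag s wiener_matrix_coeffs assms)+
  have hsm: "half_smooth dm" and hsp: "half_smooth dp" and hsq: "half_smooth q"
    unfolding dm_def dp_def q_def by (rule half_smooth_diag h half_smooth_matrix_coeffs assms)+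
  have sum: "matrix_coeffs ?R = (\<lambda>k r s. (dm k r s + q k r s) + dp k r s)"
    unfolding B_mat_add_scalar(2)[OF assms(1,3)]
    by (auto simp: fun_eq_iff dm_def dp_def q_def diag_coeffs_def fm_def fp_def f_def)
  have L: "laurent (matrix_coeffs ?R) = laurent dm + laurent q + laurent dp"
    unfolding sum laurent_add[OF wiener_add[OF wm wq] wp] laurent_add[OF wm wq] ..
  obtain hm where hm: "compr.corners_hs hm (laurent dm)"
    using corners_laurent[OF wm hsm] .
  obtain hp where hp: "compr.corners_hs hp (laurent dp)"
    using corners_laurent[OF wp hsp] .
  obtain hq where hq: "compr.corners_hs hq (laurent q)"
    using corners_laurent[OF wq hsq] .
  have M0: "entry (laurent dm) (nonneg_emb i) k = 0" if "k \<notin> range nonneg_emb" for i k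
    using that unfolding range_nonneg_emb
    by (cases i, cases k) (simp add: nonneg_emb_def entry_laurent[OF wm], simp add: dm_def diag_coeffs_def fm_def)
  have A0: "entry (laurent dp) k (nonneg_emb j) = 0" if "k \<notin> range nonneg_emb" for k j
    using that unfolding range_nonneg_emb
    by (cases j, cases k) (simp add: nonneg_emb_def entry_laurent[OF wp], simp add: dp_def diag_coeffs_def fp_def)
  have comm: "laurent dm * laurent q = laurent q * laurent dm" "laurent dp * laurent q = laurent q * laurent dp"
    "laurent dm * laurent dp = laurent dp * laurent dm"
    unfolding dm_def dp_def
    by (rule laurent_diag_commute[OF wq s(1)], rule laurent_diag_commute[OF wq s(2)],
        rule laurent_diag_commute[OF wp[unfolded dp_def] s(1)])
  let ?t = "\<lambda>f g. cop_trace (pull nonneg_emb (laurent f * compr.P' * laurent g))"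
  have main: "gdet (pull nonneg_emb (exp (laurent dm + laurent q + laurent dp)) * exp (- pull nonneg_emb (laurent dm + laurent q + laurent dp)))
      = gdet (pull nonneg_emb (exp (laurent q)) * exp (- pull nonneg_emb (laurent q)))
        * exp ((?t dp q + ?t q dm + ?t dp dm) / 2)"
    by (rule compr.gdet_wiener_hopf[OF M0 A0 hm hq hp comm])
  have tr: "?t f g = (\<Sum>\<^sub>\<infinity>j. \<Sum>r\<in>UNIV. entry (pull nonneg_emb (laurent f * compr.P' * laurent g)) (j, r) (j, r))"
    if "compr.corners_hs b (laurent f)" "compr.corners_hs c (laurent g)" for f g :: "'n coeffs" and b c
    using that unfolding compr.corners_hs_def by (blast intro: cop_trace_pairs compr.nuc_pull_corner)
  have q0: "(\<Sum>r\<in>UNIV. q k r r) = 0" for k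
    unfolding q_def by (rule trace_matrix_coeffs[OF assms(1,2)])
  have zero: "x = 0" if "((\<lambda>l::int. 0) has_sum x) UNIV" for x :: complex
    using has_sum_unique[OF that has_sum_0] by simp
  \<comment> \<open>Both corner terms that involve \<open>Q\<close> contain the coefficients of its
    pointwise trace; this is where tracelessness enters.\<close>
  have "(\<Sum>r\<in>UNIV. entry (pull nonneg_emb (laurent dp * compr.P' * laurent q)) (j, r) (j, r)) = 0" for j
    by (rule zero) (use corner_diag_sum_left[OF s(2) wq, where j = j] in \<open>simp only: q0 mult_zero_right if_cancel dp_def\<close>)
  then have "?t dp q = 0"
    by (simp only: tr[OF hp hq] infsum_0_simp)
  moreover have "(\<Sum>r\<in>UNIV. entry (pull nonneg_emb (laurent q * compr.P' * laurent dm)) (j, r) (j, r)) = 0" for j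
    by (rule zero) (use corner_diag_sum_right[OF s(1) wq, where j = j] in \<open>simp only: q0 mult_zero_left if_cancel dm_def\<close>)
  then have "?t q dm = 0"
    by (simp only: tr[OF hq hm] infsum_0_simp)
  moreover have "?t dp dm = of_nat CARD('n) * op_trace (hankel a o\<^sub>L hankel (circle_reflect a))"
  proof -
    obtain H where H: "hankel a = op_of H" "\<And>j k. entry H j k = f (int j + int k + 1)"
      using hankel_cop[OF fs(1)[unfolded f_def]] unfolding f_def by blast
    have refl: "fourier_coeff (circle_reflect a) k = f (- k)" for k
      unfolding f_def by (rule fourier_coeff_reflect[OF assms(3)])
    have "(\<lambda>k. cmod (f (- k))) summable_on UNIV"
      using summable_on_reindex_bij_betw[OF bij_uminus, of "\<lambda>k. cmod (f k)"] fs(1) by simp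
    then obtain K where K: "hankel (circle_reflect a) = op_of K" "\<And>j k. entry K j k = f (- (int j + int k + 1))"
      using hankel_cop[of "circle_reflect a"] unfolding refl by blast
    have "(\<Sum>r\<in>UNIV. entry (pull nonneg_emb (laurent dp * compr.P' * laurent dm)) (j, r) (j, r)) = of_nat CARD('n) * entry (H * K) j j" for j
    proof -
      let ?g = "\<lambda>l. fp (int j - l) * (\<Sum>r\<in>(UNIV::'n set). dm (l - int j) r r)"
      have "((\<lambda>l. if l < 0 then ?g l else 0) has_sum
          (\<Sum>r\<in>UNIV. entry (pull nonneg_emb (laurent dp * compr.P' * laurent dm)) (j, r) (j, r))) UNIV"
        using corner_diag_sum_left[OF s(2) wm, folded dp_def] .
      then have "(?g has_sum (\<Sum>r\<in>UNIV. entry (pull nonneg_emb (laurent dp * compr.P' * laurent dm)) (j, r) (j, r))) {..<0}"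
        by (subst has_sum_cong_neutral[where T = UNIV and g = "\<lambda>l. if l < 0 then ?g l else 0"]) auto
      \<comment> \<open>With \<open>l = - 1 - k\<close> the differences \<open>j - l\<close> and
        \<open>l - j\<close> become \<open>j + k + 1\<close> and its negative, which accounts for
        the shift by 1 in the Hankel matrices.\<close>
      moreover have "bij_betw (\<lambda>k. - 1 - int k) UNIV {..<0}"
        by (rule bij_betw_byWitness[where f' = "\<lambda>l. nat (- 1 - l)"]) auto
      ultimately have "((\<lambda>k. ?g (- 1 - int k)) has_sum (\<Sum>r\<in>UNIV. entry (pull nonneg_emb (laurent dp * compr.P' * laurent dm)) (j, r) (j, r))) UNIV"
        by (subst has_sum_reindex_bij_betw[where f = ?g])
      moreover have "?g (- 1 - int k) = of_nat CARD('n) * (entry H j k * entry K k j)" for k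
        by (simp add: H K fp_def dm_def fm_def diag_coeffs_def algebra_simps)
      ultimately have "((\<lambda>k. of_nat CARD('n) * (entry H j k * entry K k j)) has_sum
          (\<Sum>r\<in>UNIV. entry (pull nonneg_emb (laurent dp * compr.P' * laurent dm)) (j, r) (j, r))) UNIV"
        by simp
      from has_sum_unique[OF this has_sum_cmult_right[OF entry_mult]] show ?thesis .
    qed
    then have "?t dp dm = of_nat CARD('n) * op_trace (op_of (H * K))"
      by (simp add: tr[OF hp hm] op_trace_op_of infsum_cmult_right')
    then show ?thesis by (simp add: H(1) K(1) times_cop.rep_eq)
  qed
  ultimately have "gdet (pull nonneg_emb (exp (laurent (matrix_coeffs ?R))) * exp (- pull nonneg_emb (laurent (matrix_coeffs ?R))))
      = gdet (pull nonneg_emb (exp (laurent q)) * exp (- pull nonneg_emb (laurent q)))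
        * exp (of_nat CARD('n) / 2 * op_trace (hankel a o\<^sub>L hankel (circle_reflect a)))"
    using main unfolding L by simp
  then show ?thesis
    unfolding toeplitz_B_mat[OF B_mat_add_scalar(1)[OF assms(1,3)]] toeplitz_B_mat[OF assms(1)] fredholm_det_exp_quotient
    by (simp add: q_def mult.commute)
qed

end
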